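(* Assume $\ell(\partial I)=0$, let $f\in L^2(I)$ and let $g_0$ be the solution to $BEP_{2,\infty}$. Then $|g_0|=1$ a.e. on $J$, unless $f=g_{|_I}$ for some $g\in H^2$ with $\|g\|_{L^\infty(J)}\le1$.
   Context: $\mathbb T$ is the unit circle, $\ell$ normalized Lebesgue measure. $I\subset\mathbb T$ measurable, $J=\mathbb T\setminus I$, $\ell(I)>0$, $\ell(J)>0$; $\partial I$ is the boundary of $I$ as a subset of $\mathbb T$. $\|h\|_{L^2(E)}=(\frac1{2\pi}\int_E|h|^2d\theta)^{1/2}$. $H^2$ is the Hardy space (boundary values in $L^2(\mathbb T)$ with vanishing negative Fourier coefficients). Problem $BEP_{2,\infty}$: given $f\in L^2(I)$, find $g_0\in H^2$ with $|g_0|\le 1$ a.e. on $J$ minimizing $\|f-g\|_{L^2(I)}$ over all $g\in H^2$ with $|g|\le1$ a.e. on $J$; it has a unique solution. *)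

theory Defs
  imports "HOL-Analysis.Analysis"
begin

definition circ :: "complex set" where
  "circ = sphere 0 1"

definition ang :: "complex set \<Rightarrow> real set" where
  "ang A = {t \<in> {0..<2*pi}. cis t \<in> A}"

definition ell :: "complex set \<Rightarrow> real" where
  "ell A = measure lebesgue (ang A) / (2*pi)"

definition circ_measurable :: "complex set \<Rightarrow> bool" where
  "circ_measurable A \<longleftrightarrow> A \<subseteq> circ \<and> ang A \<in> sets lebesgue"

definition AE_on :: "complex set \<Rightarrow> (complex \<Rightarrow> bool) \<Rightarrow> bool" where
  "AE_on E P \<longleftrightarrow> (AE t in lebesgue. t \<in> ang E \<longrightarrow> P (cis t))"

definition L2_on :: "complex set \<Rightarrow> (complex \<Rightarrow> complex) \<Rightarrow> bool" where
  "L2_on E h \<longleftrightarrow>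
     (\<lambda>t. indicator (ang E) t *\<^sub>R h (cis t)) \<in> borel_measurable lebesgue \<and>
     integrable lebesgue (\<lambda>t. indicator (ang E) t * (cmod (h (cis t)))\<^sup>2)"

definition L2_norm :: "complex set \<Rightarrow> (complex \<Rightarrow> complex) \<Rightarrow> real" where
  "L2_norm E h = sqrt ((LINT t:ang E|lebesgue. (cmod (h (cis t)))\<^sup>2) / (2*pi))"

definition fourier_coeff :: "(complex \<Rightarrow> complex) \<Rightarrow> int \<Rightarrow> complex" where
  "fourier_coeff g k = (LINT t:{0..<2*pi}|lebesgue. g (cis t) * cis (- (of_int k * t))) / (2*pi)"

definition H2 :: "(complex \<Rightarrow> complex) \<Rightarrow> bool" where
  "H2 g \<longleftrightarrow> L2_on circ g \<and> (\<forall>k::int. k < 0 \<longrightarrow> fourier_coeff g k = 0)"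

definition BEP_solution :: "complex set \<Rightarrow> (complex \<Rightarrow> complex) \<Rightarrow> (complex \<Rightarrow> complex) \<Rightarrow> bool" where
  "BEP_solution I f g0 \<longleftrightarrow>
     H2 g0 \<and> AE_on (circ - I) (\<lambda>z. cmod (g0 z) \<le> 1) \<and>
     (\<forall>g. H2 g \<and> AE_on (circ - I) (\<lambda>z. cmod (g z) \<le> 1) \<longrightarrow>
          L2_norm I (\<lambda>z. f z - g0 z) \<le> L2_norm I (\<lambda>z. f z - g z))"

end

(* Idea. Perturb g0 multiplicatively: if Psi is bounded, analytic and purely imaginary on J apart
   from a set E where |g0| <= 1 - delta, then g0 exp(s Psi) is a competitor for all small real s, so
   Re (integral over I of F Psi) = 0 with F = cnj (f - g0) * g0.
   Test functions come from bounded real h supported in I and E: its Herglotz transform H, obtained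
   as the limit of the transforms on smaller circles, has real part h. H itself may be unbounded, but
   Psi = N sinh(H/N) is bounded and still imaginary wherever h = 0.
   Since the boundary of I is null, E can be chosen at positive distance from I. Taking h supported
   in E, Fubini turns the condition into the vanishing on E of the Herglotz integral of Im F, which
   continues analytically across E; hence it vanishes in the disc and Im F = 0. Taking then
   h = sgn (Re F) gives F = 0, and g0 is nonzero almost everywhere, so f = g0 on I. *)
theory Submission
  imports Defs "HOL-Complex_Analysis.Complex_Analysis"
begin

section \<open>Integration over the circle\<close>

text \<open>Multiplying by \<open>exp (s * Psi)\<close> instead of adding keeps the constraint
  exact: where \<open>Psi\<close> is imaginary the modulus of \<open>g0\<close> is unchanged,
  elsewhere the slack absorbs a small factor. Both signs of \<open>s\<close> are allowed, so
  minimality yields an equation. The choice of \<open>sinh\<close> rests on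
  \<open>Re (sinh z) = sinh (Re z) * cos (Im z)\<close>, which vanishes with \<open>Re z\<close>,
  and on a bound for \<open>cmod (sinh z)\<close> by \<open>Re z\<close> alone, which ignores the
  unbounded conjugate function. The delicate point is the limit in N. If h is supported at positive
  distance from I, then H is bounded on I, so the limit is dominated and Fubini meets only bounded
  kernel values. If h lives on I itself, no such bound is at hand; but once F is known to be real,
  only \<open>cos (Im H / N)\<close> remains, which is bounded by 1. Hence Im F is treated before Re
  F.\<close>

definition mu :: "real measure" where
  "mu = lebesgue_on {0..<2*pi}"

lemma space_mu [simp]: "space mu = {0..<2*pi}"
  by (simp add: mu_def space_restrict_space)

lemma emeasure_mu_space: "emeasure mu (space mu) = ennreal (2*pi)"
  unfolding space_mu by (simp add: mu_def emeasure_restrict_space)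

interpretation mu: finite_measure mu
  by (rule finite_measureI) (use emeasure_mu_space in simp)

interpretation mu_pair: pair_sigma_finite mu mu ..

lemma measurable_mu_borel: "f \<in> borel_measurable borel \<Longrightarrow> f \<in> borel_measurable mu"
  unfolding mu_def by (intro measurable_restrict_space1 measurable_completion) simp

lemma measurable_id_mu [measurable]: "(\<lambda>t. t) \<in> borel_measurable mu"
  by (rule measurable_mu_borel) simp

lemma measurable_cis_mu [measurable]: "cis \<in> borel_measurable mu"
  by (intro measurable_mu_borel borel_measurable_continuous_onI continuous_intros)

lemma measure_mu_space [simp]: "measure mu {0..<2*pi} = 2*pi"
  using emeasure_mu_space by (simp add: measure_def)

lemma integral_mu_const [simp]: "(LINT t|mu. c) = (2*pi) *\<^sub>R (c::'a::{banach,second_countable_topology})"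
  by (subst lebesgue_integral_const) simp

lemma integrable_mu_bounded:
  fixes f :: "real \<Rightarrow> 'a::{banach,second_countable_topology}"
  assumes "f \<in> borel_measurable mu" "AE t in mu. norm (f t) \<le> C"
  shows "integrable mu f"
  using assms by (rule mu.integrable_const_bound[rotated])

lemma integrable_mu_mult_bounded:
  fixes f g :: "real \<Rightarrow> 'a::{banach,second_countable_topology,real_normed_field}"
  assumes "integrable mu f" "g \<in> borel_measurable mu" "AE t in mu. norm (g t) \<le> C"
  shows "integrable mu (\<lambda>t. f t * g t)"
proof (rule Bochner_Integration.integrable_bound)
  show "integrable mu (\<lambda>t. C * norm (f t))" using assms(1) by simp
  show "(\<lambda>t. f t * g t) \<in> borel_measurable mu"
    using assms(2) borel_measurable_integrable[OF assms(1)] by simp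
  show "AE t in mu. norm (f t * g t) \<le> norm (C * norm (f t))"
    using assms(3)
  proof eventually_elim
    case (elim t)
    then show ?case
      using mult_left_mono[of "norm (g t)" "\<bar>C\<bar>" "norm (f t)"]
      by (simp add: norm_mult abs_mult mult.commute)
  qed
qed

lemma integral_mu_cis:
  assumes "k \<noteq> (0::int)" shows "(LINT t|mu. cis (of_int k * t)) = 0"
proof -
  have "((\<lambda>t. cis (of_int k * t)) has_integral
      (cis (of_int k * (2*pi)) / (\<i> * of_int k) - cis (of_int k * 0) / (\<i> * of_int k))) {0..2*pi}"
    using assms
    by (intro fundamental_theorem_of_calculus)
       (auto intro!: derivative_eq_intros simp: has_vector_derivative_def scaleR_conv_of_real fun_eq_iff field_simps)
  moreover have "cis (of_int k * (2*pi)) = 1"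
    using cis_multiple_2pi[of "of_int k"] by (simp add: mult_ac)
  ultimately have hi: "((\<lambda>t. cis (of_int k * t)) has_integral 0) {0..2*pi}"
    by simp
  have "((\<lambda>t. cis (of_int k * t)) has_integral 0) {0..<2*pi}"
    using hi
    by (subst has_integral_spike_set_eq[where T="{0..2*pi}"]) (auto intro: negligible_subset[of "{2*pi}"])
  moreover have "integrable mu (\<lambda>t. cis (of_int k * t))"
    by (rule integrable_mu_bounded[where C=1])
       (auto intro!: measurable_mu_borel borel_measurable_continuous_onI continuous_intros)
  ultimately show ?thesis
    using has_integral_integral_lebesgue_on[of "{0..<2*pi}" "\<lambda>t. cis (of_int k * t)"]
    unfolding mu_def by (auto intro: has_integral_unique)
qed

lemma holomorphic_on_circle_measurable:
  assumes "W holomorphic_on ball 0 R" "R > 1"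
  shows "(\<lambda>t. W (cis t)) \<in> borel_measurable mu"
proof -
  have "continuous_on UNIV (W \<circ> cis)"
    by (rule continuous_on_compose)
       (use assms in \<open>auto intro!: continuous_intros continuous_on_subset[OF holomorphic_on_imp_continuous_on]\<close>)
  then show ?thesis
    by (auto intro!: measurable_mu_borel borel_measurable_continuous_onI simp: o_def)
qed

lemma holomorphic_on_circle_bounded:
  assumes "W holomorphic_on ball 0 R" "R > 1"
  obtains C where "\<And>t. cmod (W (cis t)) \<le> C"
proof -
  have "compact (W ` sphere 0 1)"
    by (rule compact_continuous_image)
       (use assms in \<open>auto intro!: continuous_on_subset[OF holomorphic_on_imp_continuous_on]\<close>)
  then obtain C where "\<forall>x\<in>W ` sphere 0 1. norm x \<le> C"
    using bounded_iff compact_imp_bounded by blast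
  then have "cmod (W (cis t)) \<le> C" for t
    by simp
  then show ?thesis using that by blast
qed

lemma integrable_mult_holomorphic:
  assumes "integrable mu g" "W holomorphic_on ball 0 R" "R > 1"
  shows "integrable mu (\<lambda>t. g t * W (cis t))"
proof -
  obtain C where "\<And>t. cmod (W (cis t)) \<le> C"
    using holomorphic_on_circle_bounded assms by blast
  then show ?thesis
    using assms holomorphic_on_circle_measurable by (intro integrable_mu_mult_bounded[where C=C]) auto
qed

text \<open>The condition \<open>coeff\<close> says that the negative Fourier coefficients of
  \<open>g\<close> vanish, so only the constant term of the power series of \<open>W\<close>
  survives. Later arguments use analyticity of \<open>g\<close> in this form.\<close>

lemma integral_mult_holomorphic:
  assumes g: "integrable mu g" and W: "W holomorphic_on ball 0 R" "R > 1"
    and coeff: "\<And>k::nat. k \<ge> 1 \<Longrightarrow> (LINT t|mu. g t * cis (real k * t)) = 0"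
  shows "(LINT t|mu. g t * W (cis t)) = W 0 * (LINT t|mu. g t)"
proof -
  define a where "a n = (deriv ^^ n) W 0 / fact n" for n
  have sums: "(\<lambda>n. a n * z ^ n) sums W z" if "cmod z < R" for z
    using holomorphic_power_series[OF W(1), of z] that by (simp add: a_def)
  \<comment> \<open>An intermediate radius makes the coefficients themselves absolutely summable,
    which bounds all partial sums on the circle at once.\<close>
  obtain R' where R': "1 < R'" "R' < R" using dense W(2) by blast
  have "summable (\<lambda>n. a n * (of_real R') ^ n)"
    using sums[of "of_real R'"] R' by (auto intro: sums_summable)
  from powser_insidea[OF this, of 1] R' have abs: "summable (\<lambda>n. cmod (a n))"
    by simp
  define S where "S N t = g t * (\<Sum>n<N. a n * cis t ^ n)" for N t
  have int1: "integrable mu (\<lambda>t. g t * cis (real n * t))" for n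
    using integrable_mult_holomorphic[OF g, of "\<lambda>z. z^n" 2]
    by (simp add: Complex.DeMoivre holomorphic_intros)
  have Sint: "(LINT t|mu. S N t) = (if N = 0 then 0 else a 0 * (LINT t|mu. g t))" for N
  proof -
    have "(LINT t|mu. S N t) = (\<Sum>n<N. LINT t|mu. a n * (g t * cis (real n * t)))"
      unfolding S_def sum_distrib_left using int1
      by (subst Bochner_Integration.integral_sum[symmetric]) (auto simp: Complex.DeMoivre mult_ac)
    also have "\<dots> = (\<Sum>n<N. if n = 0 then a 0 * (LINT t|mu. g t) else 0)"
      by (intro sum.cong) (auto simp: coeff)
    finally show ?thesis by simp
  qed
  have "(\<lambda>N. LINT t|mu. S N t) \<longlonglongrightarrow> (LINT t|mu. g t * W (cis t))"
  proof (rule integral_dominated_convergence)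
    show "(\<lambda>t. g t * W (cis t)) \<in> borel_measurable mu"
      using integrable_mult_holomorphic[OF g W] by simp
    show "S N \<in> borel_measurable mu" for N
      unfolding S_def
      by (rule borel_measurable_integrable,
          rule integrable_mult_holomorphic[OF g, of "\<lambda>z. (\<Sum>n<N. a n * z ^ n)" 2])
         (auto intro!: holomorphic_intros)
    show "integrable mu (\<lambda>t. (\<Sum>n. cmod (a n)) * cmod (g t))"
      using g by simp
    show "AE t in mu. (\<lambda>N. S N t) \<longlonglongrightarrow> g t * W (cis t)"
      unfolding S_def using sums W(2)
      by (intro AE_I2 tendsto_intros) (simp add: sums_def)
    have "cmod (\<Sum>n<N. a n * cis t ^ n) \<le> (\<Sum>n. cmod (a n))" for N t
    proof -
      have "cmod (\<Sum>n<N. a n * cis t ^ n) \<le> (\<Sum>n<N. cmod (a n))"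
        by (rule order_trans[OF norm_sum]) (simp add: norm_mult norm_power)
      also have "\<dots> \<le> (\<Sum>n. cmod (a n))"
        using abs by (intro sum_le_suminf) auto
      finally show ?thesis .
    qed
    then show "AE t in mu. norm (S N t) \<le> (\<Sum>n. cmod (a n)) * cmod (g t)" for N
      unfolding S_def by (intro AE_I2) (simp add: norm_mult mult.commute mult_left_mono)
  qed
  moreover have "(\<lambda>N. LINT t|mu. S N t) \<longlonglongrightarrow> a 0 * (LINT t|mu. g t)"
    unfolding Sint by (rule tendsto_eventually) (auto simp: eventually_sequentially intro!: exI[of _ 1])
  ultimately show ?thesis
    using LIMSEQ_unique by (force simp: a_def)
qed

lemma mean_value_circle:
  fixes W :: "complex \<Rightarrow> complex"
  assumes "W holomorphic_on ball 0 R" "R > 1"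
  shows "(LINT t|mu. W (cis t)) = W 0 * (2 * pi)"
  using integral_mult_holomorphic[of "\<lambda>t. 1", OF _ assms] integral_mu_cis[of "int _"]
  by (simp add: scaleR_conv_of_real)

section \<open>Density of real parts of polynomials in L1 of the circle\<close>

lemma inj_on_cis: "inj_on cis {0..<2*pi}"
proof (rule inj_onI)
  fix s t assume st: "s \<in> {0..<2*pi}" "t \<in> {0..<2*pi}" "cis s = cis t"
  then obtain n where n: "s = t + 2*pi * of_int n"
    by (metis sin_cos_eq_iff cis.sel)
  with st have "\<bar>2*pi * of_int n\<bar> < 2*pi * 1" by auto
  then have "\<bar>of_int n :: real\<bar> < 1" by (simp add: abs_mult)
  then have "n = 0" by linarith
  then show "s = t" using n by simp
qed

text \<open>Since \<open>z * cnj z = 1\<close> on the circle, splitting off the constant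
  coefficients of both factors leaves the same kind of product for the remaining polynomials, plus
  terms that are polynomials or conjugates of polynomials. This makes the real parts an algebra, as
  Stone-Weierstrass demands.\<close>

lemma Re_poly_mult_cnj:
  fixes p q :: "complex poly"
  shows "\<exists>s. \<forall>z. cmod z = 1 \<longrightarrow> Re (poly p z * cnj (poly q z)) = Re (poly s z)"
proof (induction p arbitrary: q)
  case 0
  then show ?case by (intro exI[of _ 0]) simp
next
  case (pCons a p)
  obtain b r where q: "q = pCons b r" by (cases q)
  obtain s where s: "\<And>z. cmod z = 1 \<Longrightarrow> Re (poly p z * cnj (poly r z)) = Re (poly s z)"
    using pCons.IH[of r] by blast
  have "Re (poly (pCons a p) z * cnj (poly q z)) =
      Re (poly (smult (cnj a) q + smult (cnj b) (pCons 0 p) + s) z)" if z: "cmod z = 1" for z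
  proof -
    have "z * cnj z = 1" using z by (simp add: complex_norm_square[symmetric])
    then have "poly (pCons a p) z * cnj (poly q z) =
        a * cnj (poly q z) + cnj b * (z * poly p z) + poly p z * cnj (poly r z)"
      unfolding q by (simp add: algebra_simps)
    moreover have "Re (a * cnj (poly q z)) = Re (cnj a * poly q z)" by simp
    ultimately show ?thesis using s[OF z] by (simp add: algebra_simps)
  qed
  then show ?case by blast
qed

lemma Re_poly_dense_continuous:
  fixes f :: "complex \<Rightarrow> real"
  assumes "continuous_on (sphere 0 1) f" "e > 0"
  obtains p where "\<And>z. cmod z = 1 \<Longrightarrow> \<bar>f z - Re (poly p z)\<bar> < e"
proof -
  let ?R = "{h. continuous_on (sphere 0 1) h \<and> (\<exists>p. \<forall>z. cmod z = 1 \<longrightarrow> h z = Re (poly p z))}"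
  interpret function_ring_on ?R "sphere (0::complex) 1"
  proof
    fix g h assume g: "g \<in> ?R" and h: "h \<in> ?R"
    then obtain p q where p: "\<And>z. cmod z = 1 \<Longrightarrow> g z = Re (poly p z)"
      and q: "\<And>z. cmod z = 1 \<Longrightarrow> h z = Re (poly q z)" by blast
    show "(\<lambda>x. g x + h x) \<in> ?R"
      using g h p q by (auto intro!: continuous_intros exI[of _ "p + q"])
    obtain s where s: "\<And>z. cmod z = 1 \<Longrightarrow> Re (poly p z * cnj (poly q z)) = Re (poly s z)"
      using Re_poly_mult_cnj by blast
    \<comment> \<open>Product of real parts:
      \<open>Re a * Re b = Re (a * b + a * cnj b) / 2\<close>.\<close>
    have "g z * h z = Re (poly (smult (1/2) (p * q + s)) z)" if "cmod z = 1" for z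
      using p[OF that] q[OF that] s[OF that, symmetric] by (simp add: field_simps)
    then show "(\<lambda>x. g x * h x) \<in> ?R"
      using g h
      by (intro CollectI conjI continuous_intros exI[of _ "smult (1/2) (p * q + s)"]) auto
  next
    fix c
    show "(\<lambda>_. c) \<in> ?R" by (auto intro!: exI[of _ "[:of_real c:]"])
  next
    fix x y :: complex assume "x \<noteq> y"
    then have "Re x \<noteq> Re y \<or> Im x \<noteq> Im y" by (simp add: complex_eq_iff)
    moreover have "Re \<in> ?R" by (auto intro!: continuous_intros exI[of _ "[:0,1:]"])
    moreover have "Im \<in> ?R" by (auto intro!: continuous_intros exI[of _ "[:0,-\<i>:]"])
    ultimately show "\<exists>f\<in>?R. f x \<noteq> f y" by blast
  qed auto
  from Stone_Weierstrass_basic[OF assms] obtain g where "g \<in> ?R" "\<forall>z\<in>sphere 0 1. \<bar>f z - g z\<bar> < e"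
    by blast
  moreover then obtain p where "\<And>z. cmod z = 1 \<Longrightarrow> g z = Re (poly p z)" by blast
  ultimately show ?thesis using that[of p] by auto
qed

text \<open>Inner regularity replaces \<open>A\<close> by a closed subset \<open>T\<close> with
  compact image under \<open>cis\<close>; steep tents over that image converge to the indicator of
  \<open>T\<close>. Distances are taken between the points \<open>cis t\<close>, so continuity
  across the angle 0 is automatic.\<close>

lemma indicator_dense_continuous:
  assumes A: "A \<in> sets mu" and e: "e > 0"
  shows "\<exists>f. continuous_on UNIV f \<and> (\<forall>z. \<bar>f z\<bar> \<le> 1) \<and>
    (LINT t|mu. \<bar>indicator A t - f (cis t)\<bar>) < (e::real)"
proof -
  have A': "A \<in> sets lebesgue" "A \<subseteq> {0..<2*pi}"
    using A sets.sets_into_space[OF A] by (auto simp: mu_def sets_restrict_space_iff)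
  obtain T where T: "closed T" "T \<subseteq> A" "A - T \<in> lmeasurable"
    "emeasure lebesgue (A - T) < ennreal (e/2)"
    using sets_lebesgue_inner_closed[OF A'(1), of "e/2"] e by auto
  have Tmu: "T \<in> sets mu"
    using T A' unfolding mu_def
    by (subst sets_restrict_space_iff) (auto simp: borel_closed)
  have "T \<subseteq> {0..2*pi}" using T(2) A'(2) by force
  then have "bounded T" using bounded_subset[OF bounded_closed_interval] by blast
  then have "compact T" using T(1) compact_eq_bounded_closed by blast
  then have K: "compact (cis ` T)"
    by (intro compact_continuous_image continuous_intros)
  have inT: "cis t \<in> cis ` T \<longleftrightarrow> t \<in> T" if "t \<in> {0..<2*pi}" for t
    using inj_on_image_mem_iff[OF inj_on_cis that] T(2) A'(2) by blast
  \<comment> \<open>\<open>infdist\<close> to the empty set is 0, which would produce the constant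
    1; hence the separate value for \<open>T = {}\<close>.\<close>
  define f where "f n z = (if T = {} then 0 else max 0 (1 - infdist z (cis ` T) * real n))" for n z
  have f01: "0 \<le> f n z" "f n z \<le> 1" for n z
    by (auto simp: f_def infdist_nonneg)
  have cont: "continuous_on UNIV (f n)" for n
    unfolding f_def by (cases "T = {}") (auto intro!: continuous_intros)
  have lim: "(\<lambda>n. f n (cis t)) \<longlonglongrightarrow> indicator T t" if t: "t \<in> {0..<2*pi}" for t
  proof (cases "t \<in> T")
    case True
    then have "infdist (cis t) (cis ` T) = 0" by (intro infdist_zero) auto
    with True have "f n (cis t) = 1" for n by (auto simp: f_def)
    with True show ?thesis by simp
  next
    case False
    show ?thesis
    proof (cases "T = {}")
      case False
      with \<open>t \<notin> T\<close> have "infdist (cis t) (cis ` T) > 0"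
        using inT[OF t] K by (metis compact_imp_closed image_is_empty infdist_pos_not_in_closed)
      then have "filterlim (\<lambda>n. infdist (cis t) (cis ` T) * real n) at_top sequentially"
        by (intro filterlim_tendsto_pos_mult_at_top[OF tendsto_const] filterlim_real_sequentially)
      then have "\<forall>\<^sub>F n in sequentially. infdist (cis t) (cis ` T) * real n \<ge> 1"
        by (simp add: filterlim_at_top)
      then have "\<forall>\<^sub>F n in sequentially. f n (cis t) = 0"
        by eventually_elim (simp add: f_def)
      then show ?thesis using \<open>t \<notin> T\<close> by (simp add: tendsto_eventually)
    qed (simp add: f_def)
  qed
  have fm: "(\<lambda>t. f n (cis t)) \<in> borel_measurable mu" for n
    using measurable_compose[OF measurable_cis_mu borel_measurable_continuous_onI[OF cont]] .
  have "(\<lambda>n. LINT t|mu. \<bar>indicator A t - f n (cis t)\<bar>) \<longlonglongrightarrow> (LINT t|mu. \<bar>indicator A t - indicator T t\<bar> :: real)"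
  proof (rule integral_dominated_convergence)
    show "integrable mu (\<lambda>t. 2 :: real)" by simp
    show "AE x in mu. (\<lambda>i. \<bar>indicator A x - f i (cis x)\<bar>) \<longlonglongrightarrow> \<bar>indicator A x - indicator T x\<bar>"
      using lim by (intro AE_I2 tendsto_intros) auto
    have "norm \<bar>indicator A x - f i (cis x)\<bar> \<le> 2" for i x
      using f01[of i "cis x"] by (auto simp: indicator_def)
    then show "AE x in mu. norm \<bar>indicator A x - f i (cis x)\<bar> \<le> 2" for i
      by simp
  qed (use A Tmu fm in auto)
  also have "(LINT t|mu. \<bar>indicator A t - indicator T t\<bar> :: real) = (LINT t|mu. indicator (A - T) t)"
    using T(2) by (intro Bochner_Integration.integral_cong) (auto simp: indicator_def)
  also have "\<dots> = measure mu (A - T)"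
    using A Tmu A'(2) by (simp add: Int_absorb2 subset_iff)
  also have "\<dots> = measure lebesgue (A - T)"
    unfolding mu_def using A'(2) by (subst measure_restrict_space) auto
  finally have L: "(\<lambda>n. LINT t|mu. \<bar>indicator A t - f n (cis t)\<bar>) \<longlonglongrightarrow> measure lebesgue (A - T)" .
  have "measure lebesgue (A - T) < e"
    using T(3,4) e by (simp add: emeasure_eq_measure2 ennreal_less_iff)
  from order_tendstoD(2)[OF L this] obtain n where "(LINT t|mu. \<bar>indicator A t - f n (cis t)\<bar>) < e"
    by (auto simp: eventually_sequentially)
  then show ?thesis using cont f01 by (intro exI[of _ "f n"]) auto
qed

lemma holomorphic_on_poly: "poly (p :: complex poly) holomorphic_on S"
  unfolding holomorphic_on_def field_differentiable_def
  by (blast intro: poly_DERIV has_field_derivative_at_within)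

lemma Re_poly_circle_integrable: "integrable mu (\<lambda>t. Re (poly p (cis t)))"
  using integrable_mult_holomorphic[of "\<lambda>t. 1" "poly p" 2] holomorphic_on_poly[of p]
  by (intro integrable_Re) simp

lemma Re_poly_dense_L1:
  fixes u :: "real \<Rightarrow> real"
  assumes "integrable mu u" "e > 0"
  shows "\<exists>p. (LINT t|mu. \<bar>u t - Re (poly p (cis t))\<bar>) < e"
  using assms
proof (induction arbitrary: e rule: integrable_induct)
  case (base A c)
  \<comment> \<open>Two errors of \<open>e/2\<close>: \<open>\<bar>c\<bar> * d < e/2\<close>, where
    the summand 1 covers \<open>c = 0\<close>, and the uniform error \<open>e/(4*pi)\<close> times
    the total mass \<open>2*pi\<close>.\<close>
  define d where "d = e / (2 * (1 + \<bar>c\<bar>))"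
  have d: "d > 0" using base by (simp add: d_def)
  obtain f where f: "continuous_on UNIV f" "\<And>z. \<bar>f z\<bar> \<le> (1::real)"
      "(LINT t|mu. \<bar>indicator A t - f (cis t)\<bar>) < d"
    using indicator_dense_continuous[OF base(1) d] by blast
  have "continuous_on (sphere 0 1) (\<lambda>z. c * f z)"
    using f(1) by (intro continuous_intros) (auto intro: continuous_on_subset)
  from Re_poly_dense_continuous[OF this, of "e/(4*pi)"] base(3)
  obtain p where p: "\<And>z. cmod z = 1 \<Longrightarrow> \<bar>c * f z - Re (poly p z)\<bar> < e/(4*pi)"
    by auto
  have fm: "(\<lambda>t. f (cis t)) \<in> borel_measurable mu"
    using measurable_compose[OF measurable_cis_mu borel_measurable_continuous_onI[OF f(1)]] .
  have fint: "integrable mu (\<lambda>t. f (cis t))"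
    using fm f(2) by (intro integrable_mu_bounded[where C=1]) auto
  have Aint: "integrable mu (indicator A :: real \<Rightarrow> real)"
    using base by (intro integrable_real_indicator) auto
  note ints = fint Aint Re_poly_circle_integrable[of p]
  have "(LINT t|mu. \<bar>indicator A t *\<^sub>R c - Re (poly p (cis t))\<bar>) \<le>
      (LINT t|mu. \<bar>c\<bar> * \<bar>indicator A t - f (cis t)\<bar> + e/(4*pi))"
  proof (rule integral_mono)
    fix t
    have "\<bar>indicator A t *\<^sub>R c - Re (poly p (cis t))\<bar> \<le>
       \<bar>c * (indicator A t - f (cis t))\<bar> + \<bar>c * f (cis t) - Re (poly p (cis t))\<bar>"
      using abs_triangle_ineq[of "c * (indicator A t - f (cis t))" "c * f (cis t) - Re (poly p (cis t))"]
      by (simp add: algebra_simps)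
    also have "\<dots> \<le> \<bar>c\<bar> * \<bar>indicator A t - f (cis t)\<bar> + e/(4*pi)"
      using p[of "cis t"] by (simp add: abs_mult)
    finally show "\<bar>indicator A t *\<^sub>R c - Re (poly p (cis t))\<bar> \<le> \<dots>" .
  qed (use ints in auto)
  also have "\<dots> = \<bar>c\<bar> * (LINT t|mu. \<bar>indicator A t - f (cis t)\<bar>) + e/2"
    using ints by (subst Bochner_Integration.integral_add) auto
  also have "\<bar>c\<bar> * (LINT t|mu. \<bar>indicator A t - f (cis t)\<bar>) \<le> \<bar>c\<bar> * d"
    using f(3) by (intro mult_left_mono) auto
  also have "\<bar>c\<bar> * d < e/2"
    using base(3) by (simp add: d_def field_simps)
  finally show ?case by (intro exI[of _ p]) auto
next
  case (add f g)
  obtain p where p: "(LINT t|mu. \<bar>f t - Re (poly p (cis t))\<bar>) < e/2"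
    using add.IH(1)[of "e/2"] add.prems by auto
  obtain q where q: "(LINT t|mu. \<bar>g t - Re (poly q (cis t))\<bar>) < e/2"
    using add.IH(2)[of "e/2"] add.prems by auto
  note ints = add.hyps Re_poly_circle_integrable[of p] Re_poly_circle_integrable[of q]
    Re_poly_circle_integrable[of "p+q"]
  have "(LINT t|mu. \<bar>f t + g t - Re (poly (p + q) (cis t))\<bar>) \<le>
     (LINT t|mu. \<bar>f t - Re (poly p (cis t))\<bar> + \<bar>g t - Re (poly q (cis t))\<bar>)"
    by (rule integral_mono) (use ints in auto)
  also have "\<dots> < e"
    using p q ints by (subst Bochner_Integration.integral_add) auto
  finally show ?case by blast
next
  case (lim f s)
  have "(\<lambda>i. LINT t|mu. \<bar>f t - s i t\<bar>) \<longlonglongrightarrow> (LINT t|mu. \<bar>f t - f t\<bar>)"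
  proof (rule integral_dominated_convergence)
    \<comment> \<open>The approximants satisfy
      \<open>\<bar>s i x\<bar> \<le> 2 * \<bar>f x\<bar>\<close>, which gives the factor 3 for the
      differences.\<close>
    show "integrable mu (\<lambda>t. 3 * \<bar>f t\<bar>)" using lim by simp
    show "AE x in mu. (\<lambda>i. \<bar>f x - s i x\<bar>) \<longlonglongrightarrow> \<bar>f x - f x\<bar>"
      using lim by (intro AE_I2 tendsto_intros) auto
    have "norm \<bar>f x - s i x\<bar> \<le> 3 * \<bar>f x\<bar>" if "x \<in> space mu" for i x
      using lim(3)[OF that, of i] abs_triangle_ineq4[of "f x" "s i x"] by auto
    then show "AE x in mu. norm \<bar>f x - s i x\<bar> \<le> 3 * \<bar>f x\<bar>" for i
      by (intro AE_I2) blast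
  qed (use lim in auto)
  then have "(\<lambda>i. LINT t|mu. \<bar>f t - s i t\<bar>) \<longlonglongrightarrow> 0" by simp
  from order_tendstoD(2)[OF this, of "e/2"] lim.prems
  obtain i where i: "(LINT t|mu. \<bar>f t - s i t\<bar>) < e/2"
    by (auto simp: eventually_sequentially)
  obtain p where p: "(LINT t|mu. \<bar>s i t - Re (poly p (cis t))\<bar>) < e/2"
    using lim.IH[of "e/2" i] lim.prems by auto
  note ints = lim.hyps Re_poly_circle_integrable[of p]
  have "(LINT t|mu. \<bar>f t - Re (poly p (cis t))\<bar>) \<le>
     (LINT t|mu. \<bar>f t - s i t\<bar> + \<bar>s i t - Re (poly p (cis t))\<bar>)"
    by (rule integral_mono) (use ints in auto)
  also have "\<dots> < e"
    using p i ints by (subst Bochner_Integration.integral_add) auto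
  finally show ?case by blast
qed

section \<open>The Herglotz transform\<close>

text \<open>Difference quotients converge by domination. The distance condition concerns only the
  support of \<open>q\<close>, so the statement serves inside the disc as well as for continuation
  across the circle away from that support.\<close>

lemma cauchy_transform_holomorphic:
  fixes q :: "real \<Rightarrow> complex"
  assumes q: "integrable mu q" and S: "open S"
    and away: "\<And>w. w \<in> S \<Longrightarrow> \<exists>d>0. \<forall>s. q s \<noteq> 0 \<longrightarrow> d \<le> dist (cis s) w"
  shows "(\<lambda>w. LINT s|mu. q s / (cis s - w)) holomorphic_on S"
proof -
  have "(\<lambda>w. LINT s|mu. q s / (cis s - w)) field_differentiable at x" if x: "x \<in> S" for x
  proof -
    obtain d where d: "d > 0" "\<And>s. q s \<noteq> 0 \<Longrightarrow> d \<le> dist (cis s) x"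
      using away[OF x] by blast
    \<comment> \<open>Half the distance survives for every point near \<open>x\<close>, so the
      denominators are bounded below uniformly.\<close>
    have far: "d/2 \<le> cmod (cis s - w)" if "q s \<noteq> 0" "dist w x < d/2" for s w
      using d(2)[OF that(1)] that(2) dist_triangle[of "cis s" x w] by (simp add: dist_norm)
    have bnd: "cmod (q s / ((cis s - w) * (cis s - v))) \<le> cmod (q s) * (4/d^2)"
      if "dist w x < d/2" "dist v x < d/2" for s w v
    proof (cases "q s = 0")
      case False
      have "d/2 * (d/2) \<le> cmod (cis s - w) * cmod (cis s - v)"
        using far[OF False that(1)] far[OF False that(2)] d(1) by (intro mult_mono) auto
      then have "cmod (q s) / (cmod (cis s - w) * cmod (cis s - v)) \<le> cmod (q s) / (d/2 * (d/2))"
        using d(1) by (intro frac_le) auto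
      then show ?thesis by (simp add: norm_divide norm_mult power2_eq_square)
    qed simp
    have meas[measurable]: "(\<lambda>s. q s / (cis s - w)) \<in> borel_measurable mu" for w
      using q by simp
    have int: "integrable mu (\<lambda>s. q s / (cis s - w))" if w: "dist w x < d/2" for w
    proof (rule Bochner_Integration.integrable_bound)
      show "integrable mu (\<lambda>s. cmod (q s) * (2/d))" using q by simp
      have "cmod (q s / (cis s - w)) \<le> cmod (q s) * (2/d)" for s
      proof (cases "q s = 0")
        case False
        then have "cmod (q s) / cmod (cis s - w) \<le> cmod (q s) / (d/2)"
          using far[OF False w] d(1) by (intro frac_le) auto
        then show ?thesis by (simp add: norm_divide)
      qed simp
      then show "AE s in mu. norm (q s / (cis s - w)) \<le> norm (cmod (q s) * (2/d))"
        using d(1) by simp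
    qed (rule meas)
    have "((\<lambda>w. LINT s|mu. q s / (cis s - w)) has_field_derivative
        (LINT s|mu. q s / ((cis s - x) * (cis s - x)))) (at x)"
      unfolding has_field_derivative_iff
    proof (subst tendsto_at_iff_sequentially, intro allI impI)
      fix X :: "nat \<Rightarrow> complex"
      assume X: "\<forall>i. X i \<in> UNIV - {x}" "X \<longlonglongrightarrow> x"
      then obtain N where N: "\<And>n. n \<ge> N \<Longrightarrow> dist (X n) x < d/2"
        using d(1) unfolding lim_sequentially by (meson half_gt_zero)
      have eq: "((LINT s|mu. q s / (cis s - X (n + N))) - (LINT s|mu. q s / (cis s - x))) / (X (n + N) - x) =
          (LINT s|mu. q s / ((cis s - X (n + N)) * (cis s - x)))" for n
      proof -
        let ?w = "X (n + N)"
        have ne: "?w \<noteq> x" using X by auto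
        have "(LINT s|mu. q s / (cis s - ?w)) - (LINT s|mu. q s / (cis s - x)) =
            (LINT s|mu. q s / (cis s - ?w) - q s / (cis s - x))"
          using int N d(1) by (intro Bochner_Integration.integral_diff[symmetric]) auto
        also have "\<dots> = (LINT s|mu. q s / ((cis s - ?w) * (cis s - x)) * (?w - x))"
        proof (rule Bochner_Integration.integral_cong)
          fix s
          show "q s / (cis s - ?w) - q s / (cis s - x) = q s / ((cis s - ?w) * (cis s - x)) * (?w - x)"
          proof (cases "q s = 0")
            case False
            have "cis s - ?w \<noteq> 0" "cis s - x \<noteq> 0"
              using far[OF False N[of "n+N"]] far[OF False, of x] d(1) by auto
            then show ?thesis by (simp add: divide_simps) (simp add: algebra_simps)
          qed simp
        qed simp
        also have "\<dots> = (LINT s|mu. q s / ((cis s - ?w) * (cis s - x))) * (?w - x)"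
          by (rule integral_mult_left_zero)
        finally show ?thesis using ne by simp
      qed
      have "(\<lambda>n. LINT s|mu. q s / ((cis s - X (n + N)) * (cis s - x))) \<longlonglongrightarrow>
          (LINT s|mu. q s / ((cis s - x) * (cis s - x)))"
      proof (rule integral_dominated_convergence)
        show "integrable mu (\<lambda>s. cmod (q s) * (4/d^2))" using q by simp
        show "AE s in mu. norm (q s / ((cis s - X (n + N)) * (cis s - x))) \<le> cmod (q s) * (4/d^2)" for n
          using N[of "n+N"] d(1) bnd[of "X (n+N)" x] by simp
        have "(\<lambda>n. q s / ((cis s - X (n + N)) * (cis s - x))) \<longlonglongrightarrow> q s / ((cis s - x) * (cis s - x))" for s
        proof (cases "q s = 0")
          case False
          then have "cis s - x \<noteq> 0" using far[of s x] d(1) by auto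
          then show ?thesis using LIMSEQ_ignore_initial_segment[OF X(2), of N]
            by (intro tendsto_intros) auto
        qed simp
        then show "AE s in mu. (\<lambda>n. q s / ((cis s - X (n + N)) * (cis s - x))) \<longlonglongrightarrow> q s / ((cis s - x) * (cis s - x))"
          by simp
      qed (use q in auto)
      then show "((\<lambda>y. ((LINT s|mu. q s / (cis s - y)) - (LINT s|mu. q s / (cis s - x))) / (y - x)) \<circ> X) \<longlonglongrightarrow>
          (LINT s|mu. q s / ((cis s - x) * (cis s - x)))"
        unfolding o_def eq[symmetric] by (rule LIMSEQ_offset)
    qed
    then show ?thesis by (auto simp: field_differentiable_def)
  qed
  then show ?thesis
    using S by (simp add: holomorphic_on_open field_differentiable_def)
qed

text \<open>On the disc the real part is the Poisson integral of \<open>u\<close> and the imaginary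
  part its conjugate function, normalised to vanish at 0. The formula is also evaluated at points of
  the circle away from the support of \<open>u\<close>.\<close>

definition herglotz :: "(real \<Rightarrow> real) \<Rightarrow> complex \<Rightarrow> complex" where
  "herglotz u z = (LINT s|mu. u s * ((cis s + z) / (cis s - z))) / (2*pi)"

lemma dist_cis_ge: "1 - cmod z \<le> dist (cis s) z"
  using norm_triangle_ineq2[of "cis s" z] by (simp add: dist_norm)

lemma herglotz_kernel_split:
  "cis s \<noteq> z \<Longrightarrow> (cis s + z) / (cis s - z) = 2 * cis s / (cis s - z) - 1"
  by (simp add: field_simps)

lemma herglotz_kernel_bound:
  assumes "d > 0" "d \<le> dist (cis s) z"
  shows "cmod ((cis s + z) / (cis s - z)) \<le> 2/d + 1"
proof -
  have ne: "cis s \<noteq> z" using assms by auto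
  have "cmod ((cis s + z) / (cis s - z)) \<le> cmod (2 * cis s / (cis s - z)) + 1"
    unfolding herglotz_kernel_split[OF ne] using norm_triangle_ineq4 by (metis norm_one)
  also have "cmod (2 * cis s / (cis s - z)) \<le> 2 / d"
    using assms frac_le[of 2 2 d "cmod (cis s - z)"] by (simp add: norm_divide norm_mult dist_norm)
  finally show ?thesis by simp
qed

lemma herglotz_integrable:
  fixes u :: "real \<Rightarrow> real"
  assumes u: "integrable mu u" and d: "d > 0" "\<And>s. u s \<noteq> 0 \<Longrightarrow> d \<le> dist (cis s) z"
  shows "integrable mu (\<lambda>s. u s * ((cis s + z) / (cis s - z)))"
proof (rule Bochner_Integration.integrable_bound)
  show "integrable mu (\<lambda>s. \<bar>u s\<bar> * (2/d + 1))" using u by simp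
  show "AE s in mu. norm (u s * ((cis s + z) / (cis s - z))) \<le> norm (\<bar>u s\<bar> * (2/d + 1))"
  proof (rule AE_I2)
    fix s
    show "norm (u s * ((cis s + z) / (cis s - z))) \<le> norm (\<bar>u s\<bar> * (2/d + 1))"
      using mult_left_mono[OF herglotz_kernel_bound[OF d(1), of s z], of "\<bar>u s\<bar>"] d
      unfolding norm_mult by (cases "u s = 0") auto
  qed
qed (use u in auto)

text \<open>Up to a factor and an additive constant this is the Cauchy transform of
  \<open>u s * cis s\<close>; the freedom in \<open>S\<close> later permits continuation beyond the
  disc.\<close>

lemma herglotz_holomorphic_away:
  fixes u :: "real \<Rightarrow> real"
  assumes u: "integrable mu u" and S: "open S"
    and away: "\<And>w. w \<in> S \<Longrightarrow> \<exists>d>0. \<forall>s. u s \<noteq> 0 \<longrightarrow> d \<le> dist (cis s) w"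
  shows "herglotz u holomorphic_on S"
proof -
  have int: "integrable mu (\<lambda>s. u s * cis s)"
    using u by (intro integrable_mu_mult_bounded[where C=1]) auto
  have hol: "(\<lambda>w. LINT s|mu. u s * cis s / (cis s - w)) holomorphic_on S"
    using away by (intro cauchy_transform_holomorphic int S) auto
  have eq: "herglotz u w = (2 * (LINT s|mu. u s * cis s / (cis s - w)) - of_real (LINT s|mu. u s)) / (2*pi)"
    if w: "w \<in> S" for w
  proof -
    obtain d where d: "d > 0" "\<And>s. u s \<noteq> 0 \<Longrightarrow> d \<le> dist (cis s) w"
      using away[OF w] by blast
    have pt: "u s * cis s / (cis s - w) = (u s * ((cis s + w) / (cis s - w)) + u s) / 2" for s
    proof (cases "u s = 0")
      case False
      then have "cis s \<noteq> w" using d by fastforce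
      define k where "k = cis s / (cis s - w)"
      have "(cis s + w) / (cis s - w) = 2 * k - 1"
        using herglotz_kernel_split[OF \<open>cis s \<noteq> w\<close>] by (simp add: k_def)
      moreover have "u s * cis s / (cis s - w) = u s * k" by (simp add: k_def)
      ultimately have "u s * cis s / (cis s - w) = u s * k"
          "u s * ((cis s + w) / (cis s - w)) = u s * (2 * k - 1)"
        by simp_all
      then show ?thesis by (simp only:) (simp add: algebra_simps)
    qed simp
    have "(LINT s|mu. u s * cis s / (cis s - w)) =
       ((LINT s|mu. u s * ((cis s + w) / (cis s - w))) + of_real (LINT s|mu. u s)) / 2"
      unfolding pt using herglotz_integrable[OF u d] u by simp
    then show ?thesis by (simp add: herglotz_def eq_diff_eq mult.commute)
  qed
  have "(\<lambda>w. (2 * (LINT s|mu. u s * cis s / (cis s - w)) - of_real (LINT s|mu. u s)) / (2*pi)) holomorphic_on S"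
    by (intro holomorphic_intros hol) auto
  then show ?thesis using eq by (simp cong: holomorphic_cong)
qed

lemma herglotz_holomorphic:
  assumes "integrable mu u" shows "herglotz u holomorphic_on ball 0 1"
  by (rule herglotz_holomorphic_away[OF assms])
     (auto intro!: exI[of _ "1 - cmod _"] dist_cis_ge)

text \<open>The circle integrals above require holomorphy beyond the closed disc; dilates have it,
  and boundary values arise as their limits.\<close>

lemma herglotz_dilate_holomorphic:
  assumes "integrable mu u" "0 < r" "r < 1"
  shows "(\<lambda>z. herglotz u (r * z)) holomorphic_on ball 0 (1/r)"
proof (rule holomorphic_on_compose_gen[OF _ herglotz_holomorphic[OF assms(1)], unfolded o_def])
  show "(\<lambda>z. complex_of_real r * z) holomorphic_on ball 0 (1/r)" by (intro holomorphic_intros)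
  show "(\<lambda>z. complex_of_real r * z) ` ball 0 (1/r) \<subseteq> ball 0 1"
    using assms by (auto simp: norm_mult pos_less_divide_eq mult.commute)
qed

lemma herglotz_0: "herglotz u 0 = (LINT s|mu. u s) / (2*pi)"
  by (simp add: herglotz_def)

section \<open>Poisson kernel: positivity, mass, L1 contraction\<close>

definition poisson :: "real \<Rightarrow> complex \<Rightarrow> real" where
  "poisson s z = Re ((cis s + z) / (cis s - z))"

text \<open>As a function of \<open>cis s\<close> the kernel has its pole at \<open>z\<close>,
  inside the disc. Conjugation reflects the pole to \<open>1 / cnj z\<close>, outside, so the
  conjugate kernel has a power series converging beyond the circle.\<close>

lemma herglotz_kernel_cnj:
  "(cis s + z) / (cis s - z) = cnj ((1 + cnj z * cis s) / (1 - cnj z * cis s))"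
proof -
  have c: "cnj (cis s) * cis s = 1" by (simp add: cis_cnj cis_mult)
  have "(cis s + z) / (cis s - z) = (cnj (cis s) * (cis s + z)) / (cnj (cis s) * (cis s - z))"
    by simp
  also have "\<dots> = (1 + z * cnj (cis s)) / (1 - z * cnj (cis s))"
    using c by (simp add: algebra_simps)
  finally show ?thesis by simp
qed

lemma poisson_nonneg:
  assumes "cmod z \<le> 1" shows "poisson s z \<ge> 0"
proof -
  have "Re ((cis s + z) * cnj (cis s - z)) = 1 - (cmod z)^2"
    by (simp add: cmod_power2 algebra_simps) (metis add.commute power2_eq_square sin_cos_squared_add)
  moreover have "(cmod z)^2 \<le> 1" using assms by (simp add: power_le_one)
  ultimately show ?thesis
    unfolding poisson_def by (subst complex_div_cnj) (simp add: Re_divide_of_real flip: of_real_power)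
qed

lemma integral_mult_herglotz_kernel:
  assumes v: "integrable mu v" "\<And>k::nat. k \<ge> 1 \<Longrightarrow> (LINT s|mu. v s * cis (real k * s)) = 0"
    and z: "cmod z < 1"
  shows "(LINT s|mu. v s * cnj ((cis s + z) / (cis s - z))) = (LINT s|mu. v s)"
proof -
  \<comment> \<open>The radius must exceed 1 and still keep the reflected pole
    \<open>1 / cnj z\<close> outside; for \<open>z = 0\<close> there is no pole.\<close>
  obtain R where R: "R > 1" "R * cmod z < 1"
  proof (cases "z = 0")
    case False
    then obtain R where "1 < R" "R < 1 / cmod z" using dense[of 1 "1/cmod z"] z by auto
    then show ?thesis using that[of R] False by (simp add: field_simps)
  qed (use that[of 2] in auto)
  have ne: "1 \<noteq> cnj z * w" if "cmod w < R" for w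
  proof
    assume "1 = cnj z * w"
    then have "1 = cmod z * cmod w" by (metis complex_mod_cnj norm_mult norm_one)
    also have "\<dots> \<le> cmod z * R" using that by (intro mult_left_mono) auto
    finally show False using R by (simp add: mult.commute)
  qed
  have "(\<lambda>w. (1 + cnj z * w) / (1 - cnj z * w)) holomorphic_on ball 0 R"
    using ne by (intro holomorphic_intros) auto
  from integral_mult_holomorphic[OF v(1) this R(1) v(2)] show ?thesis
    unfolding herglotz_kernel_cnj by simp
qed

lemma herglotz_kernel_integrable:
  assumes "cmod z < 1" shows "integrable mu (\<lambda>s. (cis s + z) / (cis s - z))"
  using herglotz_integrable[of "\<lambda>_. 1" "1 - cmod z" z] assms dist_cis_ge by simp

lemma integral_herglotz_kernel:
  assumes "cmod z < 1" shows "(LINT s|mu. (cis s + z) / (cis s - z)) = complex_of_real (2 * pi)"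
proof -
  have "(LINT s|mu. cnj ((cis s + z) / (cis s - z))) = 2 * pi"
    using integral_mult_herglotz_kernel[of "\<lambda>_. 1" z, OF _ _ assms] integral_mu_cis[of "int _"]
    by (simp add: scaleR_conv_of_real)
  then have "cnj (LINT s|mu. (cis s + z) / (cis s - z)) = 2 * pi"
    by (simp only: Bochner_Integration.integral_cnj)
  from arg_cong[OF this, of cnj] show ?thesis
    by (simp only: complex_cnj_cnj complex_cnj_complex_of_real)
qed

lemma integral_poisson:
  assumes "cmod z < 1" shows "(LINT s|mu. poisson s z) = 2 * pi"
  unfolding poisson_def integral_Re[OF herglotz_kernel_integrable[OF assms]]
    integral_herglotz_kernel[OF assms] by (simp only: Re_complex_of_real)

lemma Re_herglotz:
  fixes u :: "real \<Rightarrow> real"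
  assumes u: "integrable mu u" and z: "cmod z < 1"
  shows "Re (herglotz u z) = (LINT s|mu. u s * poisson s z) / (2*pi)"
proof -
  have "integrable mu (\<lambda>s. u s * ((cis s + z) / (cis s - z)))"
    using z by (intro herglotz_integrable[OF u, of "1 - cmod z"] dist_cis_ge) auto
  from integral_Re[OF this] have "(LINT s|mu. u s * poisson s z) = Re (LINT s|mu. u s * ((cis s + z) / (cis s - z)))"
    by (simp add: poisson_def del: times_divide_eq_right)
  moreover have "Re (x / (2 * of_real pi)) = Re x / (2 * pi)" for x
    using Re_divide_of_real[of x "2 * pi"] by simp
  ultimately show ?thesis unfolding herglotz_def by (simp del: times_divide_eq_right)
qed

lemma poisson_bound:
  assumes "cmod z < 1" shows "\<bar>poisson s z\<bar> \<le> 2 / (1 - cmod z) + 1"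
  using herglotz_kernel_bound[of "1 - cmod z" s z] assms dist_cis_ge[of z s]
    abs_Re_le_cmod[of "(cis s + z) / (cis s - z)"]
  by (simp add: poisson_def)

lemma poisson_measurable [measurable]: "(\<lambda>s. poisson s z) \<in> borel_measurable mu"
  unfolding poisson_def by simp

text \<open>The Poisson kernel is nonnegative with total mass \<open>2*pi\<close>, so the real part
  is an average of \<open>u\<close>.\<close>

lemma Re_herglotz_bound:
  fixes u :: "real \<Rightarrow> real"
  assumes u: "integrable mu u" and z: "cmod z < 1" and C: "AE s in mu. \<bar>u s\<bar> \<le> C"
  shows "\<bar>Re (herglotz u z)\<bar> \<le> C"
proof -
  have p: "integrable mu (\<lambda>s. poisson s z)"
    using poisson_bound[OF z] by (intro integrable_mu_bounded) auto
  have up: "integrable mu (\<lambda>s. u s * poisson s z)"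
    using poisson_bound[OF z] by (intro integrable_mu_mult_bounded[OF u]) auto
  have "\<bar>LINT s|mu. u s * poisson s z\<bar> \<le> (LINT s|mu. \<bar>u s * poisson s z\<bar>)"
    by (rule integral_abs_bound)
  also have "\<dots> \<le> (LINT s|mu. C * poisson s z)"
  proof (rule integral_mono_AE)
    show "AE s in mu. \<bar>u s * poisson s z\<bar> \<le> C * poisson s z"
      using C by eventually_elim (use poisson_nonneg[of z] z in \<open>auto simp: abs_mult intro!: mult_right_mono\<close>)
  qed (use p up in auto)
  also have "\<dots> = C * (2 * pi)" using integral_poisson[OF z] by simp
  finally show ?thesis
    unfolding Re_herglotz[OF u z] by (simp add: abs_divide field_simps)
qed

text \<open>Prepares Fubini. The bound is asked only where \<open>u s\<close> is nonzero, because
  the cotangent kernel met later blows up on the diagonal and is bounded only between separated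
  supports.\<close>

lemma integrable_pair_kernel:
  fixes u :: "real \<Rightarrow> 'a::{banach,second_countable_topology,real_normed_field}"
  assumes u: "integrable mu u"
    and k[measurable]: "(\<lambda>(s,t). k s t) \<in> borel_measurable (mu \<Otimes>\<^sub>M mu)"
    and bnd: "\<And>s t. u s \<noteq> 0 \<Longrightarrow> norm (k s t) \<le> C"
  shows "integrable (mu \<Otimes>\<^sub>M mu) (\<lambda>(s,t). u s * k s t)"
proof (rule mu_pair.Fubini_integrable)
  have [measurable]: "u \<in> borel_measurable mu" using u by simp
  show "(\<lambda>(s,t). u s * k s t) \<in> borel_measurable (mu \<Otimes>\<^sub>M mu)"
    by (measurable)
  have b: "norm (u s * k s t) \<le> norm (u s) * \<bar>C\<bar>" for s t
    using bnd[of s t] by (cases "u s = 0") (auto simp: norm_mult intro!: mult_left_mono)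
  have meas: "(\<lambda>t. u s * k s t) \<in> borel_measurable mu" if "s \<in> space mu" for s
    using that by measurable
  have int: "integrable mu (\<lambda>t. u s * k s t)" if "s \<in> space mu" for s
    using b by (intro integrable_mu_bounded[OF meas[OF that]]) auto
  then show "AE s in mu. integrable mu (\<lambda>t. case (s, t) of (s, t) \<Rightarrow> u s * k s t)"
    by (auto intro!: AE_I2)
  show "integrable mu (\<lambda>s. LINT t|mu. norm (case (s, t) of (s, t) \<Rightarrow> u s * k s t))"
  proof (rule Bochner_Integration.integrable_bound)
    show "integrable mu (\<lambda>s. norm (u s) * \<bar>C\<bar> * (2*pi))" using u by simp
    show "AE s in mu. norm (LINT t|mu. norm (case (s, t) of (s, t) \<Rightarrow> u s * k s t)) \<le>
        norm (norm (u s) * \<bar>C\<bar> * (2*pi))"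
    proof (rule AE_I2)
      fix s assume s: "s \<in> space mu"
      have "(LINT t|mu. norm (u s * k s t)) \<le> (LINT t|mu. norm (u s) * \<bar>C\<bar>)"
        using int[OF s] b by (intro integral_mono) auto
      also have "\<dots> = norm (u s) * \<bar>C\<bar> * (2*pi)" by simp
      finally have "(LINT t|mu. norm (u s * k s t)) \<le> norm (u s) * \<bar>C\<bar> * (2*pi)" .
      then show "norm (LINT t|mu. norm (case (s, t) of (s, t) \<Rightarrow> u s * k s t)) \<le>
        norm (norm (u s) * \<bar>C\<bar> * (2*pi))"
        by (simp add: abs_mult)
    qed
  qed measurable
qed

lemma poisson_dilate_measurable:
  "(\<lambda>(s,t). poisson s (r * cis t)) \<in> borel_measurable (mu \<Otimes>\<^sub>M mu)"
  unfolding poisson_def by measurable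

text \<open>For a fixed radius the kernel depends on \<open>s - t\<close> only and is even in it, so
  the two angles exchange roles.\<close>

lemma poisson_dilate_integral:
  fixes r :: real
  assumes "0 < r" "r < 1"
  shows "(LINT t|mu. poisson s (r * cis t)) = 2 * pi"
proof -
  define A where "A s t = of_real r * cis (s - t)" for s t
  have P: "poisson s (r * cis t) = Re ((1 + A t s) / (1 - A t s))" for s t
    unfolding poisson_def herglotz_kernel_cnj A_def by (simp add: cis_cnj cis_mult mult.assoc)
  have "(1 + A s t) / (1 - A s t) = cnj ((1 + A t s) / (1 - A t s))" for t
    by (simp add: A_def cis_cnj)
  then have "poisson s (r * cis t) = poisson t (r * cis s)" for t
    using P[of s t] P[of t s] by (metis cnj.sel(1))
  then show ?thesis
    using integral_poisson[of "r * cis s"] assms by (simp add: norm_mult)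
qed

text \<open>Fubini with a positive kernel of mass \<open>2*pi\<close> in the second angle. The bound
  is uniform in \<open>r\<close>, which lets L1 convergence pass from polynomials to every
  \<open>u\<close>.\<close>

lemma Re_herglotz_contraction:
  fixes u :: "real \<Rightarrow> real" and r :: real
  assumes u: "integrable mu u" and r: "0 < r" "r < 1"
  shows "(LINT t|mu. \<bar>Re (herglotz u (r * cis t))\<bar>) \<le> (LINT t|mu. \<bar>u t\<bar>)"
proof -
  have z: "cmod (r * cis t) < 1" for t using r by (simp add: norm_mult)
  define k where "k s t = poisson s (r * cis t)" for s t
  have kb: "\<bar>k s t\<bar> \<le> 2 / (1 - r) + 1" for s t
    using poisson_bound[OF z, of s t] r by (simp add: k_def norm_mult)
  have km: "(\<lambda>(s,t). k s t) \<in> borel_measurable (mu \<Otimes>\<^sub>M mu)"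
    unfolding k_def by (rule poisson_dilate_measurable)
  have int: "integrable (mu \<Otimes>\<^sub>M mu) (\<lambda>(s,t). \<bar>u s\<bar> * k s t)"
    using u kb km by (intro integrable_pair_kernel[where C="2 / (1 - r) + 1"]) auto
  have k0: "k s t \<ge> 0" for s t using poisson_nonneg[of "r * cis t" s] z[of t] by (simp add: k_def)
  have kmeas: "(\<lambda>s. k s t) \<in> borel_measurable mu" for t
    unfolding k_def by measurable
  have I: "integrable mu (\<lambda>s. u s * k s t)" for t
    using kb by (intro integrable_mu_mult_bounded[OF u kmeas]) auto
  have "(LINT t|mu. \<bar>Re (herglotz u (r * cis t))\<bar>) \<le> (LINT t|mu. (LINT s|mu. \<bar>u s\<bar> * k s t) / (2*pi))"
  proof (rule integral_mono)
    show "integrable mu (\<lambda>t. \<bar>Re (herglotz u (r * cis t))\<bar>)"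
      using integrable_mult_holomorphic[of "\<lambda>_. 1", OF _ herglotz_dilate_holomorphic[OF u r]] r
      by (auto intro!: integrable_abs integrable_Re)
    show "integrable mu (\<lambda>t. (LINT s|mu. \<bar>u s\<bar> * k s t) / (2*pi))"
      using mu_pair.integrable_snd[OF int] by simp
    fix t
    have "\<bar>LINT s|mu. u s * k s t\<bar> \<le> (LINT s|mu. \<bar>u s * k s t\<bar>)"
      by (rule integral_abs_bound)
    also have "\<dots> = (LINT s|mu. \<bar>u s\<bar> * k s t)" using k0 by (simp add: abs_mult)
    finally show "\<bar>Re (herglotz u (r * cis t))\<bar> \<le> (LINT s|mu. \<bar>u s\<bar> * k s t) / (2*pi)"
      unfolding Re_herglotz[OF u z] k_def[symmetric] by (simp add: abs_divide divide_right_mono)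
  qed
  also have "\<dots> = (LINT t|mu. LINT s|mu. \<bar>u s\<bar> * k s t) / (2*pi)" by simp
  also have "(LINT t|mu. LINT s|mu. \<bar>u s\<bar> * k s t) = (LINT s|mu. LINT t|mu. \<bar>u s\<bar> * k s t)"
    by (rule mu_pair.Fubini_integral[OF int])
  also have "\<dots> = (LINT s|mu. \<bar>u s\<bar> * (2 * pi))"
    using poisson_dilate_integral[OF r] by (simp add: k_def)
  finally show ?thesis by (simp add: mult.commute)
qed

text \<open>Cauchy's formula by induction instead of contour integration:
  \<open>k = cis s / (cis s - z)\<close> satisfies \<open>cis s * k = cis s + z * k\<close>, so
  multiplying the polynomial by its variable yields a factor \<open>z\<close> and a term of mean
  zero.\<close>

lemma integral_poly_cauchy_kernel:
  assumes z: "cmod z < 1"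
  shows "integrable mu (\<lambda>s. poly p (cis s) * (cis s / (cis s - z)))"
    and "(LINT s|mu. poly p (cis s) * (cis s / (cis s - z))) = 2 * pi * poly p z"
proof -
  have ne: "cis s \<noteq> z" for s using z by auto
  have m: "(\<lambda>s. poly p (cis s)) \<in> borel_measurable mu" for p
    by (rule holomorphic_on_circle_measurable[OF holomorphic_on_poly, of 2]) simp
  have int: "integrable mu (\<lambda>s. poly p (cis s) * (cis s / (cis s - z)))" for p
  proof -
    obtain C where C: "\<And>t. cmod (poly p (cis t)) \<le> C"
      using holomorphic_on_circle_bounded[OF holomorphic_on_poly, of 2] by auto
    have "cmod (cis s / (cis s - z)) \<le> 1 / (1 - cmod z)" for s
      using dist_cis_ge[of z s] frac_le[of 1 1 "1 - cmod z" "cmod (cis s - z)"] z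
      by (simp add: norm_divide dist_norm)
    then have "cmod (poly p (cis s) * (cis s / (cis s - z))) \<le> C * (1 / (1 - cmod z))" for s
      unfolding norm_mult using C[of s] order_trans[OF norm_ge_zero C]
      by (intro mult_mono) auto
    then show ?thesis using m[of p] by (intro integrable_mu_bounded) auto
  qed
  show "integrable mu (\<lambda>s. poly p (cis s) * (cis s / (cis s - z)))" by (rule int)
  have one: "(LINT s|mu. cis s / (cis s - z)) = 2 * pi"
  proof -
    have pt: "cis s / (cis s - z) = ((cis s + z) / (cis s - z) + 1) / 2" for s
      using ne[of s] by (simp add: field_simps)
    have "(LINT s|mu. cis s / (cis s - z)) = ((LINT s|mu. (cis s + z) / (cis s - z)) + 2 * pi) / 2"
      unfolding pt using herglotz_kernel_integrable[OF z] by (simp add: scaleR_conv_of_real)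
    then show ?thesis using integral_herglotz_kernel[OF z] by simp
  qed
  show "(LINT s|mu. poly p (cis s) * (cis s / (cis s - z))) = 2 * pi * poly p z"
  proof (induction p)
    case (pCons a p)
    have "poly (pCons a p) (cis s) * (cis s / (cis s - z)) =
        a * (cis s / (cis s - z)) + poly p (cis s) * cis s + z * (poly p (cis s) * (cis s / (cis s - z)))" for s
    proof -
      define k where "k = cis s / (cis s - z)"
      have "cis s * k = cis s + z * k" using ne[of s] by (simp add: k_def field_simps)
      then have "poly p (cis s) * (cis s * k) = poly p (cis s) * (cis s + z * k)" by simp
      then show ?thesis unfolding k_def[symmetric] by (simp add: algebra_simps)
    qed
    moreover have "(LINT s|mu. poly p (cis s) * cis s) = 0"
      using mean_value_circle[OF holomorphic_on_poly, of 2 "p * [:0,1:]"] by (simp add: mult.commute)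
    moreover have "integrable mu (\<lambda>s. poly p (cis s) * cis s)"
      using integrable_mult_holomorphic[of "\<lambda>_. 1", OF _ holomorphic_on_poly, of 2 "p * [:0,1:]"] by (simp add: mult.commute)
    moreover have "integrable mu (\<lambda>s. cis s / (cis s - z))" using int[of 1] by simp
    ultimately show ?case using int[of p] pCons one by (simp add: algebra_simps del: times_divide_eq_right)
  qed simp
qed

text \<open>With \<open>Re x * Re k = Re (x * k + x * cnj k) / 2\<close>, Cauchy's formula evaluates
  the first product and \<open>integral_mult_herglotz_kernel\<close> the second; the two means of
  the polynomial cancel.\<close>

lemma Re_herglotz_Re_poly:
  assumes z: "cmod z < 1"
  shows "Re (herglotz (\<lambda>s. Re (poly p (cis s))) z) = Re (poly p z)"
proof -
  let ?k = "\<lambda>s. (cis s + z) / (cis s - z)"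
  have ne: "cis s \<noteq> z" for s using z by auto
  have pint: "integrable mu (\<lambda>s. poly p (cis s))"
    using integrable_mult_holomorphic[of "\<lambda>_. 1", OF _ holomorphic_on_poly, of 2 p] by simp
  have k1: "poly p (cis s) * ?k s = 2 * (poly p (cis s) * (cis s / (cis s - z))) - poly p (cis s)" for s
    unfolding herglotz_kernel_split[OF ne] by (simp add: algebra_simps)
  have i1: "integrable mu (\<lambda>s. poly p (cis s) * ?k s)"
    unfolding k1 using integral_poly_cauchy_kernel(1)[OF z] pint
    by (intro Bochner_Integration.integrable_diff integrable_mult_right)
  have e1: "(LINT s|mu. poly p (cis s) * ?k s) = 4 * pi * poly p z - (LINT s|mu. poly p (cis s))"
    unfolding k1 using integral_poly_cauchy_kernel[OF z] pint by (simp del: times_divide_eq_right)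
  have "(\<lambda>s. cnj (?k s)) \<in> borel_measurable mu"
    using herglotz_kernel_integrable[OF z] by (intro borel_measurable_integrable integrable_cnj)
  then have i2: "integrable mu (\<lambda>s. poly p (cis s) * cnj (?k s))"
  proof (rule integrable_mu_mult_bounded[OF pint])
    show "AE s in mu. norm (cnj (?k s)) \<le> 2 / (1 - cmod z) + 1"
      using herglotz_kernel_bound[of "1 - cmod z" _ z] dist_cis_ge z
      by (intro AE_I2) (simp only: complex_mod_cnj)
  qed
  have e2: "(LINT s|mu. poly p (cis s) * cnj (?k s)) = (LINT s|mu. poly p (cis s))"
  proof (rule integral_mult_herglotz_kernel[OF pint _ z])
    fix k :: nat assume "k \<ge> 1"
    then show "(LINT s|mu. poly p (cis s) * cis (real k * s)) = 0"
      using mean_value_circle[OF holomorphic_on_poly, of 2 "p * monom 1 k"]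
      by (simp add: poly_monom Complex.DeMoivre)
  qed
  have Re_mult: "Re x * Re k = Re ((x * k + x * cnj k) / 2)" for x k
    by simp
  have pt: "Re (poly p (cis s)) * poisson s z = Re ((poly p (cis s) * ?k s + poly p (cis s) * cnj (?k s)) / 2)" for s
    unfolding poisson_def by (rule Re_mult)
  have "(LINT s|mu. Re (poly p (cis s)) * poisson s z) =
      Re (LINT s|mu. (poly p (cis s) * ?k s + poly p (cis s) * cnj (?k s)) / 2)"
    unfolding pt using i1 i2 by (subst integral_Re) (auto simp del: times_divide_eq_right)
  also have "(LINT s|mu. (poly p (cis s) * ?k s + poly p (cis s) * cnj (?k s)) / 2) = 2 * pi * poly p z"
    using i1 i2 e1 e2 by (simp del: times_divide_eq_right)
  finally show ?thesis
    unfolding Re_herglotz[OF Re_poly_circle_integrable z] by simp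
qed

text \<open>The sum of the norms has finite integral, hence is finite almost everywhere. This
  upgrades fast mean convergence to pointwise convergence.\<close>

lemma AE_summable_of_L1_summable:
  fixes f :: "nat \<Rightarrow> 'a \<Rightarrow> 'b::{banach,second_countable_topology}"
  assumes f: "\<And>n. integrable M (f n)" and c: "\<And>n. (LINT x|M. norm (f n x)) \<le> c n" "summable c"
  shows "AE x in M. summable (\<lambda>n. norm (f n x))"
proof -
  have c0: "c n \<ge> 0" for n
    using c(1)[of n] by (rule order_trans[rotated]) (simp add: integral_nonneg_AE)
  have "(\<integral>\<^sup>+x. (\<Sum>n. ennreal (norm (f n x))) \<partial>M) = (\<Sum>n. \<integral>\<^sup>+x. ennreal (norm (f n x)) \<partial>M)"
    using f by (intro nn_integral_suminf) auto
  also have "\<dots> = (\<Sum>n. ennreal (LINT x|M. norm (f n x)))"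
    using f by (intro suminf_cong nn_integral_eq_integral) auto
  also have "\<dots> \<le> (\<Sum>n. ennreal (c n))"
    using c(1) by (intro suminf_le ennreal_leI) auto
  also have "\<dots> = ennreal (\<Sum>n. c n)"
    using c0 c(2) by (intro suminf_ennreal2) auto
  finally have "(\<integral>\<^sup>+x. (\<Sum>n. ennreal (norm (f n x))) \<partial>M) \<noteq> \<infinity>"
    by (auto simp: top_unique)
  then have "AE x in M. (\<Sum>n. ennreal (norm (f n x))) \<noteq> \<infinity>"
    using f by (intro nn_integral_PInf_AE) auto
  then show ?thesis
    by eventually_elim (rule summable_suminf_not_top; simp)
qed

section \<open>Radial limits of the Herglotz transform\<close>

lemma herglotz_diff:
  fixes u v :: "real \<Rightarrow> real"
  assumes u: "integrable mu u" and v: "integrable mu v" and z: "cmod z < 1"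
  shows "herglotz (\<lambda>s. u s - v s) z = herglotz u z - herglotz v z"
proof -
  have i: "integrable mu (\<lambda>s. w s * ((cis s + z) / (cis s - z)))" if "integrable mu w" for w :: "real \<Rightarrow> real"
    using z by (intro herglotz_integrable[OF that, of "1 - cmod z"] dist_cis_ge) auto
  show ?thesis
    unfolding herglotz_def diff_divide_distrib[symmetric]
    using i[OF u] i[OF v] by (simp add: left_diff_distrib del: times_divide_eq_right)
qed

lemma herglotz_circle_integrable:
  fixes r :: real
  assumes "integrable mu u" "0 < r" "r < 1"
  shows "integrable mu (\<lambda>t. herglotz u (r * cis t))"
  using integrable_mult_holomorphic[of "\<lambda>_. 1", OF _ herglotz_dilate_holomorphic[OF assms]] assms
  by simp

text \<open>Split \<open>u\<close> into the real part of a polynomial, whose dilates converge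
  boundedly, and a remainder small in L1, whose dilates remain small by
  \<open>Re_herglotz_contraction\<close>. The three errors are \<open>e/3\<close> each.\<close>

lemma Re_herglotz_tendsto_L1:
  fixes u :: "real \<Rightarrow> real" and r :: "nat \<Rightarrow> real"
  assumes u: "integrable mu u" and r: "\<And>n. 0 < r n" "\<And>n. r n < 1" "r \<longlonglongrightarrow> 1"
  shows "(\<lambda>n. LINT t|mu. \<bar>Re (herglotz u (r n * cis t)) - u t\<bar>) \<longlonglongrightarrow> 0"
proof (rule tendstoI)
  fix e :: real assume e: "e > 0"
  obtain p where p: "(LINT t|mu. \<bar>u t - Re (poly p (cis t))\<bar>) < e/3"
    using Re_poly_dense_L1[OF u, of "e/3"] e by auto
  define v where "v t = u t - Re (poly p (cis t))" for t
  note pint = Re_poly_circle_integrable[of p]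
  have v: "integrable mu v" unfolding v_def using u pint by simp
  have pr: "integrable mu (\<lambda>t. Re (poly p (r n * cis t)))" for n
    using Re_poly_circle_integrable[of "pcompose p [:0, of_real (r n):]"]
    by (simp add: poly_pcompose mult.commute)
  obtain C where C: "\<And>z. cmod z \<le> 1 \<Longrightarrow> cmod (poly p z) \<le> C"
  proof -
    have "compact (poly p ` cball 0 1)" by (intro compact_continuous_image continuous_intros) auto
    then obtain C where "\<forall>x\<in>poly p ` cball 0 1. cmod x \<le> C"
      using bounded_iff compact_imp_bounded by blast
    then show ?thesis using that[of C] by simp
  qed
  have "(\<lambda>n. LINT t|mu. \<bar>Re (poly p (r n * cis t)) - Re (poly p (cis t))\<bar>) \<longlonglongrightarrow>
      (LINT t|mu. \<bar>Re (poly p (cis t)) - Re (poly p (cis t))\<bar>)"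
  proof (rule integral_dominated_convergence)
    show "integrable mu (\<lambda>t. 2 * C)" by simp
    have "norm \<bar>Re (poly p (r n * cis t)) - Re (poly p (cis t))\<bar> \<le> 2 * C" for n t
    proof -
      have "cmod (r n * cis t) \<le> 1" using r(1)[of n] r(2)[of n] by (simp add: norm_mult)
      from C[OF this] have "\<bar>Re (poly p (r n * cis t))\<bar> \<le> C"
        using abs_Re_le_cmod order_trans by blast
      moreover have "\<bar>Re (poly p (cis t))\<bar> \<le> C"
        using C[of "cis t"] abs_Re_le_cmod[of "poly p (cis t)"] by simp
      ultimately show ?thesis by simp
    qed
    then show "AE t in mu. norm \<bar>Re (poly p (r n * cis t)) - Re (poly p (cis t))\<bar> \<le> 2 * C" for n
      by simp
    have "(\<lambda>n. poly p (r n * cis t)) \<longlonglongrightarrow> poly p (of_real 1 * cis t)" for t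
      using r(3) by (intro tendsto_intros)
    then have "(\<lambda>n. \<bar>Re (poly p (r n * cis t)) - Re (poly p (cis t))\<bar>) \<longlonglongrightarrow>
        \<bar>Re (poly p (of_real 1 * cis t)) - Re (poly p (cis t))\<bar>" for t
      by (intro tendsto_rabs tendsto_diff tendsto_Re tendsto_const)
    then show "AE t in mu. (\<lambda>n. \<bar>Re (poly p (r n * cis t)) - Re (poly p (cis t))\<bar>) \<longlonglongrightarrow>
        \<bar>Re (poly p (cis t)) - Re (poly p (cis t))\<bar>"
      by simp
  qed (use pr pint in auto)
  then have "(\<lambda>n. LINT t|mu. \<bar>Re (poly p (r n * cis t)) - Re (poly p (cis t))\<bar>) \<longlonglongrightarrow> 0" by simp
  from order_tendstoD(2)[OF this, of "e/3"] e
  have "\<forall>\<^sub>F n in sequentially. (LINT t|mu. \<bar>Re (poly p (r n * cis t)) - Re (poly p (cis t))\<bar>) < e/3" by simp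
  then show "\<forall>\<^sub>F n in sequentially. dist (LINT t|mu. \<bar>Re (herglotz u (r n * cis t)) - u t\<bar>) 0 < e"
  proof eventually_elim
    case (elim n)
    have z: "cmod (r n * cis t) < 1" for t using r(1,2)[of n] by (simp add: norm_mult)
    have hv: "integrable mu (\<lambda>t. Re (herglotz v (r n * cis t)))"
      using herglotz_circle_integrable[OF v r(1,2)] by (intro integrable_Re)
    have hu: "integrable mu (\<lambda>t. Re (herglotz u (r n * cis t)))"
      using herglotz_circle_integrable[OF u r(1,2)] by (intro integrable_Re)
    have "Re (herglotz v (r n * cis t)) = Re (herglotz u (r n * cis t)) - Re (poly p (r n * cis t))" for t
      unfolding v_def herglotz_diff[OF u pint z] by (simp add: Re_herglotz_Re_poly[OF z])
    then have "(LINT t|mu. \<bar>Re (herglotz u (r n * cis t)) - u t\<bar>) \<le>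
       (LINT t|mu. \<bar>Re (herglotz v (r n * cis t))\<bar> + \<bar>Re (poly p (r n * cis t)) - Re (poly p (cis t))\<bar> + \<bar>v t\<bar>)"
      using hu u hv v pr[of n] pint
      by (intro integral_mono) (auto simp: v_def)
    also have "\<dots> = (LINT t|mu. \<bar>Re (herglotz v (r n * cis t))\<bar>) +
        (LINT t|mu. \<bar>Re (poly p (r n * cis t)) - Re (poly p (cis t))\<bar>) + (LINT t|mu. \<bar>v t\<bar>)"
      using hv v pr[of n] pint by simp
    also have "\<dots> < e"
      using Re_herglotz_contraction[OF v r(1,2)[of n]] elim p unfolding v_def by linarith
    finally show ?case by simp
  qed
qed

text \<open>Differences \<open>D\<close> of transforms on two circles vanish at the origin, so \<open>D\<^sup>2\<close> has mean zero and
  the mean of \<open>|D|\<^sup>2\<close> is twice that of \<open>(Re D)\<^sup>2\<close>: convergence of the real parts suffices.\<close>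

lemma herglotz_boundary_values:
  fixes u :: "real \<Rightarrow> real"
  assumes um: "u \<in> borel_measurable mu" and C: "\<And>s. \<bar>u s\<bar> \<le> C"
  obtains r :: "nat \<Rightarrow> real" and H :: "complex \<Rightarrow> complex"
  where "\<And>n. 0 < r n" "\<And>n. r n < 1" "r \<longlonglongrightarrow> 1"
    "(\<lambda>t. H (cis t)) \<in> borel_measurable mu"
    "AE t in mu. (\<lambda>n. herglotz u (r n * cis t)) \<longlonglongrightarrow> H (cis t)"
    "AE t in mu. Re (H (cis t)) = u t"
proof -
  have u: "integrable mu u" using um C by (intro integrable_mu_bounded[where C=C]) auto
  have C0: "C \<ge> 0" using C[of 0] by linarith
  \<comment> \<open>The radii are \<open>1 - 1/(n+2)\<close>, positive already at
    \<open>n = 0\<close>.\<close>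
  define q :: "nat \<Rightarrow> real" where "q n = 1 + - inverse (real (Suc (Suc n)))" for n
  have q: "0 < q n" "q n < 1" for n by (auto simp: q_def field_simps)
  have qlim: "q \<longlonglongrightarrow> 1"
    unfolding q_def by (rule LIMSEQ_Suc) (rule LIMSEQ_inverse_real_of_nat_add_minus)
  define K where "K n t = herglotz u (q n * cis t)" for n t
  have Ki: "integrable mu (K n)" for n
    unfolding K_def by (rule herglotz_circle_integrable[OF u q])
  define a where "a n = (LINT t|mu. \<bar>Re (K n t) - u t\<bar>)" for n
  have alim: "a \<longlonglongrightarrow> 0"
    unfolding a_def K_def by (rule Re_herglotz_tendsto_L1[OF u q qlim])
  have ReK: "\<bar>Re (K n t)\<bar> \<le> C" for n t
    unfolding K_def using q[of n] C by (intro Re_herglotz_bound[OF u]) (auto simp: norm_mult)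
  \<comment> \<open>The constant comes from bounding one factor of the squared real part by
    \<open>2 * C\<close> and the other by its distance to \<open>u\<close>, then doubling.\<close>
  have sq: "(LINT t|mu. (cmod (K n t - K m t))\<^sup>2) \<le> 4 * C * (a n + a m)"
    and sqi: "integrable mu (\<lambda>t. (cmod (K n t - K m t))\<^sup>2)" for n m
  proof -
    define W where "W z = herglotz u (q n * z) - herglotz u (q m * z)" for z :: complex
    define R where "R = min (1 / q n) (1 / q m)"
    have R: "R > 1" using q[of n] q[of m] by (auto simp: R_def)
    have W: "W holomorphic_on ball 0 R"
      unfolding W_def
      by (intro holomorphic_on_diff holomorphic_on_subset[OF herglotz_dilate_holomorphic[OF u q]])
         (auto simp: R_def)
    have KW: "K n t - K m t = W (cis t)" for t by (simp add: K_def W_def)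
    have W2: "(\<lambda>z. (W z)\<^sup>2) holomorphic_on ball 0 R" using W by (intro holomorphic_intros)
    have z: "(LINT t|mu. (W (cis t))\<^sup>2) = 0"
      using mean_value_circle[OF W2 R] by (simp add: W_def)
    have i2: "integrable mu (\<lambda>t. (W (cis t))\<^sup>2)"
      using integrable_mult_holomorphic[of "\<lambda>_. 1", OF _ W2 R] by simp
    obtain B where B: "\<And>t. cmod (W (cis t)) \<le> B"
      using holomorphic_on_circle_bounded[OF W R] by blast
    have Wm: "(\<lambda>t. W (cis t)) \<in> borel_measurable mu" by (rule holomorphic_on_circle_measurable[OF W R])
    have RW: "integrable mu (\<lambda>t. (Re (W (cis t)))\<^sup>2)"
    proof (rule integrable_mu_bounded[where C="B^2"])
      have "(Re (W (cis t)))\<^sup>2 \<le> B^2" for t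
        using abs_Re_le_cmod[of "W (cis t)"] B[of t] by (intro abs_le_square_iff[THEN iffD1]) linarith
      then show "AE t in mu. norm ((Re (W (cis t)))\<^sup>2) \<le> B\<^sup>2" by simp
    qed (use Wm in simp)
    have id: "(cmod w)\<^sup>2 = 2 * (Re w)\<^sup>2 - Re (w\<^sup>2)" for w
      unfolding cmod_power2 by (simp add: power2_eq_square)
    show "integrable mu (\<lambda>t. (cmod (K n t - K m t))\<^sup>2)"
      unfolding KW id using RW i2 by simp
    have "(LINT t|mu. (cmod (K n t - K m t))\<^sup>2) = (LINT t|mu. 2 * (Re (W (cis t)))\<^sup>2) - Re (LINT t|mu. (W (cis t))\<^sup>2)"
      unfolding KW id using RW i2 by (subst integral_Re[symmetric]) auto
    also have "\<dots> = (LINT t|mu. 2 * (Re (W (cis t)))\<^sup>2)" using z by simp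
    also have "\<dots> \<le> (LINT t|mu. 4 * C * (\<bar>Re (K n t) - u t\<bar> + \<bar>Re (K m t) - u t\<bar>))"
    proof (rule integral_mono)
      fix t
      have "\<bar>Re (W (cis t))\<bar> \<le> 2 * C"
        using ReK[of n t] ReK[of m t] unfolding KW[symmetric] by simp
      moreover have "\<bar>Re (W (cis t))\<bar> \<le> \<bar>Re (K n t) - u t\<bar> + \<bar>Re (K m t) - u t\<bar>"
        unfolding KW[symmetric] by simp
      ultimately have "\<bar>Re (W (cis t))\<bar> * \<bar>Re (W (cis t))\<bar> \<le> 2 * C * (\<bar>Re (K n t) - u t\<bar> + \<bar>Re (K m t) - u t\<bar>)"
        by (intro mult_mono) auto
      then show "2 * (Re (W (cis t)))\<^sup>2 \<le> 4 * C * (\<bar>Re (K n t) - u t\<bar> + \<bar>Re (K m t) - u t\<bar>)"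
        by (simp add: power2_eq_square)
    qed (use RW Ki u in auto)
    also have "\<dots> = 4 * C * (a n + a m)"
      unfolding a_def using Ki u by simp
    finally show "(LINT t|mu. (cmod (K n t - K m t))\<^sup>2) \<le> 4 * C * (a n + a m)" .
  qed
  \<comment> \<open>The rate 1/4 for squared means becomes 1/2 for means, so the increments along
    the subsequence are summable.\<close>
  have "\<exists>N\<ge>k. a N \<le> (1/4)^k" for k :: nat
  proof -
    have "\<forall>\<^sub>F n in sequentially. a n < (1/4)^k" by (rule order_tendstoD(2)[OF alim]) simp
    then obtain N where "\<And>n. n \<ge> N \<Longrightarrow> a n < (1/4)^k" by (auto simp: eventually_sequentially)
    then show ?thesis by (intro exI[of _ "max N k"]) (auto intro: less_imp_le)
  qed
  then obtain \<rho> where \<rho>: "\<And>k. \<rho> k \<ge> k" "\<And>k. a (\<rho> k) \<le> (1/4)^k" by metis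
  have d: "(LINT t|mu. norm (K (\<rho> (Suc k)) t - K (\<rho> k) t)) \<le> (pi + 4 * C) * (1/2)^k" for k
  proof -
    let ?D = "\<lambda>t. cmod (K (\<rho> (Suc k)) t - K (\<rho> k) t)"
    \<comment> \<open>Weighted arithmetic-geometric inequality
      \<open>2 * y \<le> (1/2)^k + 2^k * y^2\<close>; the weight brings both terms to order
      \<open>(1/2)^k\<close>.\<close>
    have "(LINT t|mu. ?D t) \<le> (LINT t|mu. ((1/2)^k + 2^k * (?D t)\<^sup>2) / 2)"
    proof (rule integral_mono)
      fix t
      have "0 \<le> ((1/2)^k - ?D t)\<^sup>2 * 2^k" by simp
      also have "\<dots> = (1/2)^k + 2^k * (?D t)\<^sup>2 - 2 * ?D t"
      proof -
        have x: "(1/2)^k * 2^k = (1::real)" by (simp flip: power_mult_distrib)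
        have "((1/2)^k - y)\<^sup>2 * 2^k = ((1/2)^k * 2^k) * (1/2)^k + 2^k * y\<^sup>2 - 2 * y * ((1/2)^k * 2^k)" for y :: real
          by (simp add: power2_eq_square algebra_simps)
        then show ?thesis unfolding x by simp
      qed
      finally show "?D t \<le> ((1/2)^k + 2^k * (?D t)\<^sup>2) / 2" by simp
    qed (use Ki sqi in auto)
    also have "\<dots> = ((1/2)^k * (2*pi) + 2^k * (LINT t|mu. (?D t)\<^sup>2)) / 2"
      using sqi by simp
    also have "\<dots> \<le> ((1/2)^k * (2*pi) + 2^k * (4 * C * (2 * (1/4)^k))) / 2"
    proof -
      have "a (\<rho> (Suc k)) \<le> (1/4)^k" using \<rho>(2)[of "Suc k"] by (rule order_trans) simp
      then have "4 * C * (a (\<rho> (Suc k)) + a (\<rho> k)) \<le> 4 * C * (2 * (1/4)^k)"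
        using \<rho>(2)[of k] C0 by (intro mult_left_mono) auto
      with sq[of "\<rho> (Suc k)" "\<rho> k"] show ?thesis by (simp del: power_one_over)
    qed
    also have "\<dots> = (pi + 4 * C) * (1/2)^k"
    proof -
      have "2^k * (1/4)^k = (1/2 :: real)^k" by (simp flip: power_mult_distrib)
      then have "2^k * (4 * C * (2 * (1/4)^k)) = 8 * C * (1/2)^k" by (simp add: mult_ac)
      then show ?thesis by (simp add: algebra_simps)
    qed
    finally show ?thesis .
  qed
  have s1: "AE t in mu. summable (\<lambda>k. norm (K (\<rho> (Suc k)) t - K (\<rho> k) t))"
    using d by (rule AE_summable_of_L1_summable[rotated]) (use Ki in \<open>auto intro!: summable_mult summable_geometric\<close>)
  have s2: "AE t in mu. summable (\<lambda>k. norm (Re (K (\<rho> k) t) - u t))"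
  proof (rule AE_summable_of_L1_summable)
    show "(LINT t|mu. norm (Re (K (\<rho> k) t) - u t)) \<le> (1/4)^k" for k
      using \<rho>(2)[of k] by (simp add: a_def)
  qed (use Ki u in \<open>auto intro!: summable_geometric\<close>)
  \<comment> \<open>Where the subsequence diverges \<open>lim\<close> has an unspecified value, but
    only on a null set. The argument is the point of the circle, not the angle, to match
    \<open>H2\<close>.\<close>
  define H where "H z = lim (\<lambda>k. herglotz u (q (\<rho> k) * z))" for z :: complex
  have conv: "AE t in mu. (\<lambda>k. K (\<rho> k) t) \<longlonglongrightarrow> H (cis t)"
    using s1
  proof eventually_elim
    case (elim t)
    from summable_norm_cancel[OF this]
    have "convergent (\<lambda>n. \<Sum>k<n. K (\<rho> (Suc k)) t - K (\<rho> k) t)"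
      by (simp only: summable_iff_convergent)
    then have "convergent (\<lambda>n. K (\<rho> n) t - K (\<rho> 0) t)"
      by (simp only: sum_lessThan_telescope[of "\<lambda>k. K (\<rho> k) t"])
    from convergent_add[OF this convergent_const[of "K (\<rho> 0) t"]]
    have "convergent (\<lambda>n. K (\<rho> n) t)" by simp
    then show ?case by (simp add: H_def K_def convergent_LIMSEQ_iff)
  qed
  show ?thesis
  proof (rule that[of "\<lambda>k. q (\<rho> k)" H])
    show "(\<lambda>k. q (\<rho> k)) \<longlonglongrightarrow> 1"
      by (rule filterlim_compose[OF qlim]) (rule filterlim_at_top_mono[OF filterlim_ident], use \<rho> in simp)
    show "(\<lambda>t. H (cis t)) \<in> borel_measurable mu"
      unfolding H_def using Ki unfolding K_def by (intro borel_measurable_lim_metric) auto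
    show "AE t in mu. (\<lambda>n. herglotz u (q (\<rho> n) * cis t)) \<longlonglongrightarrow> H (cis t)"
      using conv by (simp add: K_def)
    show "AE t in mu. Re (H (cis t)) = u t"
      using conv s2
    proof eventually_elim
      case (elim t)
      have "(\<lambda>k. Re (K (\<rho> k) t) - u t) \<longlonglongrightarrow> 0"
        using summable_LIMSEQ_zero[OF elim(2)] by (rule tendsto_norm_zero_cancel)
      from tendsto_add[OF this tendsto_const[of "u t"]] have "(\<lambda>k. Re (K (\<rho> k) t)) \<longlonglongrightarrow> u t" by simp
      moreover have "(\<lambda>k. Re (K (\<rho> k) t)) \<longlonglongrightarrow> Re (H (cis t))"
        using elim(1) by (rule tendsto_Re)
      ultimately show ?case using LIMSEQ_unique by blast
    qed
  qed (use q in auto)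
qed

section \<open>Uniqueness\<close>

text \<open>The real parts of the dilates tend to \<open>v\<close> in L1, and here they are all
  zero.\<close>

lemma AE_zero_of_Re_herglotz_zero:
  fixes v :: "real \<Rightarrow> real"
  assumes v: "integrable mu v" and zero: "\<And>z. cmod z < 1 \<Longrightarrow> Re (herglotz v z) = 0"
  shows "AE t in mu. v t = 0"
proof -
  define r where "r n = 1 + - inverse (real (Suc (Suc n)))" for n
  have r: "0 < r n" "r n < 1" for n by (auto simp: r_def field_simps)
  have "r \<longlonglongrightarrow> 1"
    unfolding r_def by (rule LIMSEQ_Suc) (rule LIMSEQ_inverse_real_of_nat_add_minus)
  from Re_herglotz_tendsto_L1[OF v r this]
  have "(\<lambda>n. LINT t|mu. \<bar>Re (herglotz v (r n * cis t)) - v t\<bar>) \<longlonglongrightarrow> 0" .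
  moreover have "Re (herglotz v (r n * cis t)) = 0" for n t
    using r[of n] by (intro zero) (simp add: norm_mult)
  ultimately have "(\<lambda>n::nat. LINT t|mu. \<bar>v t\<bar>) \<longlonglongrightarrow> 0" by simp
  then have "(LINT t|mu. \<bar>v t\<bar>) = 0" by (simp add: LIMSEQ_const_iff)
  then show ?thesis
    using integral_nonneg_eq_0_iff_AE[of mu "\<lambda>t. \<bar>v t\<bar>"] v by simp
qed

text \<open>For a real function with vanishing coefficients, pairing with the conjugate Herglotz
  kernel leaves only the mean, which is zero too; so its Poisson integral vanishes. The imaginary
  part of \<open>g\<close> is the real part of \<open>- \<i> * g\<close>.\<close>

lemma AE_zero_of_fourier_zero:
  fixes g :: "real \<Rightarrow> complex"
  assumes g: "integrable mu g" and coeff: "\<And>k::int. (LINT t|mu. g t * cis (of_int k * t)) = 0"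
  shows "AE t in mu. g t = 0"
proof -
  have Re0: "AE t in mu. Re (h t) = 0"
    if h: "integrable mu h" and c: "\<And>k::int. (LINT t|mu. h t * cis (of_int k * t)) = 0" for h
  proof (rule AE_zero_of_Re_herglotz_zero)
    show v: "integrable mu (\<lambda>t. Re (h t))" using h by (rule integrable_Re)
    have hc: "integrable mu (\<lambda>t. h t * cis (of_int k * t))" for k
      by (rule integrable_mu_mult_bounded[OF h, where C=1])
         (auto intro!: measurable_mu_borel borel_measurable_continuous_onI continuous_intros)
    have vc: "(LINT t|mu. complex_of_real (Re (h t)) * cis (of_int k * t)) = 0" for k :: int
    proof -
      have "complex_of_real (Re (h t)) * cis (of_int k * t) =
         (h t * cis (of_int k * t) + cnj (h t * cis (of_int (-k) * t))) / 2" for t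
      proof -
        have "complex_of_real (Re (h t)) = (h t + cnj (h t)) / 2" by (simp add: complex_add_cnj)
        then show ?thesis by (simp only:) (simp add: cis_cnj distrib_right)
      qed
      then show ?thesis
        using c[of k] c[of "-k"]
          Bochner_Integration.integral_add[OF hc[of k] integrable_cnj[OF hc[of "-k"]]]
        by (simp only: integral_divide_zero Bochner_Integration.integral_cnj) simp
    qed
    fix z :: complex assume z: "cmod z < 1"
    let ?k = "\<lambda>s. (cis s + z) / (cis s - z)"
    have "(LINT s|mu. complex_of_real (Re (h s)) * cnj (?k s)) = (LINT s|mu. complex_of_real (Re (h s)))"
      using v vc[of "int _"] by (intro integral_mult_herglotz_kernel[OF _ _ z]) auto
    also have "\<dots> = 0" using vc[of 0] by simp
    finally have "(LINT s|mu. cnj (complex_of_real (Re (h s)) * ?k s)) = 0" by simp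
    then show "Re (herglotz (\<lambda>t. Re (h t)) z) = 0"
      unfolding herglotz_def Bochner_Integration.integral_cnj by simp
  qed
  have "(LINT t|mu. - \<i> * g t * cis (of_int k * t)) = 0" for k :: int
    using coeff[of k] integral_mult_right_zero[of mu "-\<i>" "\<lambda>t. g t * cis (of_int k * t)"]
    by (simp only: mult.assoc mult_zero_right)
  then have "AE t in mu. Re (- \<i> * g t) = 0"
    by (intro Re0) (use g in auto)
  with Re0[OF g coeff] show ?thesis
    by eventually_elim (simp add: complex_eq_iff)
qed

text \<open>The uniqueness theorem of F. and M. Riesz for Hardy functions: testing against
  \<open>exp (C H)\<close>, where \<open>Re H\<close> is the indicator of the zero set, makes the first nonvanishing
  Fourier coefficient at most a multiple of \<open>exp (- C \<beta>)\<close>.\<close>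

lemma AE_zero_of_analytic_zero_set:
  fixes g :: "real \<Rightarrow> complex"
  assumes g: "integrable mu g"
    and coeff: "\<And>k::nat. k \<ge> 1 \<Longrightarrow> (LINT t|mu. g t * cis (real k * t)) = 0"
    and B: "B \<in> sets mu" "measure mu B > 0" "AE t in mu. t \<in> B \<longrightarrow> g t = 0"
  shows "AE t in mu. g t = 0"
proof (rule AE_zero_of_fourier_zero[OF g])
  have gc: "integrable mu (\<lambda>t. g t * cis (of_int k * t))" for k
    by (rule integrable_mu_mult_bounded[OF g, where C=1])
       (auto intro!: measurable_mu_borel borel_measurable_continuous_onI continuous_intros)
  define u :: "real \<Rightarrow> real" where "u = indicator B"
  have um: "u \<in> borel_measurable mu" using B(1) by (simp add: u_def)
  have u1: "\<bar>u s\<bar> \<le> 1" for s by (simp add: u_def indicator_def)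
  have u: "integrable mu u" using um u1 by (intro integrable_mu_bounded[where C=1]) auto
  obtain r and H :: "complex \<Rightarrow> complex" where r: "\<And>n::nat. 0 < r n" "\<And>n. r n < (1::real)"
    and "r \<longlonglongrightarrow> 1" "(\<lambda>t. H (cis t)) \<in> borel_measurable mu"
    and H: "AE t in mu. (\<lambda>n. herglotz u (r n * cis t)) \<longlonglongrightarrow> H (cis t)"
      "AE t in mu. Re (H (cis t)) = u t"
    by (rule herglotz_boundary_values[OF um u1], rule that)
  define \<beta> where "\<beta> = measure mu B / (2*pi)"
  have "(LINT s|mu. u s) = measure mu B"
    unfolding u_def using B(1) sets.sets_into_space[OF B(1)] by (simp add: Int_absorb2)
  then have H0: "herglotz u 0 = of_real \<beta>" by (simp add: herglotz_0 \<beta>_def)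
  have \<beta>: "\<beta> > 0" using B(2) by (simp add: \<beta>_def)
  have neg: "(LINT t|mu. g t * cis (- (real m * t))) = 0" for m :: nat
  proof (induction m rule: less_induct)
    case (less m)
    \<comment> \<open>The shift turns the coefficient in question into the mean of \<open>h\<close>;
      the induction hypothesis supplies the coefficients in between, so that \<open>h\<close> again
      satisfies the condition of \<open>integral_mult_holomorphic\<close>.\<close>
    define h where "h t = g t * cis (- (real m * t))" for t
    have h: "integrable mu h" using gc[of "- int m"] by (simp add: h_def[abs_def])
    have hk: "(LINT t|mu. h t * cis (real k * t)) = 0" if "k \<ge> 1" for k :: nat
    proof -
      have e: "h t * cis (real k * t) = g t * cis ((real k - real m) * t)" for t
        by (simp add: h_def mult.assoc cis_mult algebra_simps)
      show ?thesis
      proof (cases "k \<le> m")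
        case True
        then have "real k - real m = - real (m - k)" by (simp add: of_nat_diff)
        then show ?thesis unfolding e using less[of "m - k"] that True by (simp del: of_nat_diff)
      next
        case False
        then have "real k - real m = real (k - m)" by (simp add: of_nat_diff)
        then show ?thesis unfolding e using coeff[of "k - m"] False by (simp del: of_nat_diff)
      qed
    qed
    define c where "c = (LINT t|mu. h t)"
    \<comment> \<open>The multiplier has modulus \<open>exp (C * \<beta>)\<close> at 0, while off
      \<open>B\<close>, where alone \<open>g\<close> is nonzero up to a null set, its boundary
      modulus is 1.\<close>
    have bound: "exp (C * \<beta>) * cmod c \<le> (LINT t|mu. cmod (g t))" for C :: nat
    proof -
      define W where "W n z = exp (of_nat C * herglotz u (r n * z))" for n and z :: complex
      have R: "1 / r n > 1" for n using r[of n] by simp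
      have W: "W n holomorphic_on ball 0 (1 / r n)" for n
        unfolding W_def by (intro holomorphic_intros herglotz_dilate_holomorphic[OF u r])
      have "W n 0 = exp (of_nat C * of_real \<beta>)" for n by (simp add: W_def H0)
      then have W0: "cmod (W n 0) = exp (C * \<beta>)" for n by simp
      have "exp (C * \<beta>) * cmod c \<le> (LINT t|mu. cmod (g t) * exp (C * Re (herglotz u (r n * cis t))))" for n
      proof -
        have "exp (C * \<beta>) * cmod c = cmod (LINT t|mu. h t * W n (cis t))"
          using integral_mult_holomorphic[OF h W R hk, of n] W0[of n] by (simp add: c_def norm_mult)
        also have "\<dots> \<le> (LINT t|mu. cmod (h t * W n (cis t)))"
          by (rule integral_norm_bound)
        also have "\<dots> = (LINT t|mu. cmod (g t) * exp (C * Re (herglotz u (r n * cis t))))"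
          by (simp add: h_def W_def norm_mult)
        finally show ?thesis .
      qed
      moreover have "(\<lambda>n. LINT t|mu. cmod (g t) * exp (C * Re (herglotz u (r n * cis t)))) \<longlonglongrightarrow>
          (LINT t|mu. cmod (g t))"
      proof (rule integral_dominated_convergence)
        show "integrable mu (\<lambda>t. cmod (g t) * exp (real C))" using g by simp
        show "(\<lambda>t. cmod (g t) * exp (C * Re (herglotz u (r n * cis t)))) \<in> borel_measurable mu" for n
          using herglotz_circle_integrable[OF u r] g by measurable
        have "norm (cmod (g t) * exp (C * Re (herglotz u (r n * cis t)))) \<le> cmod (g t) * exp (real C)" for n t
        proof -
          have "Re (herglotz u (r n * cis t)) \<le> 1"
            using Re_herglotz_bound[OF u, of "r n * cis t" 1] u1 r[of n] by (simp add: norm_mult)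
          then have "real C * Re (herglotz u (r n * cis t)) \<le> real C"
            by (simp add: mult_left_le)
          then show ?thesis by (simp add: mult_left_mono)
        qed
        then show "AE t in mu. norm (cmod (g t) * exp (C * Re (herglotz u (r n * cis t)))) \<le> cmod (g t) * exp (real C)" for n
          by simp
        show "AE t in mu. (\<lambda>n. cmod (g t) * exp (C * Re (herglotz u (r n * cis t)))) \<longlonglongrightarrow> cmod (g t)"
          using H B(3)
        proof eventually_elim
          case (elim t)
          have "(\<lambda>n. cmod (g t) * exp (C * Re (herglotz u (r n * cis t)))) \<longlonglongrightarrow> cmod (g t) * exp (C * Re (H (cis t)))"
            using elim(1) by (intro tendsto_intros)
          moreover have "cmod (g t) * exp (C * Re (H (cis t))) = cmod (g t)"
            using elim(2,3) by (auto simp: u_def indicator_def)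
          ultimately show ?case by simp
        qed
      qed (use g in auto)
      ultimately show ?thesis by (intro LIMSEQ_le_const) auto
    qed
    have "c = 0"
    proof (rule ccontr)
      assume "c \<noteq> 0"
      obtain C :: nat where C: "(LINT t|mu. cmod (g t)) / (\<beta> * cmod c) < C"
        using reals_Archimedean2 by blast
      have "(LINT t|mu. cmod (g t)) < C * \<beta> * cmod c"
        using C \<beta> \<open>c \<noteq> 0\<close> by (simp add: pos_divide_less_eq mult.assoc)
      also have "\<dots> \<le> exp (C * \<beta>) * cmod c"
      proof (rule mult_right_mono)
        show "C * \<beta> \<le> exp (C * \<beta>)" using exp_ge_add_one_self[of "C * \<beta>"] by linarith
      qed simp
      finally show False using bound[of C] by simp
    qed
    then show ?case by (simp add: c_def h_def)
  qed
  fix k :: int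
  show "(LINT t|mu. g t * cis (of_int k * t)) = 0"
  proof (cases "k > 0")
    case True
    then show ?thesis using coeff[of "nat k"] by simp
  next
    case False
    then show ?thesis using neg[of "nat (-k)"] by simp
  qed
qed

section \<open>Variations of the extremal function\<close>

lemma tendsto_mult_exp_minus_1:
  fixes z :: complex
  shows "(\<lambda>m::nat. of_nat m * (exp (z / of_nat m) - 1)) \<longlonglongrightarrow> z"
proof (cases "z = 0")
  case False
  have "((\<lambda>h. (exp (0 + h) - exp 0) / h) \<longlongrightarrow> exp 0) (at (0::complex))"
    using DERIV_exp[of 0] unfolding DERIV_def .
  moreover have "filterlim (\<lambda>m::nat. z / of_nat m) (at 0) sequentially"
    unfolding filterlim_at using False
    by (auto intro!: tendsto_divide_0[OF tendsto_const] tendsto_of_nat eventually_sequentiallyI[of 1])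
  ultimately have "(\<lambda>m::nat. (exp (0 + z / of_nat m) - exp 0) / (z / of_nat m)) \<longlonglongrightarrow> exp 0"
    by (rule filterlim_compose)
  from tendsto_mult[OF this tendsto_const[of z]]
  have "(\<lambda>m::nat. (exp (0 + z / of_nat m) - exp 0) / (z / of_nat m) * z) \<longlonglongrightarrow> z" by simp
  then show ?thesis using False by (simp add: mult.commute)
qed simp

text \<open>\<open>2 * C \<le> real m\<close> puts \<open>z / m\<close> into the range where
  \<open>cmod (exp x - 1) \<le> 3/2 * cmod x\<close>. The result dominates the later limits in
  \<open>m\<close>.\<close>

lemma norm_mult_exp_minus_1:
  fixes z :: complex
  assumes "cmod z \<le> C" "2 * C \<le> real m"
  shows "cmod (of_nat m * (exp (z / of_nat m) - 1)) \<le> 3/2 * C"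
proof (cases "m = 0")
  case False
  have "cmod (z / of_nat m) \<le> 1/2"
    using assms False by (simp add: norm_divide field_simps)
  from norm_exp_bounds(2)[OF this] have "real m * cmod (exp (z / of_nat m) - 1) \<le> real m * (3/2 * cmod (z / of_nat m))"
    by (intro mult_left_mono) auto
  also have "\<dots> = 3/2 * cmod z" using False by (simp add: norm_divide)
  finally show ?thesis using assms(1) by (simp add: norm_mult)
qed (use order_trans[OF norm_ge_zero assms(1)] in simp)

section \<open>The notions of the problem as integrals over angles\<close>

lemma AE_mu_iff: "(AE t in mu. P t) \<longleftrightarrow> (AE t in lebesgue. t \<in> {0..<2*pi} \<longrightarrow> P t)"
  unfolding mu_def by (subst AE_restrict_space_iff) simp_all

lemma AE_on_mu: "AE_on E P \<longleftrightarrow> (AE t in mu. cis t \<in> E \<longrightarrow> P (cis t))"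
  unfolding AE_on_def mu_def by (subst AE_restrict_space_iff) (auto simp: ang_def intro!: AE_cong)

lemma ang_circ: "ang circ = {0..<2*pi}"
  by (auto simp: ang_def circ_def)

lemma L2_on_circ_mu:
  "L2_on circ g \<longleftrightarrow> (\<lambda>t. g (cis t)) \<in> borel_measurable mu \<and> integrable mu (\<lambda>t. (cmod (g (cis t)))\<^sup>2)"
  unfolding L2_on_def ang_circ mu_def
  by (simp add: borel_measurable_restrict_space_iff integrable_restrict_space)

lemma L2_on_mu:
  assumes "circ_measurable I"
  shows "L2_on I f \<longleftrightarrow> (\<lambda>t. indicator (ang I) t *\<^sub>R f (cis t)) \<in> borel_measurable mu \<and>
    integrable mu (\<lambda>t. indicator (ang I) t * (cmod (f (cis t)))\<^sup>2)"
proof -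
  have e1: "indicator {0..<2*pi} t * indicator (ang I) t = (indicator (ang I) t :: real)" for t
    by (auto simp: indicator_def ang_def)
  have e2: "indicator {0..<2*pi} t * (indicator (ang I) t * x) = indicator (ang I) t * x" for t x :: real
    by (auto simp: indicator_def ang_def)
  have S: "{0..<2*pi} \<inter> space lebesgue \<in> sets lebesgue" by simp
  show ?thesis
    unfolding L2_on_def mu_def borel_measurable_restrict_space_iff[OF S] integrable_restrict_space[OF S]
      real_scaleR_def scaleR_scaleR e1 e2 ..
qed

lemma L2_norm_mu: "L2_norm I h = sqrt ((LINT t|mu. indicator (ang I) t * (cmod (h (cis t)))\<^sup>2) / (2*pi))"
proof -
  have e1: "indicator {0..<2*pi} t * indicator (ang I) t = (indicator (ang I) t :: real)" for t
    by (auto simp: indicator_def ang_def)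
  have e2: "indicator {0..<2*pi} t * (indicator (ang I) t * x) = indicator (ang I) t * x" for t x :: real
    by (auto simp: indicator_def ang_def)
  have S: "{0..<2*pi} \<inter> space lebesgue \<in> sets lebesgue" by simp
  show ?thesis
    unfolding L2_norm_def set_lebesgue_integral_def mu_def integral_restrict_space[OF S]
      real_scaleR_def e2 ..
qed

lemma fourier_coeff_mu: "fourier_coeff g k = (LINT t|mu. g (cis t) * cis (- (of_int k * t))) / (2*pi)"
  unfolding fourier_coeff_def set_lebesgue_integral_def mu_def by (simp add: integral_restrict_space)

text \<open>A negative index of \<open>fourier_coeff\<close> is a positive frequency in the
  integrand; this is the form that \<open>integral_mult_holomorphic\<close> takes.\<close>

lemma H2_mu:
  "H2 g \<longleftrightarrow> (\<lambda>t. g (cis t)) \<in> borel_measurable mu \<and> integrable mu (\<lambda>t. (cmod (g (cis t)))\<^sup>2) \<and>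
    (\<forall>k::nat. k \<ge> 1 \<longrightarrow> (LINT t|mu. g (cis t) * cis (real k * t)) = 0)"
proof -
  have "(\<forall>k::int. k < 0 \<longrightarrow> fourier_coeff g k = 0) \<longleftrightarrow>
      (\<forall>k::nat. k \<ge> 1 \<longrightarrow> (LINT t|mu. g (cis t) * cis (real k * t)) = 0)"
  proof safe
    fix k :: nat assume *: "\<forall>k::int. k < 0 \<longrightarrow> fourier_coeff g k = 0" "k \<ge> 1"
    then have "fourier_coeff g (- int k) = 0" by simp
    then show "(LINT t|mu. g (cis t) * cis (real k * t)) = 0" by (simp add: fourier_coeff_mu)
  next
    fix k :: int assume *: "\<forall>k::nat. k \<ge> 1 \<longrightarrow> (LINT t|mu. g (cis t) * cis (real k * t)) = 0" "k < 0"
    have "(LINT t|mu. g (cis t) * cis (real (nat (-k)) * t)) = 0" using * by (intro *(1)[rule_format]) auto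
    then show "fourier_coeff g k = 0" using *(2) by (simp add: fourier_coeff_mu)
  qed
  then show ?thesis unfolding H2_def L2_on_circ_mu by blast
qed

lemma integrable_square_imp_integrable_mu:
  fixes g :: "real \<Rightarrow> complex"
  assumes "g \<in> borel_measurable mu" "integrable mu (\<lambda>t. (cmod (g t))\<^sup>2)"
  shows "integrable mu g"
proof (rule Bochner_Integration.integrable_bound)
  show "integrable mu (\<lambda>t. 1 + (cmod (g t))\<^sup>2)" using assms(2) by simp
  have "x \<le> 1 + x\<^sup>2" for x :: real
    using zero_le_power2[of "x - 1/2"] by (simp add: power2_eq_square algebra_simps)
  then show "AE t in mu. norm (g t) \<le> norm (1 + (cmod (g t))\<^sup>2)"
    by simp
qed (rule assms(1))

lemma H2_integrable: "H2 g \<Longrightarrow> integrable mu (\<lambda>t. g (cis t))"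
  unfolding H2_mu by (blast intro: integrable_square_imp_integrable_mu)

lemma circ_measurable_ang: "circ_measurable I \<Longrightarrow> ang I \<in> sets mu"
  by (auto simp: circ_measurable_def mu_def sets_restrict_space_iff ang_def)

text \<open>Bounded analytic multipliers are represented as almost everywhere limits of uniformly
  bounded functions holomorphic beyond the circle. For these the factor \<open>z ^ k\<close>
  vanishes at 0, which kills the coefficient; domination by \<open>C * cmod (g (cis t))\<close>
  carries this to the limit.\<close>

lemma H2_mult_bounded_limit:
  fixes w :: "complex \<Rightarrow> complex" and R :: "nat \<Rightarrow> real"
  assumes g: "H2 g"
    and W: "\<And>n. W n holomorphic_on ball 0 (R n)" "\<And>n. R n > 1" "\<And>n t. cmod (W n (cis t)) \<le> C"
    and lim: "AE t in mu. (\<lambda>n. W n (cis t)) \<longlonglongrightarrow> w (cis t)"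
    and wm: "(\<lambda>t. w (cis t)) \<in> borel_measurable mu"
  shows "H2 (\<lambda>z. g z * w z)"
  unfolding H2_mu
proof (intro conjI allI impI)
  note gH = g[unfolded H2_mu]
  have gi: "integrable mu (\<lambda>t. g (cis t))" by (rule H2_integrable[OF g])
  have wC: "AE t in mu. cmod (w (cis t)) \<le> C"
    using lim
  proof eventually_elim
    case (elim t)
    show ?case by (rule LIMSEQ_le_const2[OF tendsto_norm[OF elim]]) (use W(3) in auto)
  qed
  have C0: "C \<ge> 0" using W(3)[of 0 0] norm_ge_zero order_trans by blast
  show "(\<lambda>t. g (cis t) * w (cis t)) \<in> borel_measurable mu"
    using gH wm by (intro borel_measurable_times) auto
  have "integrable mu (\<lambda>t. (cmod (g (cis t)))\<^sup>2 * (cmod (w (cis t)))\<^sup>2)"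
  proof (rule integrable_mu_mult_bounded)
    show "AE t in mu. norm ((cmod (w (cis t)))\<^sup>2) \<le> C\<^sup>2"
      using wC by eventually_elim (simp add: power_mono)
  qed (use gH wm in auto)
  then show "integrable mu (\<lambda>t. (cmod (g (cis t) * w (cis t)))\<^sup>2)"
    by (simp add: norm_mult power_mult_distrib)
  fix k :: nat assume k: "k \<ge> 1"
  have "(\<lambda>n. LINT t|mu. g (cis t) * (W n (cis t) * cis t ^ k)) \<longlonglongrightarrow> (LINT t|mu. g (cis t) * (w (cis t) * cis t ^ k))"
  proof (rule integral_dominated_convergence)
    show "integrable mu (\<lambda>t. C * cmod (g (cis t)))" using gi by simp
    show "AE t in mu. (\<lambda>n. g (cis t) * (W n (cis t) * cis t ^ k)) \<longlonglongrightarrow> g (cis t) * (w (cis t) * cis t ^ k)"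
      using lim by eventually_elim (intro tendsto_intros)
    show "AE t in mu. norm (g (cis t) * (W n (cis t) * cis t ^ k)) \<le> C * cmod (g (cis t))" for n
      using mult_right_mono[OF W(3)[of n] norm_ge_zero] by (intro AE_I2) (simp add: norm_mult norm_power mult.commute)
    show "(\<lambda>t. g (cis t) * (W n (cis t) * cis t ^ k)) \<in> borel_measurable mu" for n
      using gH holomorphic_on_circle_measurable[OF W(1,2)]
      by (intro borel_measurable_times borel_measurable_power measurable_cis_mu) auto
  qed (use gH wm in \<open>auto intro!: borel_measurable_times borel_measurable_power\<close>)
  moreover have "(LINT t|mu. g (cis t) * (W n (cis t) * cis t ^ k)) = 0" for n
  proof -
    have "(\<lambda>z. W n z * z ^ k) holomorphic_on ball 0 (R n)" using W(1) by (intro holomorphic_intros)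
    from integral_mult_holomorphic[OF gi this W(2)] gH k show ?thesis
      by (simp add: zero_power)
  qed
  ultimately have "(LINT t|mu. g (cis t) * (w (cis t) * cis t ^ k)) = 0"
    by (simp add: LIMSEQ_const_iff)
  then show "(LINT t|mu. g (cis t) * w (cis t) * cis (real k * t)) = 0"
    by (simp add: Complex.DeMoivre mult.assoc)
qed

section \<open>Competitors and the first variation\<close>

lemma circ_in: "cis t \<in> circ"
  by (simp add: circ_def)

lemma in_ang_iff: "t \<in> space mu \<Longrightarrow> t \<in> ang A \<longleftrightarrow> cis t \<in> A"
  by (simp add: ang_def)

text \<open>\<open>f\<close> is controlled only after multiplication with the indicator of
  \<open>I\<close>, so measurability is derived for differences of cut-off functions.\<close>

lemma L2_cross_integrable:
  assumes I: "circ_measurable I" and f: "L2_on I f" and g: "H2 g"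
  shows "integrable mu (\<lambda>t. indicator (ang I) t * (cmod (f (cis t) - g (cis t)))\<^sup>2)"
    and "integrable mu (\<lambda>t. indicator (ang I) t *\<^sub>R (cnj (f (cis t) - g (cis t)) * g (cis t)))"
proof -
  let ?i = "indicator (ang I) :: real \<Rightarrow> real"
  have A: "ang I \<in> sets mu" by (rule circ_measurable_ang[OF I])
  have gm: "(\<lambda>t. g (cis t)) \<in> borel_measurable mu" and g2: "integrable mu (\<lambda>t. (cmod (g (cis t)))\<^sup>2)"
    using g by (auto simp: H2_mu)
  have fm: "(\<lambda>t. ?i t *\<^sub>R f (cis t)) \<in> borel_measurable mu"
    and f2: "integrable mu (\<lambda>t. ?i t * (cmod (f (cis t)))\<^sup>2)"
    using f by (auto simp: L2_on_mu[OF I])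
  have dm: "(\<lambda>t. ?i t *\<^sub>R f (cis t) - ?i t *\<^sub>R g (cis t)) \<in> borel_measurable mu"
    by (rule borel_measurable_diff[OF fm]) (use gm A in simp)
  have bound: "integrable mu (\<lambda>t. 2 * (?i t * (cmod (f (cis t)))\<^sup>2) + 2 * (cmod (g (cis t)))\<^sup>2)"
    using f2 g2 by simp
  have sq: "(cmod (x - y))\<^sup>2 \<le> 2 * (cmod x)\<^sup>2 + 2 * (cmod y)\<^sup>2" for x y :: complex
  proof -
    have "(cmod (x - y))\<^sup>2 \<le> (cmod x + cmod y)\<^sup>2"
      by (intro power_mono norm_triangle_ineq4) simp
    also have "\<dots> \<le> 2 * (cmod x)\<^sup>2 + 2 * (cmod y)\<^sup>2"
      using zero_le_power2[of "cmod x - cmod y"] by (simp add: power2_eq_square algebra_simps)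
    finally show ?thesis .
  qed
  show i1: "integrable mu (\<lambda>t. ?i t * (cmod (f (cis t) - g (cis t)))\<^sup>2)"
  proof (rule Bochner_Integration.integrable_bound[OF bound])
    have e: "?i t * (cmod (f (cis t) - g (cis t)))\<^sup>2 = (cmod (?i t *\<^sub>R f (cis t) - ?i t *\<^sub>R g (cis t)))\<^sup>2" for t
      by (simp add: indicator_def)
    show "(\<lambda>t. ?i t * (cmod (f (cis t) - g (cis t)))\<^sup>2) \<in> borel_measurable mu"
      unfolding e using dm by simp
    show "AE t in mu. norm (?i t * (cmod (f (cis t) - g (cis t)))\<^sup>2) \<le>
        norm (2 * (?i t * (cmod (f (cis t)))\<^sup>2) + 2 * (cmod (g (cis t)))\<^sup>2)"
      using sq by (intro AE_I2) (simp add: indicator_def)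
  qed
  have bound2: "integrable mu (\<lambda>t. ?i t * (cmod (f (cis t) - g (cis t)))\<^sup>2 + (cmod (g (cis t)))\<^sup>2)"
    using i1 g2 by simp
  show "integrable mu (\<lambda>t. ?i t *\<^sub>R (cnj (f (cis t) - g (cis t)) * g (cis t)))"
  proof (rule Bochner_Integration.integrable_bound[OF bound2])
    have e: "?i t *\<^sub>R (cnj (f (cis t) - g (cis t)) * g (cis t)) =
        cnj (?i t *\<^sub>R f (cis t) - ?i t *\<^sub>R g (cis t)) * g (cis t)" for t
      by (simp add: indicator_def)
    have "(\<lambda>t. cnj (?i t *\<^sub>R f (cis t) - ?i t *\<^sub>R g (cis t))) \<in> borel_measurable mu"
      using measurable_compose[OF dm borel_measurable_continuous_onI[of cnj]]
      by (simp add: continuous_on_cnj)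
    then show "(\<lambda>t. ?i t *\<^sub>R (cnj (f (cis t) - g (cis t)) * g (cis t))) \<in> borel_measurable mu"
      unfolding e using gm by (intro borel_measurable_times)
    have "x * y \<le> x\<^sup>2 + y\<^sup>2" for x y :: real
      using zero_le_power2[of "x - y"] zero_le_power2[of "x + y"]
      by (simp add: power2_eq_square algebra_simps)
    then show "AE t in mu. norm (?i t *\<^sub>R (cnj (f (cis t) - g (cis t)) * g (cis t))) \<le>
        norm (?i t * (cmod (f (cis t) - g (cis t)))\<^sup>2 + (cmod (g (cis t)))\<^sup>2)"
      by (intro AE_I2) (simp add: indicator_def norm_mult flip: complex_cnj_diff)
  qed
qed

text \<open>Squaring the minimality inequality and cancelling the common term leaves a quadratic
  minus a linear expression in the increment \<open>g - g0\<close>.\<close>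

lemma BEP_solution_optimal:
  assumes sol: "BEP_solution I f g0" and I: "circ_measurable I" and f: "L2_on I f"
    and g: "H2 g" "AE_on (circ - I) (\<lambda>z. cmod (g z) \<le> 1)"
  shows "0 \<le> (LINT t|mu. indicator (ang I) t *
      ((cmod (g (cis t) - g0 (cis t)))\<^sup>2 - 2 * Re (cnj (f (cis t) - g0 (cis t)) * (g (cis t) - g0 (cis t)))))"
proof -
  have g0: "H2 g0" using sol by (simp add: BEP_solution_def)
  have "L2_norm I (\<lambda>z. f z - g0 z) \<le> L2_norm I (\<lambda>z. f z - g z)"
    using sol g by (simp add: BEP_solution_def)
  then have "(LINT t|mu. indicator (ang I) t * (cmod (f (cis t) - g0 (cis t)))\<^sup>2) \<le>
      (LINT t|mu. indicator (ang I) t * (cmod (f (cis t) - g (cis t)))\<^sup>2)"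
    by (simp add: L2_norm_mu divide_le_cancel)
  then have "0 \<le> (LINT t|mu. indicator (ang I) t * (cmod (f (cis t) - g (cis t)))\<^sup>2 -
      indicator (ang I) t * (cmod (f (cis t) - g0 (cis t)))\<^sup>2)"
    using L2_cross_integrable(1)[OF I f g0] L2_cross_integrable(1)[OF I f g(1)] by simp
  moreover have "indicator (ang I) t * (cmod (f (cis t) - g (cis t)))\<^sup>2 -
      indicator (ang I) t * (cmod (f (cis t) - g0 (cis t)))\<^sup>2 =
      indicator (ang I) t * ((cmod (g (cis t) - g0 (cis t)))\<^sup>2 -
        2 * Re (cnj (f (cis t) - g0 (cis t)) * (g (cis t) - g0 (cis t))))" for t
  proof -
    have "(cmod (a - b))\<^sup>2 - (cmod (a - c))\<^sup>2 = (cmod (b - c))\<^sup>2 - 2 * Re (cnj (a - c) * (b - c))" for a b c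
      unfolding cmod_power2 by (simp add: power2_eq_square algebra_simps)
    then show ?thesis unfolding right_diff_distrib[symmetric] by (rule arg_cong)
  qed
  ultimately show ?thesis by (simp only:)
qed

text \<open>The competitors are \<open>g0 * exp (\<Psi> / m)\<close> for large \<open>m\<close>.
  Multiplying the optimality inequality by \<open>m\<close> makes the quadratic term of order
  \<open>1 / m\<close>. The conclusion is one-sided because only positive multiples of
  \<open>\<Psi>\<close> occur.\<close>

lemma first_variation_le:
  fixes \<Psi> :: "complex \<Rightarrow> complex" and R :: "nat \<Rightarrow> real"
  assumes sol: "BEP_solution I f g0" and I: "circ_measurable I" and f: "L2_on I f"
    and W: "\<And>n. W n holomorphic_on ball 0 (R n)" "\<And>n. R n > 1" "\<And>n t. cmod (W n (cis t)) \<le> C"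
    and lim: "AE t in mu. (\<lambda>n. W n (cis t)) \<longlonglongrightarrow> \<Psi> (cis t)"
    and \<Psi>m: "(\<lambda>t. \<Psi> (cis t)) \<in> borel_measurable mu"
    and \<delta>: "\<delta> > 0"
    and J: "AE t in mu. cis t \<notin> I \<longrightarrow> Re (\<Psi> (cis t)) = 0 \<or> cmod (g0 (cis t)) \<le> 1 - \<delta>"
  shows "Re (LINT t|mu. indicator (ang I) t *\<^sub>R (cnj (f (cis t) - g0 (cis t)) * g0 (cis t)) * \<Psi> (cis t)) \<le> 0"
proof -
  define F where "F t = indicator (ang I) t *\<^sub>R (cnj (f (cis t) - g0 (cis t)) * g0 (cis t))" for t
  have g0: "H2 g0" and g01: "AE t in mu. cis t \<notin> I \<longrightarrow> cmod (g0 (cis t)) \<le> 1"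
    using sol by (auto simp: BEP_solution_def AE_on_mu circ_in)
  have A: "ang I \<in> sets mu" by (rule circ_measurable_ang[OF I])
  have F: "integrable mu F"
    using L2_cross_integrable(2)[OF I f g0] by (simp add: F_def[abs_def])
  have g0m: "(\<lambda>t. g0 (cis t)) \<in> borel_measurable mu" and g02: "integrable mu (\<lambda>t. (cmod (g0 (cis t)))\<^sup>2)"
    using g0 by (auto simp: H2_mu)
  have C0: "C \<ge> 0" using W(3)[of 0 0] norm_ge_zero order_trans by blast
  have \<Psi>C: "AE t in mu. cmod (\<Psi> (cis t)) \<le> C"
    using lim
  proof eventually_elim
    case (elim t)
    show ?case by (rule LIMSEQ_le_const2[OF tendsto_norm[OF elim]]) (use W(3) in auto)
  qed
  \<comment> \<open>The increment of the competitor is \<open>g0 * E m / m\<close>, and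
    \<open>E m\<close> tends to \<open>\<Psi>\<close>.\<close>
  define E where "E m z = of_nat m * (exp (\<Psi> z / of_nat m) - 1)" for m z
  have Em: "(\<lambda>t. E m (cis t)) \<in> borel_measurable mu" for m
  proof -
    have "(\<lambda>t. exp (\<Psi> (cis t) / of_nat m)) \<in> borel_measurable mu"
      by (rule measurable_compose[OF _ borel_measurable_exp]) (use \<Psi>m in simp)
    then show ?thesis unfolding E_def by simp
  qed
  \<comment> \<open>Three thresholds: the uniform bound for \<open>E m\<close>, a perturbation
    \<open>C / m \<le> \<delta>\<close> that the slack can absorb, and a nonzero
    denominator.\<close>
  obtain M :: nat where M: "2 * C \<le> M" "C / \<delta> \<le> M" "M \<ge> 1"
  proof -
    obtain M :: nat where "max (max (2 * C) (C / \<delta>)) 1 \<le> M" using real_arch_simple by blast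
    then show ?thesis by (intro that[of M]) auto
  qed
  have key: "0 \<le> (LINT t|mu. indicator (ang I) t * (cmod (g0 (cis t)))\<^sup>2 * (cmod (E m (cis t)))\<^sup>2 / real m
      - 2 * Re (F t * E m (cis t)))" if m: "m \<ge> M" for m
  proof -
    have m0: "m > 0" and m1: "C / \<delta> \<le> real m" using m M by (auto intro: order_trans)
    have "H2 (\<lambda>z. g0 z * exp (\<Psi> z / of_nat m))"
    proof (rule H2_mult_bounded_limit[OF g0])
      show "(\<lambda>z. exp (W n z / of_nat m)) holomorphic_on ball 0 (R n)" for n
        using W(1) m0 by (intro holomorphic_intros) auto
      show "cmod (exp (W n (cis t) / of_nat m)) \<le> exp C" for n t
      proof -
        have "Re (W n (cis t)) / real m \<le> \<bar>Re (W n (cis t))\<bar> / 1"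
          using m0 by (intro frac_le) auto
        also have "\<dots> \<le> C" using abs_Re_le_cmod[of "W n (cis t)"] W(3)[of n t] by simp
        finally show ?thesis by simp
      qed
      show "AE t in mu. (\<lambda>n. exp (W n (cis t) / of_nat m)) \<longlonglongrightarrow> exp (\<Psi> (cis t) / of_nat m)"
        using lim by eventually_elim (use m0 in \<open>auto intro!: tendsto_intros\<close>)
      show "(\<lambda>t. exp (\<Psi> (cis t) / of_nat m)) \<in> borel_measurable mu"
        by (rule measurable_compose[OF _ borel_measurable_exp]) (use \<Psi>m in simp)
    qed (rule W(2))
    moreover have "AE_on (circ - I) (\<lambda>z. cmod (g0 z * exp (\<Psi> z / of_nat m)) \<le> 1)"
      unfolding AE_on_mu using J g01 \<Psi>C
    proof eventually_elim
      case (elim t)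
      show ?case
      proof
        assume "cis t \<in> circ - I"
        then have disj: "Re (\<Psi> (cis t)) = 0 \<or> cmod (g0 (cis t)) \<le> 1 - \<delta>" and g1: "cmod (g0 (cis t)) \<le> 1"
          using elim by auto
        from disj show "cmod (g0 (cis t) * exp (\<Psi> (cis t) / of_nat m)) \<le> 1"
        proof
          assume "Re (\<Psi> (cis t)) = 0"
          then show ?thesis using g1 by (simp add: norm_mult)
        next
          assume g: "cmod (g0 (cis t)) \<le> 1 - \<delta>"
          have "Re (\<Psi> (cis t)) \<le> C" using elim(3) complex_Re_le_cmod order_trans by blast
          then have "Re (\<Psi> (cis t)) / m \<le> C / m" using m0 by (intro divide_right_mono) auto
          also have "C / m \<le> \<delta>" using m1 m0 \<delta> by (simp add: field_simps)
          finally have "cmod (g0 (cis t) * exp (\<Psi> (cis t) / of_nat m)) \<le> (1 - \<delta>) * exp \<delta>"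
            unfolding norm_mult using g order_trans[OF norm_ge_zero g] by (intro mult_mono) auto
          \<comment> \<open>Since \<open>1 - \<delta> \<le> exp (- \<delta>)\<close>, slack
            \<open>\<delta>\<close> compensates growth by \<open>exp \<delta>\<close>.\<close>
          also have "\<dots> \<le> exp (- \<delta>) * exp \<delta>"
            using exp_ge_add_one_self[of "-\<delta>"] by (intro mult_right_mono) auto
          finally show ?thesis by (simp flip: exp_add)
        qed
      qed
    qed
    ultimately have "0 \<le> (LINT t|mu. indicator (ang I) t *
      ((cmod (g0 (cis t) * exp (\<Psi> (cis t) / of_nat m) - g0 (cis t)))\<^sup>2 - 2 * Re (cnj (f (cis t) - g0 (cis t)) *
       (g0 (cis t) * exp (\<Psi> (cis t) / of_nat m) - g0 (cis t)))))"
      by (rule BEP_solution_optimal[OF sol I f])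
    also have "\<dots> = (LINT t|mu. (indicator (ang I) t * (cmod (g0 (cis t)))\<^sup>2 * (cmod (E m (cis t)))\<^sup>2 / real m
      - 2 * Re (F t * E m (cis t))) / real m)"
    proof (rule Bochner_Integration.integral_cong[OF refl])
      fix t
      have e: "g0 (cis t) * exp (\<Psi> (cis t) / of_nat m) - g0 (cis t) = g0 (cis t) * E m (cis t) / of_nat m"
      proof -
        have "g0 (cis t) * (of_nat m * x) / of_nat m = g0 (cis t) * x" for x using m0 by simp
        then show ?thesis unfolding E_def by (simp only:) (simp add: right_diff_distrib)
      qed
      show "indicator (ang I) t *
      ((cmod (g0 (cis t) * exp (\<Psi> (cis t) / of_nat m) - g0 (cis t)))\<^sup>2 - 2 * Re (cnj (f (cis t) - g0 (cis t)) *
       (g0 (cis t) * exp (\<Psi> (cis t) / of_nat m) - g0 (cis t)))) =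
       (indicator (ang I) t * (cmod (g0 (cis t)))\<^sup>2 * (cmod (E m (cis t)))\<^sup>2 / real m
      - 2 * Re (F t * E m (cis t))) / real m"
      proof (cases "t \<in> ang I")
        case True
        have "cnj (f (cis t) - g0 (cis t)) * (g0 (cis t) * E m (cis t) / of_nat m) = F t * E m (cis t) / of_real (real m)"
          using True by (simp add: F_def)
        then have "Re (cnj (f (cis t) - g0 (cis t)) * (g0 (cis t) * E m (cis t) / of_nat m)) = Re (F t * E m (cis t)) / real m"
          by (simp only: Re_divide_of_real)
        moreover have "(cmod (g0 (cis t) * E m (cis t) / of_nat m))\<^sup>2 = (cmod (g0 (cis t)))\<^sup>2 * (cmod (E m (cis t)))\<^sup>2 / real m / real m"
          by (simp add: norm_mult norm_divide power_mult_distrib power_divide power2_eq_square)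
        ultimately show ?thesis unfolding e using True by (simp add: diff_divide_distrib)
      qed (simp add: F_def)
    qed
    finally show ?thesis using m0 by (simp add: zero_le_divide_iff)
  qed
  have "(\<lambda>n. LINT t|mu. indicator (ang I) t * (cmod (g0 (cis t)))\<^sup>2 * (cmod (E (n + M) (cis t)))\<^sup>2 / real (n + M)
      - 2 * Re (F t * E (n + M) (cis t))) \<longlonglongrightarrow> (LINT t|mu. - 2 * Re (F t * \<Psi> (cis t)))"
  proof (rule integral_dominated_convergence)
    show "integrable mu (\<lambda>t. (cmod (g0 (cis t)))\<^sup>2 * (3/2 * C)\<^sup>2 + 2 * (cmod (F t) * (3/2 * C)))"
      using g02 F by simp
    show "(\<lambda>t. - 2 * Re (F t * \<Psi> (cis t))) \<in> borel_measurable mu"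
      using F \<Psi>m by simp
    show "(\<lambda>t. indicator (ang I) t * (cmod (g0 (cis t)))\<^sup>2 * (cmod (E (n + M) (cis t)))\<^sup>2 / real (n + M)
      - 2 * Re (F t * E (n + M) (cis t))) \<in> borel_measurable mu" for n
      using F Em[of "n+M"] g0m A by simp
    show "AE t in mu. (\<lambda>n. indicator (ang I) t * (cmod (g0 (cis t)))\<^sup>2 * (cmod (E (n + M) (cis t)))\<^sup>2 / real (n + M)
      - 2 * Re (F t * E (n + M) (cis t))) \<longlonglongrightarrow> - 2 * Re (F t * \<Psi> (cis t))"
    proof (rule AE_I2)
      fix t
      have "(\<lambda>n. E n (cis t)) \<longlonglongrightarrow> \<Psi> (cis t)" unfolding E_def by (rule tendsto_mult_exp_minus_1)
      then have Elim: "(\<lambda>n. E (n + M) (cis t)) \<longlonglongrightarrow> \<Psi> (cis t)" by (rule LIMSEQ_ignore_initial_segment)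
      have inv: "(\<lambda>n. inverse (real (n + M))) \<longlonglongrightarrow> 0"
        using LIMSEQ_ignore_initial_segment[OF lim_inverse_n, of M] by simp
      have "(\<lambda>n. indicator (ang I) t * (cmod (g0 (cis t)))\<^sup>2 * (cmod (E (n + M) (cis t)))\<^sup>2 * inverse (real (n + M))
        - 2 * Re (F t * E (n + M) (cis t))) \<longlonglongrightarrow>
        indicator (ang I) t * (cmod (g0 (cis t)))\<^sup>2 * (cmod (\<Psi> (cis t)))\<^sup>2 * 0 - 2 * Re (F t * \<Psi> (cis t))"
        by (intro tendsto_intros Elim inv)
      then show "(\<lambda>n. indicator (ang I) t * (cmod (g0 (cis t)))\<^sup>2 * (cmod (E (n + M) (cis t)))\<^sup>2 / real (n + M)
        - 2 * Re (F t * E (n + M) (cis t))) \<longlonglongrightarrow> - 2 * Re (F t * \<Psi> (cis t))"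
        by (simp add: divide_inverse)
    qed
    show "AE t in mu. norm (indicator (ang I) t * (cmod (g0 (cis t)))\<^sup>2 * (cmod (E (n + M) (cis t)))\<^sup>2 / real (n + M)
      - 2 * Re (F t * E (n + M) (cis t))) \<le> (cmod (g0 (cis t)))\<^sup>2 * (3/2 * C)\<^sup>2 + 2 * (cmod (F t) * (3/2 * C))" for n
      using \<Psi>C
    proof eventually_elim
      case (elim t)
      let ?e = "cmod (E (n + M) (cis t))"
      have e: "?e \<le> 3/2 * C"
        unfolding E_def using elim M(1) by (intro norm_mult_exp_minus_1) auto
      have "\<bar>indicator (ang I) t * (cmod (g0 (cis t)))\<^sup>2 * ?e\<^sup>2 / real (n + M)\<bar> \<le> (cmod (g0 (cis t)))\<^sup>2 * ?e\<^sup>2 / 1"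
      proof -
        have "x / real (n + M) \<le> x / 1" if "x \<ge> 0" for x
          using that M(3) by (intro frac_le) auto
        from this[of "(cmod (g0 (cis t)))\<^sup>2 * ?e\<^sup>2"] show ?thesis
          by (cases "t \<in> ang I") (simp_all del: of_nat_add)
      qed
      also have "\<dots> \<le> (cmod (g0 (cis t)))\<^sup>2 * (3/2 * C)\<^sup>2"
        using e by (simp del: power_mult_distrib) (intro mult_left_mono power_mono; simp)
      finally have 1: "\<bar>indicator (ang I) t * (cmod (g0 (cis t)))\<^sup>2 * ?e\<^sup>2 / real (n + M)\<bar> \<le> (cmod (g0 (cis t)))\<^sup>2 * (3/2 * C)\<^sup>2" .
      have "\<bar>Re (F t * E (n + M) (cis t))\<bar> \<le> cmod (F t) * ?e"
        using abs_Re_le_cmod[of "F t * E (n + M) (cis t)"] by (simp only: norm_mult)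
      also have "\<dots> \<le> cmod (F t) * (3/2 * C)" using e by (intro mult_left_mono) auto
      finally have 2: "\<bar>Re (F t * E (n + M) (cis t))\<bar> \<le> cmod (F t) * (3/2 * C)" .
      show ?case using 1 2 unfolding real_norm_def by linarith
    qed
  qed
  then have "0 \<le> (LINT t|mu. - 2 * Re (F t * \<Psi> (cis t)))"
  proof (rule LIMSEQ_le_const)
    show "\<exists>N. \<forall>n\<ge>N. 0 \<le> (LINT t|mu. indicator (ang I) t * (cmod (g0 (cis t)))\<^sup>2 *
      (cmod (E (n + M) (cis t)))\<^sup>2 / real (n + M) - 2 * Re (F t * E (n + M) (cis t)))"
      by (rule exI[of _ 0], rule allI, rule impI, rule key, rule le_add2)
  qed
  also have "\<dots> = - 2 * (LINT t|mu. Re (F t * \<Psi> (cis t)))"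
    by (rule integral_mult_right_zero)
  also have "(LINT t|mu. Re (F t * \<Psi> (cis t))) = Re (LINT t|mu. F t * \<Psi> (cis t))"
    by (rule integral_Re) (rule integrable_mu_mult_bounded[OF F \<Psi>m \<Psi>C])
  finally have "Re (LINT t|mu. F t * \<Psi> (cis t)) \<le> 0" by linarith
  then show ?thesis unfolding F_def .
qed

section \<open>Bounded test functions from the hyperbolic sine\<close>

lemma Re_sinh_complex: "Re (sinh (z::complex)) = sinh (Re z) * cos (Im z)"
  by (simp add: sinh_field_def Re_exp algebra_simps)

text \<open>Only the real part enters, so \<open>sinh (H / N)\<close> is bounded although the
  conjugate function \<open>Im H\<close> may not be.\<close>

lemma norm_sinh_le: "cmod (sinh z) \<le> exp \<bar>Re z\<bar>"
proof -
  have "cmod (sinh z) \<le> (cmod (exp z) + cmod (exp (-z))) / 2"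
    using norm_triangle_ineq4[of "exp z" "exp (-z)"] by (simp add: sinh_field_def norm_divide)
  also have "\<dots> \<le> (exp \<bar>Re z\<bar> + exp \<bar>Re z\<bar>) / 2"
    by (intro divide_right_mono add_mono) auto
  finally show ?thesis by simp
qed

lemma mult_sinh_divide:
  fixes z :: complex
  shows "of_nat m * sinh (z / of_nat m) =
    (of_nat m * (exp (z / of_nat m) - 1) - of_nat m * (exp (- z / of_nat m) - 1)) / 2"
  by (simp add: sinh_field_def algebra_simps diff_divide_distrib)

lemma tendsto_mult_sinh:
  fixes z :: complex
  shows "(\<lambda>m::nat. of_nat m * sinh (z / of_nat m)) \<longlonglongrightarrow> z"
proof -
  have "(\<lambda>m::nat. (of_nat m * (exp (z / of_nat m) - 1) - of_nat m * (exp (- z / of_nat m) - 1)) / 2) \<longlonglongrightarrow> (z - (- z)) / 2"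
    by (intro tendsto_divide tendsto_diff tendsto_mult_exp_minus_1 tendsto_const) simp
  then show ?thesis unfolding mult_sinh_divide by simp
qed

lemma norm_mult_sinh_le:
  fixes z :: complex
  assumes "cmod z \<le> C" "2 * C \<le> real m"
  shows "cmod (of_nat m * sinh (z / of_nat m)) \<le> 3/2 * C"
proof -
  have "cmod (of_nat m * sinh (z / of_nat m)) \<le>
     (cmod (of_nat m * (exp (z / of_nat m) - 1)) + cmod (of_nat m * (exp (- z / of_nat m) - 1))) / 2"
    unfolding mult_sinh_divide norm_divide using norm_triangle_ineq4 by (simp add: divide_right_mono)
  also have "\<dots> \<le> (3/2 * C + 3/2 * C) / 2"
    using assms by (intro divide_right_mono add_mono norm_mult_exp_minus_1) auto
  finally show ?thesis by simp
qed

text \<open>Composing \<open>sinh\<close> with dilates of the transform gives the holomorphic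
  approximants, bounded uniformly through \<open>Re_herglotz_bound\<close>. The condition off
  \<open>I\<close> is symmetric in the sign of the test function, so two one-sided variations give
  an equality.\<close>

lemma herglotz_variation:
  fixes h :: "real \<Rightarrow> real"
  assumes sol: "BEP_solution I f g0" and I: "circ_measurable I" and f: "L2_on I f"
    and h: "h \<in> borel_measurable mu" "\<And>s. \<bar>h s\<bar> \<le> C" and \<delta>: "\<delta> > 0"
    and J: "AE t in mu. cis t \<notin> I \<longrightarrow> h t = 0 \<or> cmod (g0 (cis t)) \<le> 1 - \<delta>"
  obtains r :: "nat \<Rightarrow> real" and H :: "complex \<Rightarrow> complex"
  where "\<And>n. 0 < r n" "\<And>n. r n < 1" "r \<longlonglongrightarrow> 1"
    "(\<lambda>t. H (cis t)) \<in> borel_measurable mu"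
    "AE t in mu. (\<lambda>n. herglotz h (r n * cis t)) \<longlonglongrightarrow> H (cis t)"
    "AE t in mu. Re (H (cis t)) = h t"
    "\<And>N::nat. N \<ge> 1 \<Longrightarrow> Re (LINT t|mu. indicator (ang I) t *\<^sub>R (cnj (f (cis t) - g0 (cis t)) * g0 (cis t)) *
        (of_nat N * sinh (H (cis t) / of_nat N))) = 0"
proof -
  have hi: "integrable mu h" using h by (intro integrable_mu_bounded[where C=C]) auto
  obtain r and H :: "complex \<Rightarrow> complex" where r: "\<And>n::nat. 0 < r n" "\<And>n. r n < (1::real)"
    and rlim: "r \<longlonglongrightarrow> 1" and Hm: "(\<lambda>t. H (cis t)) \<in> borel_measurable mu"
    and H: "AE t in mu. (\<lambda>n. herglotz h (r n * cis t)) \<longlonglongrightarrow> H (cis t)"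
      "AE t in mu. Re (H (cis t)) = h t"
    by (rule herglotz_boundary_values[OF h], rule that)
  have "Re (LINT t|mu. indicator (ang I) t *\<^sub>R (cnj (f (cis t) - g0 (cis t)) * g0 (cis t)) *
      (c * (of_nat N * sinh (H (cis t) / of_nat N)))) \<le> 0"
    if N: "N \<ge> 1" and c: "c = 1 \<or> c = - 1" for N :: nat and c :: complex
  proof (rule first_variation_le[OF sol I f])
    let ?W = "\<lambda>n z. c * (of_nat N * sinh (herglotz h (of_real (r n) * z) / of_nat N))"
    show "?W n holomorphic_on ball 0 (1 / r n)" for n
      unfolding sinh_field_def using N
      by (intro holomorphic_intros herglotz_dilate_holomorphic[OF hi r]) auto
    show "1 / r n > 1" for n using r[of n] by simp
    show "cmod (?W n (cis t)) \<le> real N * exp C" for n t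
    proof -
      have "\<bar>Re (herglotz h (r n * cis t))\<bar> \<le> C"
        using Re_herglotz_bound[OF hi, of "r n * cis t" C] h(2) r[of n] by (simp add: norm_mult)
      moreover have "\<bar>Re (herglotz h (r n * cis t))\<bar> / N \<le> \<bar>Re (herglotz h (r n * cis t))\<bar> / 1"
        using N by (intro frac_le) auto
      ultimately have "\<bar>Re (herglotz h (r n * cis t) / of_nat N)\<bar> \<le> C" by simp
      then have "cmod (sinh (herglotz h (r n * cis t) / of_nat N)) \<le> exp C"
        by (intro order_trans[OF norm_sinh_le]) simp
      then show ?thesis using c by (auto simp: norm_mult mult_left_mono)
    qed
    show "AE t in mu. (\<lambda>n. ?W n (cis t)) \<longlonglongrightarrow> c * (of_nat N * sinh (H (cis t) / of_nat N))"
      using H(1)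
    proof eventually_elim
      case (elim t)
      show ?case unfolding sinh_field_def using N elim by (intro tendsto_intros) auto
    qed
    show "(\<lambda>t. c * (of_nat N * sinh (H (cis t) / of_nat N))) \<in> borel_measurable mu"
    proof -
      have "(\<lambda>t. exp (H (cis t) / of_nat N)) \<in> borel_measurable mu"
        by (rule measurable_compose[OF _ borel_measurable_exp]) (use Hm in simp)
      moreover have "(\<lambda>t. exp (- (H (cis t) / of_nat N))) \<in> borel_measurable mu"
        by (rule measurable_compose[OF _ borel_measurable_exp]) (use Hm in simp)
      ultimately show ?thesis unfolding sinh_field_def by simp
    qed
    show "AE t in mu. cis t \<notin> I \<longrightarrow> Re (c * (of_nat N * sinh (H (cis t) / of_nat N))) = 0 \<or> cmod (g0 (cis t)) \<le> 1 - \<delta>"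
      using J H(2)
    proof eventually_elim
      case (elim t)
      \<comment> \<open>\<open>sinh (h t / N)\<close> vanishes with \<open>h t\<close>, whatever the
        value of \<open>Im (H (cis t))\<close>.\<close>
      have "Re (of_nat N * sinh (H (cis t) / of_nat N)) = N * (sinh (h t / N) * cos (Im (H (cis t)) / N))"
        using elim(2) by (simp add: Re_sinh_complex)
      then show ?case using elim(1) c by auto
    qed
  qed (rule \<delta>)
  from this[of _ 1] this[of _ "-1"]
  have "Re (LINT t|mu. indicator (ang I) t *\<^sub>R (cnj (f (cis t) - g0 (cis t)) * g0 (cis t)) *
      (of_nat N * sinh (H (cis t) / of_nat N))) = 0" if "N \<ge> 1" for N :: nat
    using that by (intro antisym) auto
  then show ?thesis using r rlim Hm H by (intro that)
qed

text \<open>Rationalising leaves a purely imaginary numerator; for \<open>cis s = cis t\<close> the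
  quotient is 0 by convention, so no exception arises.\<close>

lemma herglotz_kernel_circle: "Re ((cis s + cis t) / (cis s - cis t)) = 0"
proof -
  have "Re ((cis s + cis t) * cnj (cis s - cis t)) = 0"
    by (simp add: algebra_simps)
  then show ?thesis by (subst complex_div_cnj) (simp add: Re_divide_of_real flip: of_real_power)
qed

text \<open>By compactness the zeros accumulate at some \<open>e\<close> on the circle, which
  inherits the distance \<open>d\<close> from the support of \<open>q\<close>. The transform is
  holomorphic on the disc joined with \<open>ball e d\<close>, where \<open>e\<close> is an interior
  point, and the identity theorem applies.\<close>

lemma herglotz_zero_of_boundary_zeros:
  fixes q :: "real \<Rightarrow> real"
  assumes q: "integrable mu q" and d: "d > 0"
    and Z: "infinite Z" "Z \<subseteq> {0..<2*pi}"
    and away: "\<And>s t. t \<in> Z \<Longrightarrow> q s \<noteq> 0 \<Longrightarrow> d \<le> dist (cis s) (cis t)"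
    and zero: "\<And>t. t \<in> Z \<Longrightarrow> herglotz q (cis t) = 0"
    and w: "cmod w < 1"
  shows "herglotz q w = 0"
proof -
  have inf: "infinite (cis ` Z)"
    using Z inj_on_cis by (metis finite_imageD inj_on_subset)
  have "\<exists>x\<in>sphere 0 (1::real). x islimpt (cis ` Z)"
    using inf compact_sphere[of "0::complex" 1] by (subst (asm) compact_eq_Bolzano_Weierstrass) auto
  then obtain e where e: "cmod e = 1" "e islimpt (cis ` Z)" by auto
  have far: "d \<le> dist (cis s) e" if "q s \<noteq> 0" for s
  proof (rule ccontr)
    assume "\<not> d \<le> dist (cis s) e"
    then obtain t where t: "t \<in> Z" "dist (cis t) e < d - dist (cis s) e"
      using e(2) unfolding islimpt_approachable by (metis diff_gt_0_iff_gt imageE not_le)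
    then have "dist (cis s) (cis t) < d"
      using dist_triangle[of "cis s" "cis t" e] by (simp add: dist_commute)
    then show False using away[OF t(1) that] by simp
  qed
  let ?S = "ball 0 1 \<union> ball e d"
  show ?thesis
  proof (rule analytic_continuation[of "herglotz q" ?S "cis ` Z \<inter> ball e d" e])
    show "herglotz q holomorphic_on ?S"
    proof (rule herglotz_holomorphic_away[OF q])
      fix w assume w: "w \<in> ?S"
      show "\<exists>d>0. \<forall>s. q s \<noteq> 0 \<longrightarrow> d \<le> dist (cis s) w"
      proof (cases "cmod w < 1")
        case True
        then show ?thesis using dist_cis_ge by (intro exI[of _ "1 - cmod w"]) auto
      next
        case False
        then have we: "dist e w < d" using w by auto
        have "d - dist e w \<le> dist (cis s) w" if "q s \<noteq> 0" for s
          using far[OF that] dist_triangle[of "cis s" e w] by (simp add: dist_commute)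
        then show ?thesis using we by (intro exI[of _ "d - dist e w"]) auto
      qed
    qed auto
    show "connected ?S"
    proof (rule connected_Un)
      \<comment> \<open>A point on the radius to \<open>e\<close>, inside the disc and closer to
        \<open>e\<close> than \<open>d\<close>, shows that the two balls overlap.\<close>
      define c where "c = 1 - min d 1 / 2"
      have "0 \<le> c" "c < 1" "1 - c < d" using d by (auto simp: c_def min_def)
      then have "of_real c * e \<in> ball 0 1 \<inter> ball e d"
      proof -
        have "e - of_real c * e = of_real (1 - c) * e" by (simp add: algebra_simps)
        then have "dist e (of_real c * e) = \<bar>1 - c\<bar>"
          using e(1) by (simp only: dist_norm norm_mult norm_of_real mult_1_right)
        then show ?thesis using e(1) \<open>0 \<le> c\<close> \<open>c < 1\<close> \<open>1 - c < d\<close> by (simp add: norm_mult)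
      qed
      then show "ball 0 1 \<inter> ball e d \<noteq> {}" by blast
    qed auto
    show "e islimpt cis ` Z \<inter> ball e d"
      unfolding islimpt_approachable
    proof (intro allI impI)
      fix \<epsilon> :: real assume "\<epsilon> > 0"
      then obtain x where "x \<in> cis ` Z" "x \<noteq> e" "dist x e < min \<epsilon> d"
        using e(2) d unfolding islimpt_approachable by (metis min_less_iff_conj)
      then show "\<exists>x\<in>cis ` Z \<inter> ball e d. x \<noteq> e \<and> dist x e < \<epsilon>"
        by (intro bexI[of _ x]) (auto simp: dist_commute)
    qed
    show "herglotz q z = 0" if "z \<in> cis ` Z \<inter> ball e d" for z
      using that zero by auto
  qed (use w d in auto)
qed

text \<open>Source of additive competitors for the case that \<open>g0\<close> vanishes.\<close>

lemma monomial_H2: "H2 (\<lambda>z. c * z ^ k)"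
  unfolding H2_mu
proof (intro conjI allI impI)
  show m: "(\<lambda>t. c * cis t ^ k) \<in> borel_measurable mu" by measurable
  show "integrable mu (\<lambda>t. (cmod (c * cis t ^ k))\<^sup>2)"
    by (simp add: norm_mult norm_power)
  fix j :: nat assume j: "j \<ge> 1"
  have "(LINT t|mu. c * cis t ^ k * cis (real j * t)) = (LINT t|mu. c * cis (of_int (int (k + j)) * t))"
    by (intro Bochner_Integration.integral_cong) (simp_all add: Complex.DeMoivre cis_mult algebra_simps)
  also have "\<dots> = 0" using j by (subst integral_mult_right_zero) (simp only: integral_mu_cis, simp)
  finally show "(LINT t|mu. c * cis t ^ k * cis (real j * t)) = 0" .
qed

section \<open>The density of the first variation and its vanishing\<close>

locale bep_variation =
  fixes I :: "complex set" and f g0 :: "complex \<Rightarrow> complex" and F :: "real \<Rightarrow> complex"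
  assumes sol: "BEP_solution I f g0" and I: "circ_measurable I" and f: "L2_on I f"
  defines "F \<equiv> \<lambda>t. indicator (ang I) t *\<^sub>R (cnj (f (cis t) - g0 (cis t)) * g0 (cis t))"
begin

lemma F_integrable: "integrable mu F"
  unfolding F_def using L2_cross_integrable(2)[OF I f] sol by (simp add: BEP_solution_def)

lemma F_outside: "cis t \<notin> I \<Longrightarrow> F t = 0"
  by (simp add: F_def ang_def indicator_def)

lemma F_variation:
  fixes h :: "real \<Rightarrow> real"
  assumes h: "h \<in> borel_measurable mu" "\<And>s. \<bar>h s\<bar> \<le> C" and \<delta>: "\<delta> > 0"
    and J: "AE t in mu. cis t \<notin> I \<longrightarrow> h t = 0 \<or> cmod (g0 (cis t)) \<le> 1 - \<delta>"
  obtains r :: "nat \<Rightarrow> real" and H :: "complex \<Rightarrow> complex"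
  where "\<And>n. 0 < r n" "\<And>n. r n < 1" "r \<longlonglongrightarrow> 1"
    "(\<lambda>t. H (cis t)) \<in> borel_measurable mu"
    "AE t in mu. (\<lambda>n. herglotz h (r n * cis t)) \<longlonglongrightarrow> H (cis t)"
    "AE t in mu. Re (H (cis t)) = h t"
    "\<And>N::nat. N \<ge> 1 \<Longrightarrow> Re (LINT t|mu. F t * (of_nat N * sinh (H (cis t) / of_nat N))) = 0"
proof (rule herglotz_variation[OF sol I f h \<delta> J])
  fix r :: "nat \<Rightarrow> real" and H :: "complex \<Rightarrow> complex"
  assume *: "\<And>n. 0 < r n" "\<And>n. r n < 1" "r \<longlonglongrightarrow> 1"
    "(\<lambda>t. H (cis t)) \<in> borel_measurable mu"
    "AE t in mu. (\<lambda>n. herglotz h (r n * cis t)) \<longlonglongrightarrow> H (cis t)"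
    "AE t in mu. Re (H (cis t)) = h t"
    "\<And>N::nat. N \<ge> 1 \<Longrightarrow> Re (LINT t|mu. indicator (ang I) t *\<^sub>R (cnj (f (cis t) - g0 (cis t)) * g0 (cis t)) *
        (of_nat N * sinh (H (cis t) / of_nat N))) = 0"
  have "Re (LINT t|mu. F t * (of_nat N * sinh (H (cis t) / of_nat N))) = 0" if "N \<ge> 1" for N :: nat
    using *(7)[OF that] unfolding F_def .
  with *(1-6) show thesis by (rule that)
qed

text \<open>The test function is the very quantity to be annihilated: \<open>h = \<Phi>\<close> on
  \<open>E\<close>, where \<open>\<Phi>\<close> is the Herglotz integral of \<open>Im F\<close> up
  to the factor \<open>\<i> / (2*pi)\<close>. The variation then says that the square of
  \<open>\<Phi>\<close> has integral 0 over \<open>E\<close>.\<close>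

lemma F_real:
  assumes E: "E \<in> sets mu" "measure mu E > 0"
    and \<delta>: "\<delta> > 0" "\<And>t. t \<in> E \<Longrightarrow> cmod (g0 (cis t)) \<le> 1 - \<delta>"
    and d: "d > 0" "\<And>t x. t \<in> E \<Longrightarrow> x \<in> I \<Longrightarrow> d \<le> dist x (cis t)"
  shows "AE t in mu. Im (F t) = 0"
proof -
  define q where "q t = Im (F t)" for t
  have q: "integrable mu q" unfolding q_def using F_integrable by (rule integrable_Im)
  have qI: "cis t \<in> I" if "q t \<noteq> 0" for t
    using that F_outside[of t] unfolding q_def by (metis zero_complex.sel(2))
  have qE: "d \<le> dist (cis s) (cis t)" if "q s \<noteq> 0" "t \<in> E" for s t
    using d(2)[OF that(2) qI[OF that(1)]] .
  \<comment> \<open>Off the diagonal \<open>\<kappa> s t\<close> is the cotangent of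
    \<open>(t - s) / 2\<close>.\<close>
  define \<kappa> where "\<kappa> s t = Im ((cis s + cis t) / (cis s - cis t))" for s t
  have kernel: "(cis s + cis t) / (cis s - cis t) = \<i> * \<kappa> s t" for s t
    using herglotz_kernel_circle[of s t] by (simp add: complex_eq_iff \<kappa>_def)
  have \<kappa>m[measurable]: "(\<lambda>(s,t). \<kappa> s t) \<in> borel_measurable (mu \<Otimes>\<^sub>M mu)"
    unfolding \<kappa>_def by measurable
  have \<kappa>b: "\<bar>\<kappa> s t\<bar> \<le> 2/d + 1" if "d \<le> dist (cis s) (cis t)" for s t
    using herglotz_kernel_bound[OF d(1) that] unfolding kernel by (simp add: norm_mult)
  have \<kappa>_anti: "\<kappa> s t = - \<kappa> t s" for s t
  proof -
    have "(cis s + cis t) / (cis s - cis t) = - ((cis t + cis s) / (cis t - cis s))"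
      by (metis add.commute minus_diff_eq minus_divide_right)
    then show ?thesis unfolding \<kappa>_def by simp
  qed
  define \<Phi> where "\<Phi> t = (LINT s|mu. q s * \<kappa> s t)" for t
  have herg: "herglotz u (cis t) = \<i> * of_real ((LINT s|mu. u s * \<kappa> s t) / (2*pi))" for u t
  proof -
    have "herglotz u (cis t) = (LINT s|mu. \<i> * of_real (u s * \<kappa> s t)) / (2*pi)"
      unfolding herglotz_def kernel by (simp add: mult_ac)
    also have "\<dots> = \<i> * (LINT s|mu. complex_of_real (u s * \<kappa> s t)) / (2*pi)"
      by (subst integral_mult_right_zero) simp
    also have "(LINT s|mu. complex_of_real (u s * \<kappa> s t)) = of_real (LINT s|mu. u s * \<kappa> s t)"
      by (rule integral_complex_of_real)
    finally show ?thesis by simp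
  qed
  have [measurable]: "q \<in> borel_measurable mu" using q by simp
  have \<Phi>m[measurable]: "\<Phi> \<in> borel_measurable mu"
    unfolding \<Phi>_def[abs_def] by measurable
  define B where "B = (LINT s|mu. \<bar>q s\<bar>) * (2/d + 1)"
  have \<Phi>B: "\<bar>\<Phi> t\<bar> \<le> B" if "t \<in> E" for t
  proof -
    have b: "\<bar>q s * \<kappa> s t\<bar> \<le> \<bar>q s\<bar> * (2/d + 1)" for s
      using \<kappa>b[OF qE[of s t]] that by (cases "q s = 0") (auto simp: abs_mult intro!: mult_left_mono)
    have "\<bar>\<Phi> t\<bar> \<le> (LINT s|mu. \<bar>q s * \<kappa> s t\<bar>)" unfolding \<Phi>_def by (rule integral_abs_bound)
    also have "\<dots> \<le> (LINT s|mu. \<bar>q s\<bar> * (2/d + 1))"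
    proof (rule integral_mono')
      show "0 \<le> \<bar>q s\<bar> * (2/d + 1)" for s using d(1) by simp
    qed (use b q in auto)
    also have "\<dots> = B" unfolding B_def by (rule integral_mult_left_zero)
    finally show ?thesis .
  qed
  define h where "h t = indicator E t * \<Phi> t" for t
  have hm[measurable]: "h \<in> borel_measurable mu" unfolding h_def[abs_def] using E(1) by simp
  have B0: "B \<ge> 0" unfolding B_def using d(1) by (intro mult_nonneg_nonneg) auto
  have hB: "\<bar>h t\<bar> \<le> B" for t using \<Phi>B[of t] B0 by (simp add: h_def indicator_def)
  have hE: "t \<in> E" if "h t \<noteq> 0" for t using that by (auto simp: h_def indicator_def split: if_splits)
  have hi: "integrable mu h" using hm hB by (intro integrable_mu_bounded[where C=B]) auto
  have hJ: "AE t in mu. cis t \<notin> I \<longrightarrow> h t = 0 \<or> cmod (g0 (cis t)) \<le> 1 - \<delta>"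
    using hE \<delta>(2) by (intro AE_I2) blast
  obtain r and H :: "complex \<Rightarrow> complex" where r: "\<And>n::nat. 0 < r n" "\<And>n. r n < (1::real)" "r \<longlonglongrightarrow> 1"
    and Hm: "(\<lambda>t. H (cis t)) \<in> borel_measurable mu"
    and H: "AE t in mu. (\<lambda>n. herglotz h (r n * cis t)) \<longlonglongrightarrow> H (cis t)" "AE t in mu. Re (H (cis t)) = h t"
    and var: "\<And>N::nat. N \<ge> 1 \<Longrightarrow> Re (LINT t|mu. F t * (of_nat N * sinh (H (cis t) / of_nat N))) = 0"
    by (rule F_variation[OF hm hB \<delta>(1) hJ], rule that)
  \<comment> \<open>Points of \<open>I\<close> keep distance \<open>d\<close> from the support of
    \<open>h\<close>, so the transform is continuous there and its radial limit is its value on the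
    circle.\<close>
  have HI: "AE t in mu. cis t \<in> I \<longrightarrow> H (cis t) = herglotz h (cis t)"
    using H(1)
  proof eventually_elim
    case (elim t)
    show ?case
    proof
      assume t: "cis t \<in> I"
      have "herglotz h holomorphic_on ball (cis t) (d/2)"
      proof (rule herglotz_holomorphic_away[OF hi open_ball])
        fix w assume w: "w \<in> ball (cis t) (d/2)"
        have "d/2 \<le> dist (cis s) w" if "h s \<noteq> 0" for s
          using d(2)[OF hE[OF that] t] dist_triangle[of "cis t" "cis s" w] w by (simp add: dist_commute)
        then show "\<exists>d>0. \<forall>s. h s \<noteq> 0 \<longrightarrow> d \<le> dist (cis s) w"
          using d(1) by (intro exI[of _ "d/2"]) auto
      qed
      then have cont: "isCont (herglotz h) (cis t)"
        using d(1) by (intro continuous_on_interior[OF holomorphic_on_imp_continuous_on]) auto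
      have "(\<lambda>n. of_real (r n) * cis t) \<longlonglongrightarrow> of_real 1 * cis t"
        using r(3) by (intro tendsto_intros)
      then have "(\<lambda>n. herglotz h (r n * cis t)) \<longlonglongrightarrow> herglotz h (cis t)"
        using isCont_tendsto_compose[OF cont] by simp
      then show "H (cis t) = herglotz h (cis t)" using elim LIMSEQ_unique by blast
    qed
  qed
  define D where "D = B * (2/d + 1)"
  have hergD: "cmod (herglotz h (cis t)) \<le> D" if t: "cis t \<in> I" for t
  proof -
    have "\<bar>h s * \<kappa> s t\<bar> \<le> D" for s
    proof (cases "h s = 0")
      case False
      then have "d \<le> dist (cis s) (cis t)" using d(2)[OF hE t] by (simp add: dist_commute)
      from \<kappa>b[OF this] hB[of s] B0 show ?thesis unfolding D_def abs_mult by (intro mult_mono) auto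
    qed (use B0 d(1) in \<open>simp add: D_def\<close>)
    then have "\<bar>LINT s|mu. h s * \<kappa> s t\<bar> \<le> (LINT s|mu. D)"
      by (intro order_trans[OF integral_abs_bound] integral_mono') (use B0 d(1) in \<open>auto simp: D_def\<close>)
    also have "\<dots> = D * (2 * pi)" by simp
    finally show ?thesis unfolding herg norm_mult norm_of_real
      by (simp add: abs_divide pos_divide_le_eq)
  qed
  \<comment> \<open>The shift secures \<open>2 * D \<le> N\<close> for the uniform
    \<open>sinh\<close> bound and \<open>N \<ge> 1\<close> for the variation; in the limit
    \<open>H\<close> itself is the test function on \<open>I\<close>.\<close>
  have "(\<lambda>n. LINT t|mu. F t * (of_nat (n + nat \<lceil>2 * D + 1\<rceil>) * sinh (H (cis t) / of_nat (n + nat \<lceil>2 * D + 1\<rceil>)))) \<longlonglongrightarrow>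
      (LINT t|mu. F t * herglotz h (cis t))"
  proof (rule integral_dominated_convergence)
    let ?N = "\<lambda>n. n + nat \<lceil>2 * D + 1\<rceil>"
    have N: "2 * D \<le> real (?N n)" for n by linarith
    show "integrable mu (\<lambda>t. cmod (F t) * (3/2 * D))" using F_integrable by simp
    have Fm: "F \<in> borel_measurable mu" using F_integrable by simp
    show "(\<lambda>t. F t * (of_nat (?N n) * sinh (H (cis t) / of_nat (?N n)))) \<in> borel_measurable mu" for n
    proof -
      have "(\<lambda>t. exp (H (cis t) / of_nat (?N n))) \<in> borel_measurable mu"
        by (rule measurable_compose[OF _ borel_measurable_exp]) (use Hm in simp)
      moreover have "(\<lambda>t. exp (- (H (cis t) / of_nat (?N n)))) \<in> borel_measurable mu"
        by (rule measurable_compose[OF _ borel_measurable_exp]) (use Hm in simp)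
      ultimately show ?thesis unfolding sinh_field_def using Fm by simp
    qed
    show "AE t in mu. (\<lambda>n. F t * (of_nat (?N n) * sinh (H (cis t) / of_nat (?N n)))) \<longlonglongrightarrow> F t * herglotz h (cis t)"
      using HI
    proof eventually_elim
      case (elim t)
      show ?case
      proof (cases "cis t \<in> I")
        case True
        have "(\<lambda>n. of_nat (?N n) * sinh (H (cis t) / of_nat (?N n))) \<longlonglongrightarrow> H (cis t)"
          by (rule LIMSEQ_ignore_initial_segment[OF tendsto_mult_sinh])
        then show ?thesis using elim True by (intro tendsto_mult tendsto_const) simp
      qed (simp add: F_outside)
    qed
    show "AE t in mu. norm (F t * (of_nat (?N n) * sinh (H (cis t) / of_nat (?N n)))) \<le> cmod (F t) * (3/2 * D)" for n
      using HI
    proof eventually_elim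
      case (elim t)
      show ?case
      proof (cases "cis t \<in> I")
        case True
        then have "cmod (H (cis t)) \<le> D" using elim hergD by simp
        from norm_mult_sinh_le[OF this N[of n]] show ?thesis
          unfolding norm_mult[of "F t"] by (intro mult_left_mono) auto
      qed (simp add: F_outside)
    qed
    have "(\<lambda>t. LINT s|mu. h s * \<kappa> s t) \<in> borel_measurable mu" by measurable
    then show "(\<lambda>t. F t * herglotz h (cis t)) \<in> borel_measurable mu"
      unfolding herg using Fm by simp
  qed
  then have lim: "(\<lambda>n. Re (LINT t|mu. F t * (of_nat (n + nat \<lceil>2 * D + 1\<rceil>) *
      sinh (H (cis t) / of_nat (n + nat \<lceil>2 * D + 1\<rceil>))))) \<longlonglongrightarrow> Re (LINT t|mu. F t * herglotz h (cis t))"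
    by (rule tendsto_Re)
  have "D \<ge> 0" using B0 d(1) by (simp add: D_def)
  then have "n + nat \<lceil>2 * D + 1\<rceil> \<ge> 1" for n by linarith
  from lim[unfolded var[OF this]] have "(\<lambda>n::nat. 0) \<longlonglongrightarrow> Re (LINT t|mu. F t * herglotz h (cis t))" .
  then have 0: "Re (LINT t|mu. F t * herglotz h (cis t)) = 0" by (simp add: LIMSEQ_const_iff)
  \<comment> \<open>By the choice of \<open>h\<close> this is the integral of the square of
    \<open>\<Phi>\<close> over \<open>E\<close>.\<close>
  define P where "P = (LINT s|mu. h s * \<Phi> s)"
  have P: "P = (LINT t|mu. q t * (LINT s|mu. h s * \<kappa> t s))"
  proof -
    have ki: "integrable (mu \<Otimes>\<^sub>M mu) (\<lambda>(t,s). q t * (h s * \<kappa> t s))"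
    proof (rule integrable_pair_kernel[OF q, where C="B * (2/d+1)"])
      show "(\<lambda>(t,s). h s * \<kappa> t s) \<in> borel_measurable (mu \<Otimes>\<^sub>M mu)" by measurable
      show "norm (h s * \<kappa> t s) \<le> B * (2/d + 1)" if "q t \<noteq> 0" for t s
      proof (cases "h s = 0")
        case False
        from \<kappa>b[OF qE[OF that hE[OF this]]] hB[of s] B0 show ?thesis
          unfolding real_norm_def abs_mult by (intro mult_mono) auto
      qed (use B0 d(1) in simp)
    qed
    have "P = (LINT s|mu. LINT t|mu. q t * (h s * \<kappa> t s))"
      unfolding P_def \<Phi>_def by (subst integral_mult_right_zero[symmetric]) (simp add: mult_ac)
    also have "\<dots> = (LINT t|mu. LINT s|mu. q t * (h s * \<kappa> t s))"
      by (rule mu_pair.Fubini_integral[OF ki])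
    also have "\<dots> = (LINT t|mu. q t * (LINT s|mu. h s * \<kappa> t s))"
      by (subst integral_mult_right_zero) (rule refl)
    finally show ?thesis .
  qed
  have "P = 0"
  proof -
    \<comment> \<open>Exchanging the angles costs a sign, and
      \<open>Re (F t * (- \<i> * x)) = Im (F t) * x\<close> for real \<open>x\<close>: a test
      function imaginary on \<open>I\<close> isolates \<open>Im F\<close>.\<close>
    have herg': "herglotz h (cis t) = - \<i> * of_real ((LINT s|mu. h s * \<kappa> t s) / (2*pi))" for t
      unfolding herg by (subst \<kappa>_anti) simp
    have Fh: "integrable mu (\<lambda>t. F t * herglotz h (cis t))"
    proof (rule Bochner_Integration.integrable_bound)
      show "integrable mu (\<lambda>t. cmod (F t) * D)" using F_integrable by simp
      have "(\<lambda>t. LINT s|mu. h s * \<kappa> s t) \<in> borel_measurable mu" by measurable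
      then show "(\<lambda>t. F t * herglotz h (cis t)) \<in> borel_measurable mu"
        unfolding herg using F_integrable by simp
      have "cmod (F t * herglotz h (cis t)) \<le> cmod (F t) * D" for t
        using hergD[of t] F_outside[of t] by (cases "cis t \<in> I") (auto simp: norm_mult intro!: mult_left_mono)
      then show "AE t in mu. norm (F t * herglotz h (cis t)) \<le> norm (cmod (F t) * D)"
        using \<open>D \<ge> 0\<close> by simp
    qed
    have "Re (LINT t|mu. F t * herglotz h (cis t)) = (LINT t|mu. Re (F t * herglotz h (cis t)))"
      by (rule integral_Re[OF Fh, symmetric])
    also have "\<dots> = (LINT t|mu. q t * (LINT s|mu. h s * \<kappa> t s) / (2*pi))"
      unfolding herg' q_def by simp
    also have "\<dots> = P / (2*pi)" unfolding P by simp
    finally show ?thesis using 0 by simp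
  qed
  have hP: "integrable mu (\<lambda>s. h s * \<Phi> s)"
  proof (rule integrable_mu_bounded[where C="B * B"])
    show "AE s in mu. norm (h s * \<Phi> s) \<le> B * B"
    proof (rule AE_I2)
      fix s show "norm (h s * \<Phi> s) \<le> B * B"
        using hB[of s] \<Phi>B[of s] B0 hE[of s]
        by (cases "h s = 0") (auto simp: abs_mult intro!: mult_mono)
    qed
  qed measurable
  have "AE s in mu. h s * \<Phi> s = 0"
    using integral_nonneg_eq_0_iff_AE[OF hP] \<open>P = 0\<close>
    by (auto simp: P_def h_def indicator_def)
  then have \<Phi>0: "AE s in mu. s \<in> E \<longrightarrow> \<Phi> s = 0"
    by eventually_elim (auto simp: h_def indicator_def)
  \<comment> \<open>Positive measure makes this set infinite, which is enough for an accumulation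
    point of zeros.\<close>
  define Z where "Z = {t \<in> E. \<Phi> t = 0}"
  have Esub: "E \<subseteq> {0..<2*pi}" using sets.sets_into_space[OF E(1)] by simp
  have "infinite Z"
  proof
    assume "finite Z"
    then have "Z \<in> null_sets lebesgue"
      using negligible_finite negligible_iff_null_sets by blast
    then have "AE t in lebesgue. t \<in> {0..<2*pi} \<longrightarrow> t \<notin> Z"
      using AE_not_in by fastforce
    then have "AE t in mu. t \<notin> Z"
      by (simp only: AE_mu_iff)
    with \<Phi>0 have "AE t in mu. t \<notin> E" by eventually_elim (auto simp: Z_def)
    then have "emeasure mu E = 0"
      using AE_iff_null_sets[OF E(1)] by auto
    then show False using E(2) by (simp add: measure_def)
  qed
  have "AE t in mu. q t = 0"
  proof (rule AE_zero_of_Re_herglotz_zero[OF q])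
    fix w :: complex assume "cmod w < 1"
    have "herglotz q w = 0"
    proof (rule herglotz_zero_of_boundary_zeros[OF q d(1) \<open>infinite Z\<close> _ _ _ \<open>cmod w < 1\<close>])
      show "Z \<subseteq> {0..<2*pi}" using Esub by (auto simp: Z_def)
      show "d \<le> dist (cis s) (cis t)" if "t \<in> Z" "q s \<noteq> 0" for s t
        using qE that by (auto simp: Z_def)
      show "herglotz q (cis t) = 0" if "t \<in> Z" for t
        using that unfolding herg \<Phi>_def[symmetric] by (simp add: Z_def)
    qed
    then show "Re (herglotz q w) = 0" by simp
  qed
  then show ?thesis by (simp add: q_def)
qed

text \<open>For real \<open>F\<close> and \<open>h = sgn (Re F)\<close> the variation is a positive
  multiple of the integral of \<open>\<bar>Re F\<bar> * cos (Im H / N)\<close>. \<open>Im H\<close>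
  is finite at each angle, so the cosine tends to 1, with \<open>\<bar>Re F\<bar>\<close> as
  dominating function.\<close>

lemma F_zero:
  assumes real: "AE t in mu. Im (F t) = 0"
  shows "AE t in mu. F t = 0"
proof -
  have [measurable]: "F \<in> borel_measurable mu" using F_integrable by simp
  define h where "h t = sgn (Re (F t))" for t
  have hm: "h \<in> borel_measurable mu" unfolding h_def[abs_def] by measurable
  have h1: "\<bar>h t\<bar> \<le> 1" for t by (simp add: h_def sgn_if)
  \<comment> \<open>\<open>h\<close> vanishes off \<open>I\<close>, so the first alternative always
    holds and \<open>1/2\<close> merely stands for some positive slack.\<close>
  have hJ: "AE t in mu. cis t \<notin> I \<longrightarrow> h t = 0 \<or> cmod (g0 (cis t)) \<le> 1 - 1/2"
    using F_outside by (intro AE_I2) (simp add: h_def)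
  obtain r :: "nat \<Rightarrow> real" and H :: "complex \<Rightarrow> complex" where "\<And>n. 0 < r n" "\<And>n. r n < 1" "r \<longlonglongrightarrow> 1"
    and Hm: "(\<lambda>t. H (cis t)) \<in> borel_measurable mu"
    and "AE t in mu. (\<lambda>n. herglotz h (r n * cis t)) \<longlonglongrightarrow> H (cis t)"
    and H: "AE t in mu. Re (H (cis t)) = h t"
    and var: "\<And>N::nat. N \<ge> 1 \<Longrightarrow> Re (LINT t|mu. F t * (of_nat N * sinh (H (cis t) / of_nat N))) = 0"
    by (rule F_variation[OF hm h1 _ hJ], simp, rule that)
  define y where "y t = Im (H (cis t))" for t
  have [measurable]: "y \<in> borel_measurable mu" unfolding y_def[abs_def] using Hm by simp
  have cosint: "(LINT t|mu. \<bar>Re (F t)\<bar> * cos (y t / N)) = 0" if N: "N \<ge> 1" for N :: nat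
  proof -
    have pt: "AE t in mu. Re (F t * (of_nat N * sinh (H (cis t) / of_nat N))) = N * sinh (1 / N) * (\<bar>Re (F t)\<bar> * cos (y t / N))"
      using H real
    proof eventually_elim
      case (elim t)
      \<comment> \<open>Oddness of \<open>sinh\<close>; where \<open>h t = 0\<close> both sides are
        0.\<close>
      have "Re (F t) * sinh (h t / N) = \<bar>Re (F t)\<bar> * sinh (1 / N)"
        by (simp add: h_def sgn_if)
      then have "Re (F t) * sinh (h t / N) * cos (y t / N) = \<bar>Re (F t)\<bar> * sinh (1 / N) * cos (y t / N)" by simp
      moreover have "Re (sinh (H (cis t) / of_nat N)) = sinh (h t / N) * cos (y t / N)"
        using elim(1) by (simp add: Re_sinh_complex y_def)
      ultimately show ?case using elim(2) by (simp add: algebra_simps)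
    qed
    have sinhm: "(\<lambda>t. sinh (H (cis t) / of_nat N)) \<in> borel_measurable mu"
    proof -
      have "(\<lambda>t. exp (H (cis t) / of_nat N)) \<in> borel_measurable mu"
        by (rule measurable_compose[OF _ borel_measurable_exp]) (use Hm in simp)
      moreover have "(\<lambda>t. exp (- (H (cis t) / of_nat N))) \<in> borel_measurable mu"
        by (rule measurable_compose[OF _ borel_measurable_exp]) (use Hm in simp)
      ultimately show ?thesis unfolding sinh_field_def by simp
    qed
    have int: "integrable mu (\<lambda>t. F t * (of_nat N * sinh (H (cis t) / of_nat N)))"
    proof (rule integrable_mu_mult_bounded[OF F_integrable])
      show "AE t in mu. norm (of_nat N * sinh (H (cis t) / of_nat N)) \<le> N * exp 1"
        using H
      proof eventually_elim
        case (elim t)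
        have "\<bar>h t\<bar> / N \<le> \<bar>h t\<bar> / 1" using N by (intro frac_le) auto
        then have "\<bar>Re (H (cis t) / of_nat N)\<bar> \<le> 1" using elim h1[of t] by simp
        then have "cmod (sinh (H (cis t) / of_nat N)) \<le> exp 1"
          by (intro order_trans[OF norm_sinh_le]) simp
        then show ?case by (simp add: norm_mult mult_left_mono)
      qed
    qed (use sinhm in simp)
    have "0 = (LINT t|mu. Re (F t * (of_nat N * sinh (H (cis t) / of_nat N))))"
      unfolding integral_Re[OF int] var[OF N] by (rule refl)
    also have "\<dots> = (LINT t|mu. N * sinh (1 / N) * (\<bar>Re (F t)\<bar> * cos (y t / N)))"
    proof (rule integral_cong_AE[OF _ _ pt])
      show "(\<lambda>t. Re (F t * (of_nat N * sinh (H (cis t) / of_nat N)))) \<in> borel_measurable mu"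
        by (rule borel_measurable_integrable[OF integrable_Re[OF int]])
    qed measurable
    also have "\<dots> = N * sinh (1 / N) * (LINT t|mu. \<bar>Re (F t)\<bar> * cos (y t / N))"
      by (rule integral_mult_right_zero)
    finally show ?thesis using N by simp
  qed
  have "(\<lambda>n. LINT t|mu. \<bar>Re (F t)\<bar> * cos (y t / real (Suc n))) \<longlonglongrightarrow> (LINT t|mu. \<bar>Re (F t)\<bar>)"
  proof (rule integral_dominated_convergence)
    show "integrable mu (\<lambda>t. \<bar>Re (F t)\<bar>)" using F_integrable by simp
    have "norm (\<bar>Re (F t)\<bar> * cos (y t / real (Suc n))) \<le> \<bar>Re (F t)\<bar>" for n t
      unfolding real_norm_def abs_mult using abs_cos_le_one by (simp add: mult_left_le)
    then show "AE t in mu. norm (\<bar>Re (F t)\<bar> * cos (y t / real (Suc n))) \<le> \<bar>Re (F t)\<bar>" for n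
      by simp
    have "(\<lambda>n. y t / real (Suc n)) \<longlonglongrightarrow> 0" for t
      by (intro real_tendsto_divide_at_top[OF tendsto_const] filterlim_compose[OF filterlim_real_sequentially filterlim_Suc])
    then have "(\<lambda>n. \<bar>Re (F t)\<bar> * cos (y t / real (Suc n))) \<longlonglongrightarrow> \<bar>Re (F t)\<bar> * cos 0" for t
      by (intro tendsto_intros)
    then show "AE t in mu. (\<lambda>n. \<bar>Re (F t)\<bar> * cos (y t / real (Suc n))) \<longlonglongrightarrow> \<bar>Re (F t)\<bar>" by simp
  qed measurable
  then have "(LINT t|mu. \<bar>Re (F t)\<bar>) = 0"
    using cosint[of "Suc _"] by (simp add: LIMSEQ_const_iff)
  moreover have "integrable mu (\<lambda>t. \<bar>Re (F t)\<bar>)" using F_integrable by simp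
  ultimately have "AE t in mu. Re (F t) = 0"
    using integral_nonneg_eq_0_iff_AE[of mu "\<lambda>t. \<bar>Re (F t)\<bar>"] by simp
  with real show ?thesis by eventually_elim (simp add: complex_eq_iff)
qed

text \<open>If \<open>g0\<close> vanishes, multiplicative perturbations are void, but then every small multiple of a
  monomial is a competitor.\<close>

lemma eq_on_I_of_zero:
  assumes g0: "AE t in mu. g0 (cis t) = 0" and J: "measure mu ({0..<2*pi} - ang I) > 0"
  shows "AE t in mu. cis t \<in> I \<longrightarrow> f (cis t) = 0"
proof -
  have A: "ang I \<in> sets mu" by (rule circ_measurable_ang[OF I])
  \<comment> \<open>The linear term of the increment at \<open>g0 = 0\<close>: monomials read off
    its Fourier coefficients, and it vanishes off \<open>I\<close> by construction.\<close>
  define v where "v t = indicator (ang I) t *\<^sub>R cnj (f (cis t))" for t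
  have fm: "(\<lambda>t. indicator (ang I) t *\<^sub>R f (cis t)) \<in> borel_measurable mu"
    and f2: "integrable mu (\<lambda>t. indicator (ang I) t * (cmod (f (cis t)))\<^sup>2)"
    using f by (auto simp: L2_on_mu[OF I])
  have "integrable mu (\<lambda>t. indicator (ang I) t *\<^sub>R f (cis t))"
  proof (rule integrable_square_imp_integrable_mu[OF fm])
    have "(cmod (indicator (ang I) t *\<^sub>R f (cis t)))\<^sup>2 = indicator (ang I) t * (cmod (f (cis t)))\<^sup>2" for t
      by (simp add: indicator_def)
    then show "integrable mu (\<lambda>t. (cmod (indicator (ang I) t *\<^sub>R f (cis t)))\<^sup>2)" using f2 by simp
  qed
  from integrable_cnj[OF this] have v: "integrable mu v"
    unfolding v_def[abs_def] by simp
  have key: "Re (c * (LINT t|mu. v t * cis (real k * t))) \<le> 0" if c: "cmod c = 1" for c k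
  proof (rule field_le_epsilon)
    fix e :: real assume e: "e > 0"
    have vk: "integrable mu (\<lambda>t. v t * cis (real k * t))"
      by (rule integrable_mu_mult_bounded[OF v, where C=1])
         (auto intro!: measurable_mu_borel borel_measurable_continuous_onI continuous_intros)
    \<comment> \<open>\<open>\<delta> \<le> 1\<close> keeps the monomial admissible; after division
      by \<open>2 * \<delta>\<close> the quadratic term leaves \<open>\<delta> * pi\<close>, which
      must not exceed \<open>e\<close>.\<close>
    define \<delta> where "\<delta> = min 1 (e / pi)"
    have \<delta>: "0 < \<delta>" "\<delta> \<le> 1" "\<delta> * pi \<le> e" using e by (auto simp: \<delta>_def min_def field_simps)
    let ?g = "\<lambda>z. (of_real \<delta> * c) * z ^ k"
    have g1: "cmod (?g (cis t)) = \<delta>" for t using c \<delta> by (simp add: norm_mult norm_power)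
    have indint: "integrable mu (\<lambda>t. indicator (ang I) t * \<delta>\<^sup>2)"
      using A by (intro integrable_mu_bounded[where C="\<delta>\<^sup>2"]) (auto simp: indicator_def)
    have "AE_on (circ - I) (\<lambda>z. cmod (?g z) \<le> 1)"
      unfolding AE_on_mu using g1 \<delta> by (intro AE_I2) simp
    from BEP_solution_optimal[OF sol I f monomial_H2 this]
    have "0 \<le> (LINT t|mu. indicator (ang I) t * ((cmod (?g (cis t) - g0 (cis t)))\<^sup>2 -
        2 * Re (cnj (f (cis t) - g0 (cis t)) * (?g (cis t) - g0 (cis t)))))" .
    also have "\<dots> = (LINT t|mu. indicator (ang I) t * \<delta>\<^sup>2 - 2 * \<delta> * Re (c * (v t * cis (real k * t))))"
    proof (rule integral_cong_AE)
      show "AE t in mu. indicator (ang I) t * ((cmod (?g (cis t) - g0 (cis t)))\<^sup>2 -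
        2 * Re (cnj (f (cis t) - g0 (cis t)) * (?g (cis t) - g0 (cis t)))) =
        indicator (ang I) t * \<delta>\<^sup>2 - 2 * \<delta> * Re (c * (v t * cis (real k * t)))"
        using g0
      proof eventually_elim
        case (elim t)
        have "cnj (f (cis t)) * ?g (cis t) = of_real \<delta> * (c * (cnj (f (cis t)) * cis (real k * t)))"
          by (simp add: Complex.DeMoivre mult_ac)
        then have "Re (cnj (f (cis t)) * ?g (cis t)) = \<delta> * Re (c * (cnj (f (cis t)) * cis (real k * t)))"
          by (simp only: Re_complex_of_real times_complex.sel Im_complex_of_real)
        then show ?case using elim g1[of t] by (cases "t \<in> ang I") (simp_all add: v_def del: times_complex.sel)
      qed
      let ?d = "\<lambda>t. indicator (ang I) t *\<^sub>R f (cis t) - indicator (ang I) t *\<^sub>R g0 (cis t)"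
      have g0m: "(\<lambda>t. g0 (cis t)) \<in> borel_measurable mu"
        using sol by (simp add: BEP_solution_def H2_mu)
      have dm: "?d \<in> borel_measurable mu"
        by (rule borel_measurable_diff[OF fm]) (use g0m A in simp)
      have "(\<lambda>t. cnj (?d t)) \<in> borel_measurable mu"
        using measurable_compose[OF dm borel_measurable_continuous_onI[of cnj]]
        by (simp add: continuous_on_cnj)
      moreover have gd: "(\<lambda>t. ?g (cis t) - g0 (cis t)) \<in> borel_measurable mu"
        using g0m by (intro borel_measurable_diff borel_measurable_times borel_measurable_power) auto
      ultimately have "(\<lambda>t. cnj (?d t) * (?g (cis t) - g0 (cis t))) \<in> borel_measurable mu"
        by (rule borel_measurable_times)
      from measurable_compose[OF this borel_measurable_continuous_onI[of Re]]
      have [measurable]: "(\<lambda>t. Re (cnj (?d t) * (?g (cis t) - g0 (cis t)))) \<in> borel_measurable mu"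
        by (simp only: continuous_on_Re continuous_on_id)
      have [measurable]: "(\<lambda>t. cmod (?g (cis t) - g0 (cis t))) \<in> borel_measurable mu"
        by (rule measurable_compose[OF gd borel_measurable_norm])
      have [measurable]: "ang I \<in> sets mu" by (rule A)
      have m: "(\<lambda>t. indicator (ang I) t * (cmod (?g (cis t) - g0 (cis t)))\<^sup>2 -
          2 * Re (cnj (?d t) * (?g (cis t) - g0 (cis t)))) \<in> borel_measurable mu"
        by measurable
      have e: "indicator (ang I) t * ((cmod (?g (cis t) - g0 (cis t)))\<^sup>2 -
        2 * Re (cnj (f (cis t) - g0 (cis t)) * (?g (cis t) - g0 (cis t)))) =
        indicator (ang I) t * (cmod (?g (cis t) - g0 (cis t)))\<^sup>2 -
          2 * Re (cnj (?d t) * (?g (cis t) - g0 (cis t)))" for t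
        by (cases "t \<in> ang I") (simp_all del: times_complex.sel)
      show "(\<lambda>t. indicator (ang I) t * ((cmod (?g (cis t) - g0 (cis t)))\<^sup>2 -
        2 * Re (cnj (f (cis t) - g0 (cis t)) * (?g (cis t) - g0 (cis t))))) \<in> borel_measurable mu"
        unfolding e by (rule m)
    qed (use vk v A in auto)
    also have "\<dots> = (LINT t|mu. indicator (ang I) t * \<delta>\<^sup>2) - 2 * \<delta> * Re (c * (LINT t|mu. v t * cis (real k * t)))"
    proof -
      have cvk: "integrable mu (\<lambda>t. c * (v t * cis (real k * t)))" using vk by simp
      have "(LINT t|mu. indicator (ang I) t * \<delta>\<^sup>2 - 2 * \<delta> * Re (c * (v t * cis (real k * t)))) =
         (LINT t|mu. indicator (ang I) t * \<delta>\<^sup>2) - (LINT t|mu. 2 * \<delta> * Re (c * (v t * cis (real k * t))))"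
        by (rule Bochner_Integration.integral_diff[OF indint integrable_mult_right[OF integrable_Re[OF cvk]]])
      also have "(LINT t|mu. 2 * \<delta> * Re (c * (v t * cis (real k * t)))) =
          2 * \<delta> * (LINT t|mu. Re (c * (v t * cis (real k * t))))"
        by (rule integral_mult_right_zero)
      also have "(LINT t|mu. Re (c * (v t * cis (real k * t)))) = Re (c * (LINT t|mu. v t * cis (real k * t)))"
        unfolding integral_Re[OF cvk] by (subst integral_mult_right_zero) (rule refl)
      finally show ?thesis .
    qed
    finally have
      "2 * \<delta> * Re (c * (LINT t|mu. v t * cis (real k * t))) \<le> (LINT t|mu. indicator (ang I) t * \<delta>\<^sup>2)"
      by linarith
    also have "\<dots> \<le> (LINT t|mu. \<delta>\<^sup>2)"
      using indint by (intro integral_mono) (auto simp: indicator_def)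
    also have "\<dots> = 2 * pi * \<delta>\<^sup>2" by simp
    finally have "\<delta> * Re (c * (LINT t|mu. v t * cis (real k * t))) \<le> \<delta> * (\<delta> * pi)"
      by (simp add: power2_eq_square algebra_simps)
    then have "Re (c * (LINT t|mu. v t * cis (real k * t))) \<le> \<delta> * pi"
      using \<delta>(1) by (simp only: mult_le_cancel_left_pos)
    then show "Re (c * (LINT t|mu. v t * cis (real k * t))) \<le> 0 + e" using \<delta>(3) by simp
  qed
  \<comment> \<open>The values 1, -1, \<open>\<i>\<close>, \<open>-\<i>\<close> of \<open>c\<close>
    force the coefficients to vanish; then the uniqueness theorem applies, with the complement of
    \<open>I\<close> as zero set of positive measure.\<close>
  have "AE t in mu. v t = 0"
  proof (rule AE_zero_of_analytic_zero_set[OF v])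
    fix k :: nat
    show "(LINT t|mu. v t * cis (real k * t)) = 0"
      using key[of 1 k] key[of "-1" k] key[of \<i> k] key[of "-\<i>" k] by (simp add: complex_eq_iff)
  next
    show "{0..<2*pi} - ang I \<in> sets mu"
      using A sets.compl_sets[OF A] by simp
    show "AE t in mu. t \<in> {0..<2*pi} - ang I \<longrightarrow> v t = 0"
      by (intro AE_I2) (simp add: v_def)
  qed (use J in simp)
  then show ?thesis
    by (rule AE_mp) (intro AE_I2, auto simp: v_def in_ang_iff[of _ I] ang_def)
qed

end

text \<open>Outside \<open>I\<close> and outside its boundary means outside the closure, hence at
  positive distance. \<open>I\<close> must be nonempty because \<open>infdist\<close> to the empty
  set is 0.\<close>

lemma frontier_null_imp_far:
  assumes I: "circ_measurable I" and null: "ang ((top_of_set circ) frontier_of I) \<in> null_sets lebesgue"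
    and ne: "I \<noteq> {}"
  shows "AE t in mu. cis t \<notin> I \<longrightarrow> infdist (cis t) I > 0"
proof -
  have sub: "I \<subseteq> circ" using I by (simp add: circ_measurable_def)
  have "AE t in lebesgue. t \<in> {0..<2*pi} \<longrightarrow> t \<notin> ang ((top_of_set circ) frontier_of I)"
    using AE_not_in[OF null] by eventually_elim simp
  then have "AE t in mu. t \<notin> ang ((top_of_set circ) frontier_of I)"
    by (simp only: AE_mu_iff)
  with AE_space show ?thesis
  proof eventually_elim
    case (elim t)
    show ?case
    proof
      assume t: "cis t \<notin> I"
      have "cis t \<notin> (top_of_set circ) frontier_of I" using elim in_ang_iff by blast
      moreover have "cis t \<notin> (top_of_set circ) interior_of I"
        using t interior_of_subset[of "top_of_set circ" I] by auto
      ultimately have "cis t \<notin> (top_of_set circ) closure_of I" by (simp add: frontier_of_def)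
      then have "cis t \<notin> closure I"
        using sub by (simp add: closure_of_subtopology Int_absorb1 circ_in)
      then show "infdist (cis t) I > 0"
        using in_closure_iff_infdist_zero[OF ne] infdist_nonneg[of "cis t" I] by (simp add: order_less_le)
    qed
  qed
qed

section \<open>Choice of the slack set and conclusion\<close>

theorem mainTheorem3:
  fixes I J :: "complex set" and f g0 :: "complex \<Rightarrow> complex"
  assumes "circ_measurable I"
    and "J = circ - I"
    and "ell I > 0" and "ell J > 0"
    and "ang ((top_of_set circ) frontier_of I) \<in> null_sets lebesgue"
    and "L2_on I f"
    and "BEP_solution I f g0"
  shows "AE_on J (\<lambda>z. cmod (g0 z) = 1) \<or>
         (\<exists>g. H2 g \<and> AE_on J (\<lambda>z. cmod (g z) \<le> 1) \<and> AE_on I (\<lambda>z. f z = g z))"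
proof (cases "AE_on J (\<lambda>z. cmod (g0 z) = 1)")
  case False
  define F where "F = (\<lambda>t. indicator (ang I) t *\<^sub>R (cnj (f (cis t) - g0 (cis t)) * g0 (cis t)))"
  interpret bep_variation I f g0 F
    by unfold_locales (fact assms | rule eq_reflection[OF F_def])+
  have A: "ang I \<in> sets mu" by (rule circ_measurable_ang[OF I])
  have g0H: "H2 g0" and g01: "AE t in mu. cis t \<notin> I \<longrightarrow> cmod (g0 (cis t)) \<le> 1"
    using sol by (auto simp: BEP_solution_def AE_on_mu circ_in)
  have g0m: "(\<lambda>t. g0 (cis t)) \<in> borel_measurable mu" using g0H by (simp add: H2_mu)
  have ne: "I \<noteq> {}" using assms(3) by (auto simp: ell_def ang_def)
  \<comment> \<open>One index measures both the slack of \<open>g0\<close> and the distance from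
    \<open>I\<close>. Up to a null set these sets exhaust the part of \<open>J\<close> where
    \<open>cmod (g0 z) < 1\<close>, so they cannot all be null.\<close>
  define E where "E n = {t \<in> space mu. cis t \<notin> I \<and> cmod (g0 (cis t)) \<le> 1 - 1 / real (Suc n) \<and>
      1 / real (Suc n) \<le> infdist (cis t) I}" for n
  have Em: "E n \<in> sets mu" for n
  proof -
    have "E n = (space mu - ang I) \<inter> {t \<in> space mu. cmod (g0 (cis t)) \<le> 1 - 1 / real (Suc n)} \<inter>
        {t \<in> space mu. 1 / real (Suc n) \<le> infdist (cis t) I}"
      by (auto simp: E_def ang_def)
    moreover have [measurable]: "(\<lambda>t. infdist (cis t) I) \<in> borel_measurable mu"
      by (intro measurable_mu_borel borel_measurable_continuous_onI continuous_intros)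
    have [measurable]: "(\<lambda>t. g0 (cis t)) \<in> borel_measurable mu" by (rule g0m)
    have "{t \<in> space mu. cmod (g0 (cis t)) \<le> 1 - 1 / real (Suc n)} \<in> sets mu" by measurable
    moreover have "{t \<in> space mu. 1 / real (Suc n) \<le> infdist (cis t) I} \<in> sets mu" by measurable
    ultimately show ?thesis using sets.compl_sets[OF A] by (simp only: sets.Int)
  qed
  have "\<exists>n. measure mu (E n) > 0"
  proof (rule ccontr)
    assume "\<not> ?thesis"
    then have "measure mu (E n) = 0" for n by (simp add: zero_less_measure_iff)
    then have "E n \<in> null_sets mu" for n
      using Em by (simp add: null_sets_def mu.emeasure_eq_measure)
    then have "AE t in mu. t \<notin> E n" for n by (rule AE_not_in)
    then have "AE t in mu. \<forall>n. t \<notin> E n" by (simp add: AE_all_countable)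
    with g01 frontier_null_imp_far[OF I assms(5) ne] AE_space
    have "AE t in mu. cis t \<in> J \<longrightarrow> cmod (g0 (cis t)) = 1"
    proof eventually_elim
      case (elim t)
      show ?case
      proof (rule impI, rule ccontr)
        assume t: "cis t \<in> J" "cmod (g0 (cis t)) \<noteq> 1"
        with elim assms(2) have "cmod (g0 (cis t)) < 1" "infdist (cis t) I > 0" by auto
        then have "min (1 - cmod (g0 (cis t))) (infdist (cis t) I) > 0" by simp
        then obtain n where "1 / real (Suc n) < min (1 - cmod (g0 (cis t))) (infdist (cis t) I)"
          by (rule nat_approx_posE)
        then have "cmod (g0 (cis t)) \<le> 1 - 1 / real (Suc n)" "1 / real (Suc n) \<le> infdist (cis t) I"
          by linarith+
        moreover have "t \<in> space mu" "cis t \<notin> I" using elim t assms(2) by auto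
        ultimately have "t \<in> E n" unfolding E_def by blast
        then show False using elim by blast
      qed
    qed
    then show False using False by (simp add: AE_on_mu)
  qed
  then obtain n where n: "measure mu (E n) > 0" by blast
  have "AE t in mu. Im (F t) = 0"
  proof (rule F_real[OF Em n])
    show "1 / real (Suc n) \<le> dist x (cis t)" if "t \<in> E n" "x \<in> I" for t x
      using that infdist_le[of x I "cis t"] by (auto simp: E_def dist_commute)
  qed (auto simp: E_def)
  then have F0: "AE t in mu. F t = 0" by (rule F_zero)
  \<comment> \<open>By the uniqueness theorem \<open>g0\<close> is either zero or nonzero almost
    everywhere; only in the second case can it be cancelled from \<open>F t = 0\<close>.\<close>
  have "AE t in mu. cis t \<in> I \<longrightarrow> f (cis t) = g0 (cis t)"
  proof (cases "AE t in mu. g0 (cis t) = 0")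
    case True
    have "{0..<2*pi} - ang I = ang J" using assms(2) by (auto simp: ang_def circ_in)
    then have "measure mu ({0..<2*pi} - ang I) > 0"
      using assms(4) unfolding mu_def
      by (subst measure_restrict_space) (auto simp: ell_def ang_def zero_less_divide_iff)
    from eq_on_I_of_zero[OF True this] True show ?thesis
      by eventually_elim simp
  next
    case False
    define B where "B = {t \<in> space mu. g0 (cis t) = 0}"
    have B: "B \<in> sets mu" unfolding B_def using g0m by measurable
    have "\<not> measure mu B > 0"
    proof
      assume pos: "measure mu B > 0"
      have "AE t in mu. g0 (cis t) = 0"
        by (rule AE_zero_of_analytic_zero_set[OF H2_integrable[OF g0H] _ B pos])
           (use g0H in \<open>auto simp: H2_mu B_def\<close>)
      with False show False by blast
    qed
    then have "measure mu B = 0" by (simp add: zero_less_measure_iff)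
    then have "B \<in> null_sets mu" using B by (simp add: null_sets_def mu.emeasure_eq_measure)
    from AE_not_in[OF this] F0 AE_space show ?thesis
      by eventually_elim (auto simp: B_def F_def in_ang_iff ang_def)
  qed
  then have "AE_on I (\<lambda>z. f z = g0 z)" by (simp add: AE_on_mu)
  moreover have "AE_on J (\<lambda>z. cmod (g0 z) \<le> 1)"
    using sol assms(2) by (simp add: BEP_solution_def)
  ultimately show ?thesis using g0H by blast
qed simp

end
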